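(* Let $X$ be a quasi-Polish space, let $k$ be a positive integer, let $Q=\bar k=\{0,\ldots,k-1\}$ be the antichain with $k$ elements, and let $T\in\mathcal{T}_{\omega_1}(Q)$. Then $\mathcal{W}(X,T)=\mathcal{L}(X,T)$.
   Context: Trees. $\omega^*$ is the set of finite strings over $\omega$, $\varepsilon$ the empty string, $\sqsubseteq$ the prefix order. A tree is a non-empty prefix-closed $T\subseteq\omega^*$; it is well founded if it has no infinite path, and infinite-branching if every non-leaf $\tau\in T$ has $\tau i\in T$ for all $i<\omega$. Terms. For a quasiorder $Q$, $\mathbb{T}_\sigma$ is the set of variable-free terms defined inductively from constants $q\in Q$, unary symbols $s_\alpha$ ($\alpha<\omega_1$) and $\omega$-ary symbols $F_q$ ($q\in Q$) and $F_\alpha$ ($\alpha<\omega_1$), all symbols being distinct. To each $u\in\mathbb{T}_\sigma$ one associates an infinite-branching well founded tree $T$ with a labeling $t$ of its nodes by terms, written $T(u)=(T,t)$: $T(q)$ and $T(s_\alpha(u))$ are the one-node tree $\{\varepsilon\}$ labeled by $q$, resp. by $s_\alpha(u)$; $T(F_q(u_0,u_1,\ldots))$ has root labeled $q$, and its labeled subtree above the node $i$ is $T(u_i)$ for each $i\ge0$; $T(F_\alpha(u_0,u_1,\ldots))$ has root labeled $s_\alpha(u_0)$, and its labeled subtree above the node $i$ is $T(u_{i+1})$ for each $i\ge0$. $\mathcal{T}_{\omega_1}(Q)$ is the set of all infinite-branching well founded trees labeled by terms that are constants or of the form $s_\alpha(u)$; $u\mapsto T(u)$ is a bijection of $\mathbb{T}_\sigma$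 onto it, and for $T=T(u)$ one writes $\mathcal{L}(X,T)=\mathcal{L}(X,u)$ and $\Sigma_T=\Sigma_u$ (defined below). Bases. A base in a set $X$ is a sequence $\mathcal{L}(X)=\{\mathcal{L}_\alpha(X)\}_{\alpha<\omega_1}$ of subsets of $P(X)$, each closed under countable unions and finite intersections, such that for $\alpha<\beta$ all sets of $\mathcal{L}_\alpha$ and their complements belong to $\mathcal{L}_\beta$. The $\beta$-shift is the base $\mathcal{L}^\beta(X)=\{\mathcal{L}_{\beta+\alpha}(X)\}_{\alpha<\omega_1}$; for $U\subseteq X$, the $U$-restriction $\mathcal{L}(U)$ is the base in $U$ with levels $\{U\cap S\mid S\in\mathcal{L}_\alpha(X)\}$. Here $\mathcal{L}(X)$ is the Borel base $\{\mathbf{\Sigma}^0_{1+\alpha}(X)\}_{\alpha<\omega_1}$, where $\mathbf{\Sigma}^0_1$ is the class of open sets, $\mathbf{\Sigma}^0_2$ the class of countable unions of differences of open sets, and, for $\alpha>2$, $\mathbf{\Sigma}^0_\alpha$ the class of countable unions of complements of sets in $\bigcup_{\beta<\alpha}\mathbf{\Sigma}^0_\beta$. Families. For a well founded tree $T$, a $T$-family $\{U_\tau\}_{\tau\in T}$ of subsets of $X$ is monotone if $U_\tau\supseteq U_{\tau'}$ whenever $\tau\sqsubseteq\tau'$ in $T$; its components are $\tilde U_\tau=U_\tau\setminus\bigcup\{U_{\tau'}\mid\tau\sqsubset\tau'\in T\}$. The notions "$F$ is a $u$-family in $\mathcal{L}(X)$" and "$F$ determines $A:X\to Q$" are defined by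 induction, simultaneously for all bases: (i) the only $q$-family is $\{X\}$, and it determines exactly the constant function $\lambda x.q$; (ii) an $s_\alpha(u)$-family in $\mathcal{L}(X)$ is a $u$-family in $\mathcal{L}^{\omega^\alpha}(X)$, and it determines $A$ iff it determines $A$ as a $u$-family in $\mathcal{L}^{\omega^\alpha}(X)$; (iii) if $u=F_q(u_0,\ldots)$ or $u=F_\alpha(u_0,\ldots)$ and $T(u)=(T,t)$, a $u$-family is a pair $(\{U_\tau\}_{\tau\in T},\{F_\tau\}_{\tau\in T})$ where $\{U_\tau\}$ is a monotone $T$-family of $\mathcal{L}_0(X)$-sets with $U_\varepsilon=X$ and each $F_\tau$ is a $t(\tau)$-family in $\mathcal{L}(\tilde U_\tau)$; it determines $A$ iff $F_\tau$ determines $A|_{\tilde U_\tau}$ for every $\tau\in T$. $\mathcal{L}(X,u)$ is the set of all $A:X\to Q$ determined by some $u$-family in $\mathcal{L}(X)$. Wadge hierarchy. $\mathcal{N}=\omega^\omega$ is the Baire space. For $A,B:\mathcal{N}\to Q$, $A\le_W B$ means that there is a continuous $f:\mathcal{N}\to\mathcal{N}$ with $A(x)\le_Q B(f(x))$ for all $x$. For a non-empty closed $C\subseteq\mathcal{N}$, a function $A:C\to Q$ is identified with $A\circ r:\mathcal{N}\to Q$, where $r$ is a fixed continuous retraction of $\mathcal{N}$ onto $C$; for a non-empty open $U\subseteq\mathcal{N}$, a function $A:U\to Q$ is identified with $A\circ h:\mathcal{N}\to Q$ for a fixed homeomorphism $h:\mathcal{N}\to U$. The classes $\Sigma_u\subseteq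 Q^{\mathcal{N}}$, $u\in\mathbb{T}_\sigma$, are defined by induction: (1) $\Sigma_q=\{\lambda x.q\}$; (2) $\Sigma_{s_\alpha(u)}$ consists of all $A\circ g$ with $A\in\Sigma_u$ and $g:\mathcal{N}\to\mathcal{N}$ being $\mathbf{\Sigma}^0_{1+\omega^\alpha}$-measurable (preimages of open sets are $\mathbf{\Sigma}^0_{1+\omega^\alpha}$); (3) $\Sigma_{F_q(u_0,\ldots)}$ consists of all $A\in Q^{\mathcal{N}}$ such that for some pairwise disjoint non-empty open sets $U_0,U_1,\ldots$ not exhausting $\mathcal{N}$, $A$ is constantly $q$ on $V=\mathcal{N}\setminus\bigcup_iU_i$ and $A|_{U_i}\in\Sigma_{u_i}$ for all $i\ge0$; (4) $\Sigma_{F_\alpha(u_0,\ldots)}$ consists of all $A\in Q^{\mathcal{N}}$ such that for some pairwise disjoint non-empty open sets $U_1,U_2,\ldots$ not exhausting $\mathcal{N}$, $A|_V\in\Sigma_{s_\alpha(u_0)}$ for $V=\mathcal{N}\setminus\bigcup_{i\ge1}U_i$, and $A|_{U_i}\in\Sigma_{u_i}$ for all $i\ge1$. The level of the $Q$-Wadge hierarchy in $\mathcal{N}$ given by $T$ is $\mathcal{W}(\mathcal{N},T)=\{A\in Q^{\mathcal{N}}\mid A\le_W B\text{ for some }B\in\Sigma_T\}$. A quasi-Polish space is a space homeomorphic to a $\mathbf{\Pi}^0_2$-subspace (complement of a $\mathbf{\Sigma}^0_2$-set) of $P(\omega)$ with the Scott topology, whose basic open sets are $\{A\subseteq\omega\mid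 F\subseteq A\}$ for finite $F\subseteq\omega$. For a quasi-Polish space $X$ one fixes a continuous open surjection $\xi:\mathcal{N}\to X$ and sets $\mathcal{W}(X,T)=\{A:X\to Q\mid A\circ\xi\in\mathcal{W}(\mathcal{N},T)\}$. *)

theory Defs
  imports "HOL-Analysis.Analysis" "HOL-Library.Sublist" "HOL-Library.Countable_Set_Type"
begin

section \<open>Countable ordinals\<close>

typedef omega1 = "Field (cardSuc natLeq)"
  using Field_cardSuc_not_empty[OF natLeq_Card_order] by blast

lemma Well_order_cardSuc_natLeq: "Well_order (cardSuc natLeq)"
  by (rule cardSuc_Well_order[OF natLeq_Card_order])

instantiation omega1 :: ord
begin

definition less_eq_omega1 :: "omega1 \<Rightarrow> omega1 \<Rightarrow> bool" where
  "x \<le> y \<longleftrightarrow> (Rep_omega1 x, Rep_omega1 y) \<in> cardSuc natLeq"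

definition less_omega1 :: "omega1 \<Rightarrow> omega1 \<Rightarrow> bool" where
  "x < y \<longleftrightarrow> x \<le> y \<and> x \<noteq> (y :: omega1)"

instance ..

end

instance omega1 :: linorder
proof
  let ?r = "cardSuc natLeq"
  have refl: "refl_on (Field ?r) ?r" and trans: "trans ?r" and anti: "antisym ?r"
    and tot: "total_on (Field ?r) ?r"
    using Well_order_cardSuc_natLeq
    by (auto simp: well_order_on_def linear_order_on_def partial_order_on_def preorder_on_def)
  fix x y z :: omega1
  show "x \<le> x" for x :: omega1
    using refl Rep_omega1[of x] by (auto simp: less_eq_omega1_def refl_on_def)
  show "x \<le> y \<Longrightarrow> y \<le> z \<Longrightarrow> x \<le> z"
    using trans by (auto simp: less_eq_omega1_def dest: transD)
  show anti': "x \<le> y \<Longrightarrow> y \<le> x \<Longrightarrow> x = y" for x y :: omega1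
    using anti by (auto simp: less_eq_omega1_def Rep_omega1_inject dest: antisymD)
  show "x \<le> y \<or> y \<le> x"
    using tot refl Rep_omega1[of x] Rep_omega1[of y]
    by (cases "x = y")
      (auto simp: less_eq_omega1_def total_on_def refl_on_def Rep_omega1_inject)
  show "x < y \<longleftrightarrow> x \<le> y \<and> \<not> y \<le> x"
    using anti' \<open>\<And>x::omega1. x \<le> x\<close> by (auto simp: less_omega1_def)
qed

instance omega1 :: wellorder
proof (rule wf_wellorderI)
  let ?r = "cardSuc natLeq"
  have "{(x, y). x < y} = inv_image (?r - Id) Rep_omega1"
    by (auto simp: less_omega1_def less_eq_omega1_def inv_image_def Rep_omega1_inject)
  then show "wf {(x::omega1, y). x < y}"
    using Well_order_cardSuc_natLeq by (simp add: wf_inv_image well_order_on_def)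
qed intro_classes

lemma countable_lessThan_omega1:
  includes cardinal_syntax
  shows "countable {..<a :: omega1}"
proof -
  let ?r = "cardSuc natLeq"
  have "Rep_omega1 ` {..<a} \<subseteq> underS ?r (Rep_omega1 a)"
    by (auto simp: underS_def less_omega1_def less_eq_omega1_def Rep_omega1_inject)
  moreover have "|underS ?r (Rep_omega1 a)| <o ?r"
    by (rule card_of_underS[OF cardSuc_Card_order[OF natLeq_Card_order] Rep_omega1])
  then have "|underS ?r (Rep_omega1 a)| \<le>o natLeq"
    using cardSuc_ordLeq_ordLess[OF natLeq_Card_order card_of_Card_order] by blast
  then have "countable (underS ?r (Rep_omega1 a))"
    by (simp add: countable_card_le_natLeq)
  ultimately have "countable (Rep_omega1 ` {..<a})"
    using countable_subset by blast
  moreover have "inj_on Rep_omega1 {..<a}"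
    by (simp add: inj_on_def Rep_omega1_inject)
  ultimately show ?thesis
    using countable_image_inj_eq by blast
qed

lemma uncountable_omega1:
  includes cardinal_syntax
  shows "uncountable (UNIV :: omega1 set)"
proof
  assume "countable (UNIV :: omega1 set)"
  then have "countable (Field (cardSuc natLeq))"
    using type_definition.Rep_range[OF type_definition_omega1] countable_image by metis
  then have "|Field (cardSuc natLeq)| \<le>o natLeq"
    by (simp add: countable_card_le_natLeq)
  then have "cardSuc natLeq \<le>o natLeq"
    using card_of_Field_ordIso[OF cardSuc_Card_order[OF natLeq_Card_order]]
      ordIso_ordLeq_trans ordIso_symmetric by blast
  then show False
    using cardSuc_greater[OF natLeq_Card_order] not_ordLess_ordLeq by blast
qed

text \<open>Countable sets are strictly bounded, so the \<^term>\<open>Least\<close>s below are attained.\<close>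

lemma countable_bounded_omega1:
  assumes "countable (A :: omega1 set)"
  shows "\<exists>b. \<forall>a\<in>A. a < b"
proof (rule ccontr)
  assume "\<nexists>b. \<forall>a\<in>A. a < b"
  then have "UNIV = (\<Union>a\<in>A. insert a {..<a})"
    by (auto simp: not_less le_less)
  moreover have "countable (\<Union>a\<in>A. insert a {..<a})"
    using assms countable_lessThan_omega1 by (intro countable_UN) auto
  ultimately show False
    using uncountable_omega1 by simp
qed

function oadd :: "omega1 \<Rightarrow> omega1 \<Rightarrow> omega1" where
  "oadd a b = (LEAST c. a \<le> c \<and> (\<forall>b'<b. oadd a b' < c))"
  by auto
termination
  by (relation "inv_image {(x, y). x < y} snd") (auto intro: wf wf_inv_image)

declare oadd.simps [simp del]

instantiation omega1 :: "{zero, one, plus}"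
begin

definition zero_omega1 :: omega1 where "0 = (LEAST a :: omega1. True)"
definition one_omega1 :: omega1 where "1 = (LEAST a :: omega1. 0 < a)"
definition plus_omega1 :: "omega1 \<Rightarrow> omega1 \<Rightarrow> omega1" where "a + b = oadd a b"

instance ..

end

text \<open>\<open>omega_pow a\<close> is \<open>\<omega>\<^sup>a\<close>, the least upper bound of \<open>1\<close> and all \<open>\<omega>\<^sup>b \<cdot> n\<close>, \<open>b < a\<close>, \<open>n < \<omega>\<close>.\<close>

function omega_pow :: "omega1 \<Rightarrow> omega1" where
  "omega_pow a = (LEAST c. 0 < c \<and> (\<forall>b<a. \<forall>n. ((\<lambda>x. x + omega_pow b) ^^ n) 0 < c))"
  by auto
termination
  by (relation "{(x, y). x < y}") (auto intro: wf)

declare omega_pow.simps [simp del]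


section \<open>Terms and labeled trees\<close>

datatype 'q trm =
    is_Const: Const 'q
  | is_S: S omega1 "'q trm"
  | is_FQ: FQ 'q "nat \<Rightarrow> 'q trm"
  | is_FA: FA omega1 "nat \<Rightarrow> 'q trm"

definition terms :: "'q set \<Rightarrow> 'q trm set" where
  "terms Q = {u. set_trm u \<subseteq> Q}"

type_synonym 'q ltree = "nat list \<Rightarrow> 'q trm option"

primrec tree_of :: "'q trm \<Rightarrow> 'q ltree" where
  "tree_of (Const q) = (\<lambda>\<tau>. if \<tau> = [] then Some (Const q) else None)"
| "tree_of (S \<alpha> u) = (\<lambda>\<tau>. if \<tau> = [] then Some (S \<alpha> u) else None)"
| "tree_of (FQ q us) = (\<lambda>\<tau>. case \<tau> of [] \<Rightarrow> Some (Const q) | i # \<sigma> \<Rightarrow> tree_of (us i) \<sigma>)"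
| "tree_of (FA \<alpha> us) = (\<lambda>\<tau>. case \<tau> of [] \<Rightarrow> Some (S \<alpha> (us 0)) | i # \<sigma> \<Rightarrow> tree_of (us (Suc i)) \<sigma>)"

definition is_tree :: "nat list set \<Rightarrow> bool" where
  "is_tree T \<longleftrightarrow> T \<noteq> {} \<and> (\<forall>\<tau>\<in>T. \<forall>\<sigma>. prefix \<sigma> \<tau> \<longrightarrow> \<sigma> \<in> T)"

definition well_founded_tree :: "nat list set \<Rightarrow> bool" where
  "well_founded_tree T \<longleftrightarrow> \<not> (\<exists>p :: nat \<Rightarrow> nat. \<forall>n. map p [0..<n] \<in> T)"

definition infinite_branching :: "nat list set \<Rightarrow> bool" where
  "infinite_branching T \<longleftrightarrow>
     (\<forall>\<tau>\<in>T. (\<exists>\<sigma>\<in>T. strict_prefix \<tau> \<sigma>) \<longrightarrow> (\<forall>i. \<tau> @ [i] \<in> T))"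

definition ltrees :: "'q set \<Rightarrow> 'q ltree set" where
  "ltrees Q = {T. is_tree (dom T) \<and> well_founded_tree (dom T) \<and> infinite_branching (dom T) \<and>
                  (\<forall>t\<in>ran T. t \<in> terms Q \<and> (is_Const t \<or> is_S t))}"

text \<open>The inverse of the bijection \<open>u \<mapsto> T(u)\<close> from \<^term>\<open>terms Q\<close> onto \<^term>\<open>ltrees Q\<close>.\<close>

definition term_of :: "'q set \<Rightarrow> 'q ltree \<Rightarrow> 'q trm" where
  "term_of Q T = (THE u. u \<in> terms Q \<and> tree_of u = T)"


section \<open>Bases and families\<close>

text \<open>The class \<open>\<Sigma>\<^sup>0\<^sub>\<alpha>(X)\<close> for \<open>\<alpha> \<ge> 1\<close>, in the version suitable for non-metrizable spaces.\<close>

inductive Sigma0 :: "'a topology \<Rightarrow> omega1 \<Rightarrow> 'a set \<Rightarrow> bool" for X where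
  opn: "openin X U \<Longrightarrow> Sigma0 X 1 U"
| diff: "(\<And>n :: nat. openin X (A n)) \<Longrightarrow> (\<And>n. openin X (B n)) \<Longrightarrow>
    Sigma0 X (1 + 1) (\<Union>n. A n - B n)"
| compl: "1 + 1 < \<alpha> \<Longrightarrow> (\<And>n :: nat. 0 < \<beta> n \<and> \<beta> n < \<alpha>) \<Longrightarrow> (\<And>n. Sigma0 X (\<beta> n) (A n)) \<Longrightarrow>
    Sigma0 X \<alpha> (\<Union>n. topspace X - A n)"

type_synonym 'a base = "omega1 \<Rightarrow> 'a set set"

definition borel_base :: "'a topology \<Rightarrow> 'a base" where
  "borel_base X = (\<lambda>\<alpha>. {A. Sigma0 X (1 + \<alpha>) A})"

definition shift_base :: "omega1 \<Rightarrow> 'a base \<Rightarrow> 'a base" where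
  "shift_base \<beta> L = (\<lambda>\<alpha>. L (\<beta> + \<alpha>))"

definition restrict_base :: "'a set \<Rightarrow> 'a base \<Rightarrow> 'a base" where
  "restrict_base U L = (\<lambda>\<alpha>. (\<inter>) U ` L \<alpha>)"

definition monotone_family :: "nat list set \<Rightarrow> (nat list \<Rightarrow> 'a set) \<Rightarrow> bool" where
  "monotone_family T U \<longleftrightarrow> (\<forall>\<sigma>\<in>T. \<forall>\<tau>\<in>T. prefix \<sigma> \<tau> \<longrightarrow> U \<tau> \<subseteq> U \<sigma>)"

definition cpt :: "nat list set \<Rightarrow> (nat list \<Rightarrow> 'a set) \<Rightarrow> nat list \<Rightarrow> 'a set" where
  "cpt T U \<tau> = U \<tau> - \<Union> {U \<sigma> |\<sigma>. \<sigma> \<in> T \<and> strict_prefix \<tau> \<sigma>}"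

text \<open>\<open>Single X\<close> is the family \<open>{X}\<close>. In \<open>Nest U F\<close> only the values of \<open>U\<close> and \<open>F\<close> on the nodes of
  the tree at hand matter.\<close>

datatype 'a family = Single "'a set" | Nest "nat list \<Rightarrow> 'a set" "nat list \<Rightarrow> 'a family"

text \<open>\<open>is_family u X L F\<close>: \<open>F\<close> is a \<open>u\<close>-family in the base \<open>L\<close> in the set \<open>X\<close>.\<close>

inductive is_family :: "'q trm \<Rightarrow> 'a set \<Rightarrow> 'a base \<Rightarrow> 'a family \<Rightarrow> bool" where
  "is_family (Const q) X L (Single X)"
| "is_family u X (shift_base (omega_pow \<alpha>) L) F \<Longrightarrow> is_family (S \<alpha> u) X L F"
| "is_FQ u \<or> is_FA u \<Longrightarrow>
   monotone_family (dom (tree_of u)) U \<Longrightarrow>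
   (\<And>\<tau>. \<tau> \<in> dom (tree_of u) \<Longrightarrow> U \<tau> \<in> L 0) \<Longrightarrow>
   U [] = X \<Longrightarrow>
   (\<And>\<tau> t. tree_of u \<tau> = Some t \<Longrightarrow>
      is_family t (cpt (dom (tree_of u)) U \<tau>)
        (restrict_base (cpt (dom (tree_of u)) U \<tau>) L) (F \<tau>)) \<Longrightarrow>
   is_family u X L (Nest U F)"

text \<open>\<open>determines u X L F A\<close>: the \<open>u\<close>-family \<open>F\<close> in \<open>L\<close> determines \<open>A\<close>. Functions on \<open>X\<close> are
  represented by their extensional versions.\<close>

inductive determines ::
  "'q trm \<Rightarrow> 'a set \<Rightarrow> 'a base \<Rightarrow> 'a family \<Rightarrow> ('a \<Rightarrow> 'q) \<Rightarrow> bool" where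
  "determines (Const q) X L (Single X) (\<lambda>x\<in>X. q)"
| "determines u X (shift_base (omega_pow \<alpha>) L) F A \<Longrightarrow> determines (S \<alpha> u) X L F A"
| "is_FQ u \<or> is_FA u \<Longrightarrow>
   A \<in> extensional X \<Longrightarrow>
   (\<And>\<tau> t. tree_of u \<tau> = Some t \<Longrightarrow>
      determines t (cpt (dom (tree_of u)) U \<tau>)
        (restrict_base (cpt (dom (tree_of u)) U \<tau>) L) (F \<tau>)
        (restrict A (cpt (dom (tree_of u)) U \<tau>))) \<Longrightarrow>
   determines u X L (Nest U F) A"

definition level :: "'q set \<Rightarrow> 'a set \<Rightarrow> 'a base \<Rightarrow> 'q trm \<Rightarrow> ('a \<Rightarrow> 'q) set" where
  "level Q X L u = {A \<in> X \<rightarrow>\<^sub>E Q. \<exists>F. is_family u X L F \<and> determines u X L F A}"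

definition tree_level :: "'q set \<Rightarrow> 'a topology \<Rightarrow> 'q ltree \<Rightarrow> ('a \<Rightarrow> 'q) set" where
  "tree_level Q X T = level Q (topspace X) (borel_base X) (term_of Q T)"


section \<open>The Wadge hierarchy\<close>

type_synonym baire = "nat \<Rightarrow> nat"

definition wadge_le :: "('q \<Rightarrow> 'q \<Rightarrow> bool) \<Rightarrow> (baire \<Rightarrow> 'q) \<Rightarrow> (baire \<Rightarrow> 'q) \<Rightarrow> bool" where
  "wadge_le le A B \<longleftrightarrow> (\<exists>f. continuous_on UNIV f \<and> (\<forall>x. le (A x) (B (f x))))"

definition Sigma0_measurable :: "omega1 \<Rightarrow> (baire \<Rightarrow> baire) \<Rightarrow> bool" where
  "Sigma0_measurable \<beta> g \<longleftrightarrow> (\<forall>U. open U \<longrightarrow> Sigma0 euclidean \<beta> (g -` U))"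

definition jump :: "omega1 \<Rightarrow> (baire \<Rightarrow> 'q) set \<Rightarrow> (baire \<Rightarrow> 'q) set" where
  "jump \<alpha> C = {A \<circ> g |A g. A \<in> C \<and> Sigma0_measurable (1 + omega_pow \<alpha>) g}"

definition open_pieces :: "(nat \<Rightarrow> baire set) \<Rightarrow> bool" where
  "open_pieces U \<longleftrightarrow> (\<forall>i. open (U i) \<and> U i \<noteq> {}) \<and> disjoint_family U \<and> (\<Union>i. U i) \<noteq> UNIV"

text \<open>The classes \<open>\<Sigma>\<^sub>u\<close>, relative to a choice \<open>r\<close> of retractions onto non-empty closed sets and a
  choice \<open>h\<close> of homeomorphisms onto non-empty open sets, through which functions on such sets are
  identified with functions on the Baire space. In the last clause \<open>U i\<close> plays the role of the
  set attached to \<open>u\<^sub>i\<^sub>+\<^sub>1\<close>.\<close>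

primrec Sigma_class ::
  "(baire set \<Rightarrow> baire \<Rightarrow> baire) \<Rightarrow> (baire set \<Rightarrow> baire \<Rightarrow> baire) \<Rightarrow> 'q trm \<Rightarrow> (baire \<Rightarrow> 'q) set"
where
  "Sigma_class r h (Const q) = {\<lambda>x. q}"
| "Sigma_class r h (S \<alpha> u) = jump \<alpha> (Sigma_class r h u)"
| "Sigma_class r h (FQ q us) =
     {A. \<exists>U. open_pieces U \<and> (\<forall>x \<in> - (\<Union>i. U i). A x = q) \<and>
             (\<forall>i. A \<circ> h (U i) \<in> Sigma_class r h (us i))}"
| "Sigma_class r h (FA \<alpha> us) =
     {A. \<exists>U. open_pieces U \<and> A \<circ> r (- (\<Union>i. U i)) \<in> jump \<alpha> (Sigma_class r h (us 0)) \<and>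
             (\<forall>i. A \<circ> h (U i) \<in> Sigma_class r h (us (Suc i)))}"

definition wadge_baire ::
  "(baire set \<Rightarrow> baire \<Rightarrow> baire) \<Rightarrow> (baire set \<Rightarrow> baire \<Rightarrow> baire) \<Rightarrow> 'q set \<Rightarrow> ('q \<Rightarrow> 'q \<Rightarrow> bool) \<Rightarrow>
   'q ltree \<Rightarrow> (baire \<Rightarrow> 'q) set" where
  "wadge_baire r h Q le T =
     {A \<in> UNIV \<rightarrow> Q. \<exists>B \<in> Sigma_class r h (term_of Q T). wadge_le le A B}"

definition wadge_level ::
  "(baire set \<Rightarrow> baire \<Rightarrow> baire) \<Rightarrow> (baire set \<Rightarrow> baire \<Rightarrow> baire) \<Rightarrow> (baire \<Rightarrow> 'a) \<Rightarrow>
   'q set \<Rightarrow> ('q \<Rightarrow> 'q \<Rightarrow> bool) \<Rightarrow> 'a topology \<Rightarrow> 'q ltree \<Rightarrow> ('a \<Rightarrow> 'q) set" where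
  "wadge_level r h \<xi> Q le X T = {A \<in> topspace X \<rightarrow>\<^sub>E Q. A \<circ> \<xi> \<in> wadge_baire r h Q le T}"


section \<open>Quasi-Polish spaces\<close>

definition scott_topology :: "nat set topology" where
  "scott_topology = topology_generated_by {{A. F \<subseteq> A} |F. finite F}"

definition quasi_polish :: "'a topology \<Rightarrow> bool" where
  "quasi_polish X \<longleftrightarrow>
     (\<exists>P. Sigma0 scott_topology (1 + 1) (- P) \<and> X homeomorphic_space subtopology scott_topology P)"

end

theory Submission
  imports Defs
begin

text \<open>
  All levels of both hierarchies are compared through one predicate, \<open>determined_on Z u b Y A\<close>. It is
  defined by recursion on the term \<open>u\<close> and says that some \<open>u\<close>-family over \<open>Y \<subseteq> Z\<close> with sets of level
  \<open>1 + b\<close> and above determines \<open>A\<close>. The components of a family on the tree of \<open>u\<close> can be computed in the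
  subtrees above the successors of the root, so \<open>\<L>(Z, u)\<close> consists of the \<open>A\<close> with
  \<open>determined_on Z u 0 Z A\<close> (\<open>level_borel_base\<close>). With \<open>\<N>\<close> the Baire space, it remains to prove that
  \<open>A \<circ> \<xi>\<close> is reducible to a function in \<open>\<Sigma>\<^sub>u\<close> iff \<open>A \<circ> \<xi>\<close> is determined on \<open>\<N>\<close>, and that this holds iff
  \<open>A\<close> is determined on \<open>X\<close>.

  Substitution gives the easy directions. A map that pulls open sets back to level \<open>1 + c\<close> pulls level
  \<open>1 + b\<close> back to level \<open>1 + (c + b)\<close>, hence it pulls families back with a shift by \<open>c\<close>
  (\<open>determined_on_pullback\<close>). For \<open>\<xi>\<close> and for continuous reductions \<open>c = 0\<close>; for the jumps in the
  definition of \<open>\<Sigma>\<^sub>u\<close> one has \<open>c = \<omega>\<^sup>\<alpha>\<close>. So functions in \<open>\<Sigma>\<^sub>u\<close>, and those reducible to them, are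
  determined.

  Conversely, let \<open>A\<close> be determined on \<open>\<N>\<close>. A shift by \<open>c\<close> is undone by a substitution: the sets of
  the family are generated by countably many ambiguous sets of level \<open>1 + c\<close>, and their characteristic
  functions form a map \<open>g\<close> with \<open>A = A' \<circ> g\<close> for some \<open>A'\<close> that is determined without the shift
  (\<open>determined_on_unshift\<close>). At this point the sets downstairs are made disjoint by the reduction
  property, which turns the partial information on the range of \<open>g\<close> into a total function. The open
  sets at a branching of \<open>u\<close> are treated by gluing: \<open>\<N>\<close> contains a universal sequence of disjoint
  open pieces, each of which is mapped continuously onto \<open>\<N>\<close> by its payload, and functions on the pieces
  are copied there. The classes \<open>\<Sigma>\<^sub>u\<close> are closed under composition with continuous surjections, so the
  copies are of the required kind (\<open>determined_on_imp_Sigma_class\<close>).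

  The descent from \<open>A \<circ> \<xi>\<close> to \<open>A\<close> uses Baire category. The fibres of \<open>\<xi>\<close> are \<open>G\<^sub>\<delta>\<close> sets, hence Baire
  spaces. A set \<open>W\<close> in \<open>\<N>\<close> is replaced by the set of those \<open>x\<close> for which \<open>W\<close> is non-meager in the fibre
  of \<open>x\<close>. Since \<open>\<xi>\<close> is open, this keeps the level of \<open>W\<close> (\<open>Sigma0_nonmeager_image\<close>). If \<open>Y\<close> is
  non-meager in the fibre of \<open>x\<close>, then so is one of the countably many parts into which a family splits
  \<open>Y\<close>; following these parts down the term, \<open>x\<close> reaches a component that meets its fibre, and the
  constant there is \<open>A x\<close> (\<open>determined_on_nonmeager_image\<close>).
\<close>

section \<open>Arithmetic of countable ordinals\<close>

lemma zero_le_omega1 [simp]: "0 \<le> (a :: omega1)"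
  unfolding zero_omega1_def by (rule Least_le) simp

lemma not_less_zero_omega1 [simp]: "\<not> (a :: omega1) < 0"
  by (simp add: not_less)

lemma zero_less_one_omega1: "0 < (1 :: omega1)"
proof -
  obtain b :: omega1 where "0 < b"
    using countable_bounded_omega1[of "{0}"] by auto
  then show ?thesis
    unfolding one_omega1_def by (rule LeastI)
qed

lemma one_le_iff_omega1: "1 \<le> (a :: omega1) \<longleftrightarrow> 0 < a"
  using zero_less_one_omega1 by (auto simp: one_omega1_def intro: Least_le)

text \<open>The supremum in the definition of the sum is attained since only countably many ordinals
  have to be bounded.\<close>

lemma add_omega1_bounds: "a \<le> a + b \<and> (\<forall>b'<b. a + b' < a + (b :: omega1))"
proof -
  have "countable (insert a ((\<lambda>b'. a + b') ` {..<b}))"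
    using countable_lessThan_omega1[of b] by simp
  then obtain c where "\<forall>x\<in>insert a ((\<lambda>b'. a + b') ` {..<b}). x < c"
    using countable_bounded_omega1 by meson
  then have "a \<le> c \<and> (\<forall>b'<b. oadd a b' < c)"
    by (auto simp: plus_omega1_def)
  then have "a \<le> oadd a b \<and> (\<forall>b'<b. oadd a b' < oadd a b)"
    unfolding oadd.simps[of a b] by (rule LeastI)
  then show ?thesis
    by (simp add: plus_omega1_def)
qed

lemma le_add_omega1 [simp]: "a \<le> a + (b :: omega1)"
  using add_omega1_bounds by blast

lemma add_strict_mono_omega1: "b' < b \<Longrightarrow> a + b' < a + (b :: omega1)"
  using add_omega1_bounds by blast

lemma add_mono_omega1: "b' \<le> b \<Longrightarrow> a + b' \<le> a + (b :: omega1)"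
  using add_strict_mono_omega1[of b' b a] by (cases "b' = b") (auto simp: less_le)

lemma add_least_omega1:
  assumes "a \<le> c" and "\<And>b'. b' < b \<Longrightarrow> a + b' < c"
  shows "a + b \<le> (c :: omega1)"
  unfolding plus_omega1_def oadd.simps[of a b] using assms
  by (intro Least_le) (auto simp: plus_omega1_def)

lemma less_add_cases_omega1:
  assumes "d < a + (b :: omega1)"
  shows "d < a \<or> (\<exists>b'<b. d \<le> a + b')"
  using assms add_least_omega1[of a d b] by (meson not_le)

text \<open>This serves as ordinal subtraction in the inductions over the Borel hierarchy.\<close>

lemma less_add_posE_omega1:
  assumes "d < a + (b :: omega1)" and "0 < b"
  shows "\<exists>b'<b. d \<le> a + b'"
  using less_add_cases_omega1[OF assms(1)] assms(2) le_add_omega1[of a 0]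
  by (meson less_imp_le order_trans)

lemma add_zero_omega1 [simp]: "a + 0 = (a :: omega1)"
  using add_least_omega1[of a a 0] by (auto intro: antisym)

lemma zero_add_omega1 [simp]: "0 + a = (a :: omega1)"
proof (induction a rule: less_induct)
  case (less a)
  have "0 + a \<le> a"
    using less by (intro add_least_omega1) auto
  moreover have "\<not> 0 + a < a"
    using less[of "0 + a"] add_strict_mono_omega1[of "0 + a" a 0] by auto
  ultimately show ?case
    by auto
qed

lemma add_assoc_omega1: "(a + b) + c = a + (b + (c :: omega1))"
proof (induction c rule: less_induct)
  case (less c)
  have "(a + b) + c \<le> a + (b + c)"
  proof (rule add_least_omega1)
    show "a + b \<le> a + (b + c)"
      by (simp add: add_mono_omega1)
    show "a + b + c' < a + (b + c)" if "c' < c" for c'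
      using less[OF that] add_strict_mono_omega1[OF add_strict_mono_omega1[OF that]] by simp
  qed
  moreover have "a + (b + c) \<le> (a + b) + c"
  proof (rule add_least_omega1)
    show "a \<le> a + b + c"
      using le_add_omega1[of a b] le_add_omega1[of "a + b" c] by (rule order_trans)
    fix d assume "d < b + c"
    then consider "d < b" | c' where "c' < c" "d \<le> b + c'"
      using less_add_cases_omega1 by blast
    then show "a + d < a + b + c"
    proof cases
      case 1
      then have "a + d < a + b"
        by (rule add_strict_mono_omega1)
      then show ?thesis
        using le_add_omega1 by (rule less_le_trans)
    next
      case 2
      then have "a + d \<le> a + b + c'"
        using less add_mono_omega1 by metis
      then show ?thesis
        using 2(1) add_strict_mono_omega1 le_less_trans by blast
    qed
  qed
  ultimately show ?case
    by auto
qed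

lemma omega_pow_pos: "0 < omega_pow a"
proof -
  let ?m = "\<lambda>b n. ((\<lambda>x. x + omega_pow b) ^^ n) 0"
  have "countable (insert 0 (\<Union>b\<in>{..<a}. range (?m b)))"
    using countable_lessThan_omega1[of a] by simp
  then obtain c where "\<forall>x\<in>insert 0 (\<Union>b\<in>{..<a}. range (?m b)). x < c"
    using countable_bounded_omega1 by meson
  then have "0 < c \<and> (\<forall>b<a. \<forall>n. ?m b n < c)"
    by auto
  then have "0 < (LEAST c. 0 < c \<and> (\<forall>b<a. \<forall>n. ?m b n < c)) \<and>
      (\<forall>b<a. \<forall>n. ?m b n < (LEAST c. 0 < c \<and> (\<forall>b<a. \<forall>n. ?m b n < c)))"
    by (rule LeastI)
  then show ?thesis
    unfolding omega_pow.simps[of a] by blast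
qed

lemma one_less_two_omega1: "1 < 1 + (1 :: omega1)"
  using add_strict_mono_omega1[OF zero_less_one_omega1, of 1] by simp

lemma less_two_omega1: "d < 1 + (1 :: omega1) \<Longrightarrow> d \<le> 1"
proof -
  assume "d < 1 + (1 :: omega1)"
  then obtain b :: omega1 where "b < 1" "d \<le> 1 + b"
    using less_add_posE_omega1 zero_less_one_omega1 by blast
  moreover have "b = 0"
    using \<open>b < 1\<close> one_le_iff_omega1[of b] by (auto simp: not_le[symmetric] intro: antisym)
  ultimately show ?thesis
    by simp
qed

lemma omega1_cases:
  assumes "0 < (a :: omega1)"
  obtains (one) "a = 1" | (two) "a = 1 + 1" | (more) "1 + 1 < a"
proof (cases "1 + 1 \<le> a")
  case False
  then have "a = 1"
    using assms less_two_omega1[of a] one_le_iff_omega1[of a] by auto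
  then show thesis
    by (rule one)
qed (use two more in \<open>auto simp: le_less\<close>)

lemma one_add_pos_omega1 [simp]: "0 < 1 + (a :: omega1)"
  using le_add_omega1[of 1 a] zero_less_one_omega1 less_le_trans by blast

section \<open>The Borel hierarchy of a topological space\<close>

lemma Sigma0_pos: "Sigma0 Z a A \<Longrightarrow> 0 < a"
  by (induction rule: Sigma0.induct) (simp_all add: zero_less_one_omega1, metis less_trans)

lemma Sigma0_subset: "Sigma0 Z a A \<Longrightarrow> A \<subseteq> topspace Z"
  by (induction rule: Sigma0.induct) (auto dest: openin_subset)

lemma Sigma0_oneD: "Sigma0 Z 1 A \<Longrightarrow> openin Z A"
  using one_less_two_omega1 by (auto elim: Sigma0.cases)

lemma Sigma0_one_iff: "Sigma0 Z 1 A \<longleftrightarrow> openin Z A"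
  using Sigma0_oneD Sigma0.opn by blast

lemma Sigma0_twoD:
  assumes "Sigma0 Z (1 + 1) A"
  shows "\<exists>B C. (\<forall>n :: nat. openin Z (B n) \<and> openin Z (C n)) \<and> A = (\<Union>n. B n - C n)"
  using assms
proof (cases rule: Sigma0.cases)
  case opn
  then show ?thesis
    using less_irrefl[of "1 :: omega1"] one_less_two_omega1 by metis
next
  case (diff B C)
  then show ?thesis
    by (intro exI[of _ B] exI[of _ C]) simp
qed simp

lemma Sigma0_moreD:
  assumes "Sigma0 Z a A" "1 + 1 < a"
  shows "\<exists>b B. (\<forall>n :: nat. 0 < b n \<and> b n < a \<and> Sigma0 Z (b n) (B n)) \<and>
    A = (\<Union>n. topspace Z - B n)"
  using assms(1)
proof (cases rule: Sigma0.cases)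
  case (compl b B)
  then show ?thesis
    by (intro exI[of _ b] exI[of _ B]) simp
qed (use assms(2) less_trans[OF one_less_two_omega1] in auto)

lemma Sigma0_diff_open: "openin Z A \<Longrightarrow> openin Z B \<Longrightarrow> Sigma0 Z (1 + 1) (A - B)"
  using Sigma0.diff[of Z "\<lambda>_. A" "\<lambda>_. B"] by simp

lemma Sigma0_compl_more:
  "1 + 1 < a \<Longrightarrow> b < a \<Longrightarrow> Sigma0 Z b A \<Longrightarrow> Sigma0 Z a (topspace Z - A)"
  using Sigma0.compl[of a "\<lambda>_. b" Z "\<lambda>_. A"] Sigma0_pos by auto

text \<open>Countable unions: at level two a double sequence has to be enumerated.\<close>

lemma Sigma0_UN_nat:
  assumes "\<And>n :: nat. Sigma0 Z a (A n)"
  shows "Sigma0 Z a (\<Union>n. A n)"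
  using Sigma0_pos[OF assms[of 0]]
proof (cases rule: omega1_cases)
  case one
  then show ?thesis
    using assms by (auto simp: Sigma0_one_iff)
next
  case two
  have "\<forall>n. \<exists>B C. (\<forall>m::nat. openin Z (B m) \<and> openin Z (C m)) \<and> A n = (\<Union>m. B m - C m)"
    using Sigma0_twoD assms unfolding two by blast
  then obtain B C where BC: "\<And>n m :: nat. openin Z (B n m)" "\<And>n m. openin Z (C n m)"
    "\<And>n. A n = (\<Union>m. B n m - C n m)"
    by metis
  have "(\<Union>n. A n) = (\<Union>k. case_prod B (prod_decode k) - case_prod C (prod_decode k))"
  proof (intro equalityI subsetI; elim UN_E)
    fix x n assume "x \<in> A n"
    then obtain m where "x \<in> B n m - C n m"
      using BC by blast
    then show "x \<in> (\<Union>k. case_prod B (prod_decode k) - case_prod C (prod_decode k))"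
      by (intro UN_I[of "prod_encode (n, m)"]) auto
  next
    fix x k assume "x \<in> case_prod B (prod_decode k) - case_prod C (prod_decode k)"
    then show "x \<in> (\<Union>n. A n)"
      using BC by (auto split: prod.splits)
  qed
  moreover have "Sigma0 Z (1 + 1) (\<Union>k. case_prod B (prod_decode k) - case_prod C (prod_decode k))"
    using BC(1,2) by (intro Sigma0.diff) (auto split: prod.splits)
  ultimately show ?thesis
    by (simp add: two)
next
  case more
  have "\<forall>n. \<exists>b B. (\<forall>m::nat. 0 < b m \<and> b m < a \<and> Sigma0 Z (b m) (B m)) \<and>
      A n = (\<Union>m. topspace Z - B m)"
    using Sigma0_moreD[OF assms more] by blast
  then obtain b B where B: "\<And>n m :: nat. 0 < b n m \<and> b n m < a \<and> Sigma0 Z (b n m) (B n m)"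
    "\<And>n. A n = (\<Union>m. topspace Z - B n m)"
    by metis
  have "(\<Union>n. A n) = (\<Union>k. topspace Z - case_prod B (prod_decode k))"
  proof (intro equalityI subsetI; elim UN_E)
    fix x n assume "x \<in> A n"
    then obtain m where "x \<in> topspace Z - B n m"
      using B by blast
    then show "x \<in> (\<Union>k. topspace Z - case_prod B (prod_decode k))"
      by (intro UN_I[of "prod_encode (n, m)"]) auto
  next
    fix x k assume "x \<in> topspace Z - case_prod B (prod_decode k)"
    then show "x \<in> (\<Union>n. A n)"
      using B(2) by (auto split: prod.splits)
  qed
  moreover have "Sigma0 Z a (\<Union>k. topspace Z - case_prod B (prod_decode k))"
    by (rule Sigma0.compl[OF more, where \<beta> = "\<lambda>k. case_prod b (prod_decode k)"])
      (use B(1) in \<open>auto split: prod.splits\<close>)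
  ultimately show ?thesis
    by simp
qed

lemma Sigma0_openin: "openin Z A \<Longrightarrow> 0 < a \<Longrightarrow> Sigma0 Z a A"
proof (cases rule: omega1_cases, assumption)
  assume A: "openin Z A"
  show "a = 1 \<Longrightarrow> Sigma0 Z a A"
    using A by (simp add: Sigma0_one_iff)
  show "a = 1 + 1 \<Longrightarrow> Sigma0 Z a A"
    using Sigma0_diff_open[OF A openin_empty] by simp
  assume "1 + 1 < a"
  then have "Sigma0 Z a (topspace Z - (topspace Z - A))"
    using Sigma0_compl_more[OF _ _ Sigma0_diff_open[OF openin_topspace A]] by blast
  then show "Sigma0 Z a A"
    using openin_subset[OF A] by (simp add: double_diff)
qed

lemma Sigma0_empty: "0 < a \<Longrightarrow> Sigma0 Z a {}"
  by (simp add: Sigma0_openin)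

lemma Sigma0_topspace: "0 < a \<Longrightarrow> Sigma0 Z a (topspace Z)"
  by (simp add: Sigma0_openin)

lemma Sigma0_UN:
  assumes "countable I" "0 < a" "\<And>i. i \<in> I \<Longrightarrow> Sigma0 Z a (A i)"
  shows "Sigma0 Z a (\<Union>i\<in>I. A i)"
proof (cases "I = {}")
  case False
  then have "(\<Union>i\<in>I. A i) = (\<Union>n. A (from_nat_into I n))"
    using range_from_nat_into[OF False assms(1)] by (metis image_image)
  then show ?thesis
    using Sigma0_UN_nat[of Z a "\<lambda>n. A (from_nat_into I n)"] assms(3) from_nat_into[OF False]
    by simp
qed (use assms(2) Sigma0_empty in auto)

lemma Sigma0_Un: "Sigma0 Z a A \<Longrightarrow> Sigma0 Z a B \<Longrightarrow> Sigma0 Z a (A \<union> B)"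
proof -
  assume AB: "Sigma0 Z a A" "Sigma0 Z a B"
  have "Sigma0 Z a (\<Union>C\<in>{A, B}. C)"
    by (rule Sigma0_UN) (use AB Sigma0_pos in auto)
  then show ?thesis
    by simp
qed

lemma Sigma0_mono:
  assumes "Sigma0 Z a A" "a \<le> b"
  shows "Sigma0 Z b A"
proof (cases "a = b")
  case False
  then have ab: "a < b"
    using assms(2) by simp
  show ?thesis
    using Sigma0_pos[OF assms(1)]
proof (cases rule: omega1_cases)
    case one
    then show ?thesis
      using assms(1) Sigma0_openin[of Z A b] less_trans[OF zero_less_one_omega1] ab
      by (simp add: Sigma0_one_iff)
  next
    case two
    obtain B C where BC: "\<forall>n :: nat. openin Z (B n) \<and> openin Z (C n)"
      "A = (\<Union>n. B n - C n)"
      using Sigma0_twoD assms(1) unfolding two by blast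
    have "B n - C n = topspace Z - ((topspace Z - B n) \<union> (C n - {}))" for n
      using BC(1) openin_subset[of Z "B n"] by blast
    then have "A = (\<Union>n. topspace Z - ((topspace Z - B n) \<union> (C n - {})))"
      unfolding BC(2) by (rule SUP_cong[OF refl])
    moreover have "Sigma0 Z b (topspace Z - ((topspace Z - B n) \<union> (C n - {})))" for n
      using ab unfolding two
      using BC(1) by (intro Sigma0_compl_more[of b "1 + 1"] Sigma0_Un Sigma0_diff_open) auto
    then have "Sigma0 Z b (\<Union>n. topspace Z - ((topspace Z - B n) \<union> (C n - {})))"
      by (rule Sigma0_UN_nat)
    ultimately show ?thesis
      by metis
  next
    case more
    obtain c and B :: "nat \<Rightarrow> _" where B:
      "\<forall>n. 0 < c n \<and> c n < a \<and> Sigma0 Z (c n) (B n)" "A = (\<Union>n. topspace Z - B n)"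
      using Sigma0_moreD[OF assms(1) more] by blast
    show ?thesis
      unfolding B(2) using B(1) ab more by (intro Sigma0.compl[of b c]) (auto intro: less_trans)
  qed
qed (use assms in auto)

lemma Sigma0_compl:
  assumes "Sigma0 Z a A" "a < b"
  shows "Sigma0 Z b (topspace Z - A)"
proof (cases "1 + 1 < b")
  case True
  then show ?thesis
    using Sigma0_compl_more[OF _ assms(2,1)] by simp
next
  case False
  have "1 \<le> a"
    using Sigma0_pos[OF assms(1)] by (simp add: one_le_iff_omega1)
  then have "b = 1 + 1"
    using False less_two_omega1[of b] assms(2) by (metis leD linorder_neqE order_trans)
  moreover from this have "a = 1"
    using less_two_omega1[of a] assms(2) \<open>1 \<le> a\<close> by simp
  ultimately show ?thesis
    using assms(1) Sigma0_diff_open by (metis Sigma0_one_iff openin_topspace)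
qed

lemma Sigma0_Int:
  assumes "Sigma0 Z a A" "Sigma0 Z a B"
  shows "Sigma0 Z a (A \<inter> B)"
  using Sigma0_pos[OF assms(1)]
proof (cases rule: omega1_cases)
  case one
  then show ?thesis
    using assms by (auto simp: Sigma0_one_iff)
next
  case two
  obtain C D where CD: "\<forall>n :: nat. openin Z (C n) \<and> openin Z (D n)"
      "A = (\<Union>n. C n - D n)"
      using Sigma0_twoD assms(1) unfolding two by blast
  obtain E F where EF: "\<forall>n :: nat. openin Z (E n) \<and> openin Z (F n)"
      "B = (\<Union>n. E n - F n)"
      using Sigma0_twoD assms(2) unfolding two by blast
  have "A \<inter> B = (\<Union>n. \<Union>m. (C n \<inter> E m) - (D n \<union> F m))"
    unfolding CD(2) EF(2) by blast
  then show ?thesis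
    using CD(1) EF(1) two by (auto intro!: Sigma0_UN_nat Sigma0_diff_open)
next
  case more
  obtain c and C :: "nat \<Rightarrow> _" where C:
      "\<forall>n. 0 < c n \<and> c n < a \<and> Sigma0 Z (c n) (C n)" "A = (\<Union>n. topspace Z - C n)"
      using Sigma0_moreD[OF assms(1) more] by blast
  obtain d and D :: "nat \<Rightarrow> _" where D:
      "\<forall>n. 0 < d n \<and> d n < a \<and> Sigma0 Z (d n) (D n)" "B = (\<Union>n. topspace Z - D n)"
      using Sigma0_moreD[OF assms(2) more] by blast
  have "A \<inter> B = (\<Union>n. \<Union>m. topspace Z - (C n \<union> D m))"
    unfolding C(2) D(2) by blast
  moreover have "Sigma0 Z (max (c n) (d m)) (C n \<union> D m)" for n m
    using C(1) D(1) Sigma0_mono[of Z "c n" "C n"] Sigma0_mono[of Z "d m" "D m"]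
    by (intro Sigma0_Un) auto
  then have "Sigma0 Z a (topspace Z - (C n \<union> D m))" for n m
    using C(1) D(1) by (intro Sigma0_compl) auto
  then have "Sigma0 Z a (\<Union>n. \<Union>m. topspace Z - (C n \<union> D m))"
    by (intro Sigma0_UN_nat)
  ultimately show ?thesis
    by (simp only:)
qed

lemma Sigma0_Diff: "Sigma0 Z a A \<Longrightarrow> Sigma0 Z b B \<Longrightarrow> a \<le> c \<Longrightarrow> b < c \<Longrightarrow> Sigma0 Z c (A - B)"
proof -
  assume *: "Sigma0 Z a A" "Sigma0 Z b B" "a \<le> c" "b < c"
  have "A - B = A \<inter> (topspace Z - B)"
    using Sigma0_subset[OF *(1)] by blast
  then show "Sigma0 Z c (A - B)"
    using Sigma0_Int[OF Sigma0_mono[OF *(1,3)] Sigma0_compl[OF *(2,4)]] by simp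
qed

text \<open>Above the open sets the definition of the hierarchy distinguishes the second level from the
  later ones. Differences give one description for all of them, and the proofs by induction over the
  hierarchy use it.\<close>

lemma Sigma0_as_differences:
  assumes "Sigma0 Z a W" "1 < a"
  shows "\<exists>b A B. (\<forall>n :: nat. 0 < b n \<and> b n < a \<and> Sigma0 Z (b n) (A n) \<and> Sigma0 Z (b n) (B n)) \<and>
    W = (\<Union>n. A n - B n)"
proof (cases "1 + 1 < a")
  case True
  obtain c and B :: "nat \<Rightarrow> _" where 
      "\<forall>n. 0 < c n \<and> c n < a \<and> Sigma0 Z (c n) (B n)" "W = (\<Union>n. topspace Z - B n)"
      using Sigma0_moreD[OF assms(1) True] by blast
  then show ?thesis
    using Sigma0_topspace by (intro exI[of _ c] exI[of _ "\<lambda>_. topspace Z"] exI[of _ B]) auto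
next
  case False
  then have a: "a = 1 + 1"
    using assms(2) less_two_omega1[of a] by (meson linorder_neqE not_less)
  obtain B C where  "\<forall>n :: nat. openin Z (B n) \<and> openin Z (C n)"
      "W = (\<Union>n. B n - C n)"
      using Sigma0_twoD assms(1) unfolding a by blast
  then show ?thesis
    using a by (intro exI[of _ "\<lambda>_. 1"] exI[of _ B] exI[of _ C])
      (auto simp: Sigma0_one_iff one_less_two_omega1 zero_less_one_omega1)
qed

text \<open>Preimages commute with differences and countable unions, and left addition of \<open>c\<close> is strictly
  monotone, so each step of the hierarchy survives. The map is taken to be partial, with domain \<open>D\<close>,
  so that inverses of homeomorphisms onto subspaces are covered.\<close>

lemma Sigma0_pullback:
  assumes open_level: "\<And>U. openin Z' U \<Longrightarrow> \<exists>V. Sigma0 Z (1 + c) V \<and> (\<forall>x\<in>D. x \<in> V \<longleftrightarrow> g x \<in> U)"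
    and "Sigma0 Z' (1 + b) W"
  shows "\<exists>V. Sigma0 Z (1 + (c + b)) V \<and> (\<forall>x\<in>D. x \<in> V \<longleftrightarrow> g x \<in> W)"
  using assms(2)
proof (induction b arbitrary: W rule: less_induct)
  case (less b)
  show ?case
  proof (cases "b = 0")
    case True
    then show ?thesis
      using less.prems open_level by (simp add: Sigma0_one_iff)
  next
    case False
    then have b: "0 < b"
      by (simp add: less_le)
    then have "1 < 1 + b"
      using add_strict_mono_omega1[of 0 b 1] by simp
    then obtain d and A B :: "nat \<Rightarrow> _" where dAB:
      "\<forall>n. 0 < d n \<and> d n < 1 + b \<and> Sigma0 Z' (d n) (A n) \<and> Sigma0 Z' (d n) (B n)"
      and W: "W = (\<Union>n. A n - B n)"
      using Sigma0_as_differences[OF less.prems] by blast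
    then have d: "d n < 1 + b" and AB: "Sigma0 Z' (d n) (A n)" "Sigma0 Z' (d n) (B n)" for n
      by auto
    have "\<exists>e<b. d n \<le> 1 + e" for n
      by (rule less_add_posE_omega1[OF d b])
    then obtain e where e: "\<And>n. e n < b" "\<And>n. d n \<le> 1 + e n"
      by metis
    have "\<exists>V. Sigma0 Z (1 + (c + e n)) V \<and> (\<forall>x\<in>D. x \<in> V \<longleftrightarrow> g x \<in> A n)" for n
      using less.IH[OF e(1)] Sigma0_mono[OF AB(1) e(2)] by blast
    then obtain A' where A': "\<And>n. Sigma0 Z (1 + (c + e n)) (A' n)"
      "\<And>n. \<forall>x\<in>D. x \<in> A' n \<longleftrightarrow> g x \<in> A n"
      by metis
    have "\<exists>V. Sigma0 Z (1 + (c + e n)) V \<and> (\<forall>x\<in>D. x \<in> V \<longleftrightarrow> g x \<in> B n)" for n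
      using less.IH[OF e(1)] Sigma0_mono[OF AB(2) e(2)] by blast
    then obtain B' where B': "\<And>n. Sigma0 Z (1 + (c + e n)) (B' n)"
      "\<And>n. \<forall>x\<in>D. x \<in> B' n \<longleftrightarrow> g x \<in> B n"
      by metis
    have "1 + (c + e n) < 1 + (c + b)" for n
      using e(1) by (intro add_strict_mono_omega1)
    then have "Sigma0 Z (1 + (c + b)) (\<Union>n. A' n - B' n)"
      using A'(1) B'(1) by (intro Sigma0_UN_nat Sigma0_Diff) (auto intro: less_imp_le)
    moreover have "\<forall>x\<in>D. x \<in> (\<Union>n. A' n - B' n) \<longleftrightarrow> g x \<in> W"
      unfolding W using A'(2) B'(2) by blast
    ultimately show ?thesis
      by blast
  qed
qed

section \<open>Families described by recursion on the term\<close>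

text \<open>Trees and families of sets indexed by them are inconvenient in inductions over terms. For
  \<open>Y \<subseteq> topspace Z\<close> this predicate says that some \<open>u\<close>-family over \<open>Y\<close> in the \<open>b\<close>-shift of the Borel
  base of \<open>Z\<close> determines \<open>A\<close>. It only mentions the sets at the immediate successors of the root, and it
  takes them from the hierarchy of the ambient space \<open>Z\<close>, so that no base has to be restricted. The sets
  \<open>U i\<close> may overlap; each of them then describes \<open>A\<close> on the overlap.\<close>

primrec determined_on :: "'a topology \<Rightarrow> 'q trm \<Rightarrow> omega1 \<Rightarrow> 'a set \<Rightarrow> ('a \<Rightarrow> 'q) \<Rightarrow> bool" where
  "determined_on Z (Const q) = (\<lambda>b Y A. \<forall>x\<in>Y. A x = q)"
| "determined_on Z (S a u) = (\<lambda>b. determined_on Z u (b + omega_pow a))"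
| "determined_on Z (FQ q us) = (\<lambda>b Y A. \<exists>U. (\<forall>i. Sigma0 Z (1 + b) (U i)) \<and>
     (\<forall>x\<in>Y - (\<Union>i. U i). A x = q) \<and> (\<forall>i. determined_on Z (us i) b (Y \<inter> U i) A))"
| "determined_on Z (FA a us) = (\<lambda>b Y A. \<exists>U. (\<forall>i. Sigma0 Z (1 + b) (U i)) \<and>
     determined_on Z (us 0) (b + omega_pow a) (Y - (\<Union>i. U i)) A \<and>
     (\<forall>i. determined_on Z (us (Suc i)) b (Y \<inter> U i) A))"

text \<open>Passing to a subset of \<open>Y\<close> keeps the sets of the family. This makes it possible to shrink the \<open>U i\<close>, in
  particular to make them disjoint.\<close>

lemma determined_on_cong:
  assumes "determined_on Z u b Y A" "Y' \<subseteq> Y" "\<And>x. x \<in> Y' \<Longrightarrow> A x = A' x"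
  shows "determined_on Z u b Y' A'"
  using assms
proof (induction u arbitrary: b Y Y')
  case (Const q)
  then show ?case
    by (metis determined_on.simps(1) subsetD)
next
  case (S a u)
  then show ?case
    by simp
next
  case (FQ q us)
  obtain U where U: "\<forall>i. Sigma0 Z (1 + b) (U i)" "\<forall>x\<in>Y - (\<Union>i. U i). A x = q"
    "\<forall>i. determined_on Z (us i) b (Y \<inter> U i) A"
    using FQ.prems(1) by auto
  have "determined_on Z (us i) b (Y' \<inter> U i) A'" for i
    using FQ.prems(2,3) U(3) by (intro FQ.IH[of "us i" b "Y \<inter> U i"]) auto
  moreover have "\<forall>x\<in>Y' - (\<Union>i. U i). A' x = q"
    using U(2) FQ.prems(2,3) by (metis DiffD1 DiffD2 DiffI subsetD)
  ultimately show ?case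
    using U(1) by auto
next
  case (FA a us)
  obtain U where U: "\<forall>i. Sigma0 Z (1 + b) (U i)"
    "determined_on Z (us 0) (b + omega_pow a) (Y - (\<Union>i. U i)) A"
    "\<forall>i. determined_on Z (us (Suc i)) b (Y \<inter> U i) A"
    using FA.prems(1) by auto
  have "determined_on Z (us (Suc i)) b (Y' \<inter> U i) A'" for i
    using FA.prems(2,3) U(3) by (intro FA.IH[of "us (Suc i)" b "Y \<inter> U i"]) auto
  moreover have "determined_on Z (us 0) (b + omega_pow a) (Y' - (\<Union>i. U i)) A'"
    using FA.prems(2,3) U(2) by (intro FA.IH[of "us 0" _ "Y - (\<Union>i. U i)"]) auto
  ultimately show ?case
    using U(1) by auto
qed

text \<open>The restriction to \<open>Y\<close> of the \<open>b\<close>-shift of the Borel base; every base met in a family on \<open>Z\<close> has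
  this form.\<close>

definition level_base :: "'a topology \<Rightarrow> omega1 \<Rightarrow> 'a set \<Rightarrow> 'a base" where
  "level_base Z b Y = (\<lambda>c. (\<inter>) Y ` {A. Sigma0 Z (1 + (b + c)) A})"

lemma borel_base_eq: "borel_base Z = level_base Z 0 (topspace Z)"
proof
  show "borel_base Z c = level_base Z 0 (topspace Z) c" for c
    using Sigma0_subset[of Z "1 + c"] unfolding borel_base_def level_base_def
    by (auto simp: image_iff inf_absorb2)
qed

lemma shift_level_base: "shift_base d (level_base Z b Y) = level_base Z (b + d) Y"
  by (simp add: shift_base_def level_base_def add_assoc_omega1)

lemma restrict_level_base: "Y' \<subseteq> Y \<Longrightarrow> restrict_base Y' (level_base Z b Y) = level_base Z b Y'"
proof -
  assume "Y' \<subseteq> Y"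
  then have "Y' \<inter> (Y \<inter> A) = Y' \<inter> A" for A
    by blast
  then show ?thesis
    by (simp add: restrict_base_def level_base_def image_image)
qed

lemma level_base_0_iff: "V \<in> level_base Z b Y 0 \<longleftrightarrow> (\<exists>A. Sigma0 Z (1 + b) A \<and> V = Y \<inter> A)"
  by (auto simp: level_base_def)

definition family_on :: "'a topology \<Rightarrow> 'q trm \<Rightarrow> omega1 \<Rightarrow> 'a set \<Rightarrow> ('a \<Rightarrow> 'q) \<Rightarrow> bool" where
  "family_on Z u b Y A \<longleftrightarrow>
     (\<exists>F. is_family u Y (level_base Z b Y) F \<and> determines u Y (level_base Z b Y) F (restrict A Y))"

text \<open>The family of sets on \<open>T(u)\<close> together with the families on its components, also for terms
  whose tree has only the root. Without the latter case the passage to a successor of the root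
  would have to distinguish the kinds of subterms.\<close>

definition tree_family_on :: "'a topology \<Rightarrow> 'q trm \<Rightarrow> omega1 \<Rightarrow> 'a set \<Rightarrow> ('a \<Rightarrow> 'q) \<Rightarrow> bool" where
  "tree_family_on Z u b Y A \<longleftrightarrow> (\<exists>U. monotone_family (dom (tree_of u)) U \<and>
     (\<forall>\<tau>\<in>dom (tree_of u). U \<tau> \<in> level_base Z b Y 0) \<and> U [] = Y \<and>
     (\<forall>\<tau> t. tree_of u \<tau> = Some t \<longrightarrow> family_on Z t b (cpt (dom (tree_of u)) U \<tau>) A))"

lemma is_family_Const_iff: "is_family (Const q) Y L F \<longleftrightarrow> F = Single Y"
  by (auto elim: is_family.cases intro: is_family.intros)

lemma determines_Const_iff: "determines (Const q) Y L (Single Y) A \<longleftrightarrow> A = (\<lambda>x\<in>Y. q)"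
  by (auto elim: determines.cases intro: determines.intros)

lemma is_family_S_iff: "is_family (S a u) Y L F \<longleftrightarrow> is_family u Y (shift_base (omega_pow a) L) F"
  by (auto elim: is_family.cases intro: is_family.intros)

lemma determines_S_iff:
  "determines (S a u) Y L F A \<longleftrightarrow> determines u Y (shift_base (omega_pow a) L) F A"
  by (auto elim: determines.cases intro: determines.intros)

lemma family_on_Const: "family_on Z (Const q) b Y A \<longleftrightarrow> (\<forall>x\<in>Y. A x = q)"
  by (auto simp: family_on_def is_family_Const_iff determines_Const_iff restrict_def fun_eq_iff)

lemma family_on_S: "family_on Z (S a u) b Y A \<longleftrightarrow> family_on Z u (b + omega_pow a) Y A"
  by (simp add: family_on_def is_family_S_iff determines_S_iff shift_level_base)

lemma family_on_branching:
  assumes u: "is_FQ u \<or> is_FA u"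
  shows "family_on Z u b Y A \<longleftrightarrow> tree_family_on Z u b Y A"
proof
  let ?T = "dom (tree_of u)"
  assume "family_on Z u b Y A"
  then obtain F where F: "is_family u Y (level_base Z b Y) F"
    "determines u Y (level_base Z b Y) F (restrict A Y)"
    unfolding family_on_def by blast
  obtain U G where UG: "F = Nest U G" "monotone_family ?T U" "\<forall>\<tau>\<in>?T. U \<tau> \<in> level_base Z b Y 0"
    "U [] = Y" "\<And>\<tau> t. tree_of u \<tau> = Some t \<Longrightarrow>
      is_family t (cpt ?T U \<tau>) (restrict_base (cpt ?T U \<tau>) (level_base Z b Y)) (G \<tau>)"
    using F(1) u by (cases rule: is_family.cases) auto
  have det: "determines t (cpt ?T U \<tau>) (restrict_base (cpt ?T U \<tau>) (level_base Z b Y)) (G \<tau>)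
      (restrict (restrict A Y) (cpt ?T U \<tau>))" if "tree_of u \<tau> = Some t" for \<tau> t
    using F(2) u that unfolding UG(1) by (cases rule: determines.cases) auto
  have "family_on Z t b (cpt ?T U \<tau>) A" if "tree_of u \<tau> = Some t" for \<tau> t
  proof -
    have "U \<tau> \<subseteq> Y"
      using UG(3) that by (auto simp: level_base_0_iff)
    then have sub: "cpt ?T U \<tau> \<subseteq> Y"
      by (auto simp: cpt_def)
    then have "restrict (restrict A Y) (cpt ?T U \<tau>) = restrict A (cpt ?T U \<tau>)"
      by (auto simp: restrict_def fun_eq_iff)
    then show ?thesis
      using UG(5)[OF that] det[OF that] unfolding family_on_def restrict_level_base[OF sub] by auto
  qed
  then show "tree_family_on Z u b Y A"
    unfolding tree_family_on_def using UG(2-4) by blast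
next
  let ?T = "dom (tree_of u)"
  assume "tree_family_on Z u b Y A"
  then obtain U where U: "monotone_family ?T U" "\<forall>\<tau>\<in>?T. U \<tau> \<in> level_base Z b Y 0" "U [] = Y"
    "\<And>\<tau> t. tree_of u \<tau> = Some t \<Longrightarrow> family_on Z t b (cpt ?T U \<tau>) A"
    unfolding tree_family_on_def by blast
  have "\<forall>\<tau>. \<exists>G. \<forall>t. tree_of u \<tau> = Some t \<longrightarrow> is_family t (cpt ?T U \<tau>) (level_base Z b (cpt ?T U \<tau>)) G \<and>
      determines t (cpt ?T U \<tau>) (level_base Z b (cpt ?T U \<tau>)) G (restrict A (cpt ?T U \<tau>))"
  proof
    show "\<exists>G. \<forall>t. tree_of u \<tau> = Some t \<longrightarrow> is_family t (cpt ?T U \<tau>) (level_base Z b (cpt ?T U \<tau>)) G \<and>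
      determines t (cpt ?T U \<tau>) (level_base Z b (cpt ?T U \<tau>)) G (restrict A (cpt ?T U \<tau>))" for \<tau>
      using U(4)[of \<tau>] unfolding family_on_def by (cases "tree_of u \<tau>") auto
  qed
  from choice[OF this] obtain G where G: "\<And>\<tau> t. tree_of u \<tau> = Some t \<Longrightarrow>
      is_family t (cpt ?T U \<tau>) (level_base Z b (cpt ?T U \<tau>)) (G \<tau>) \<and>
      determines t (cpt ?T U \<tau>) (level_base Z b (cpt ?T U \<tau>)) (G \<tau>) (restrict A (cpt ?T U \<tau>))"
    by blast
  have sub: "cpt ?T U \<tau> \<subseteq> Y" if "tree_of u \<tau> = Some t" for \<tau> t
    using U(2) that by (auto simp: level_base_0_iff cpt_def)
  have "restrict (restrict A Y) (cpt ?T U \<tau>) = restrict A (cpt ?T U \<tau>)"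
    if "tree_of u \<tau> = Some t" for \<tau> t
    using sub[OF that] by (auto simp: restrict_def fun_eq_iff)
  then have "determines u Y (level_base Z b Y) (Nest U G) (restrict A Y)"
    using u G by (intro determines.intros(3)) (auto simp: restrict_level_base[OF sub])
  moreover have "is_family u Y (level_base Z b Y) (Nest U G)"
    using u U(1-3) G by (intro is_family.intros(3)) (auto simp: restrict_level_base[OF sub])
  ultimately show "family_on Z u b Y A"
    unfolding family_on_def by blast
qed

lemma tree_family_on_leaf:
  fixes Z :: "'a topology"
  assumes "is_Const u \<or> is_S u" "Y \<subseteq> topspace Z"
  shows "tree_family_on Z u b Y A \<longleftrightarrow> family_on Z u b Y A"
proof -
  have T: "tree_of u = (\<lambda>\<tau>. if \<tau> = [] then Some u else None)"
    using assms(1) by (cases u) auto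
  then have dom: "dom (tree_of u) = {[]}"
    by (auto split: if_splits)
  have cpt: "cpt {[]} U [] = U []" for U :: "nat list \<Rightarrow> 'a set"
    by (auto simp: cpt_def)
  have "Y \<in> level_base Z b Y 0"
    using assms(2) Sigma0_topspace[of "1 + b" Z] by (auto simp: level_base_0_iff)
  then show ?thesis
    unfolding tree_family_on_def dom
    by (auto simp: T cpt monotone_family_def intro!: exI[of _ "\<lambda>_. Y"])
qed

lemma tree_family_on_iff:
  assumes "Y \<subseteq> topspace Z"
  shows "tree_family_on Z u b Y A \<longleftrightarrow> family_on Z u b Y A"
proof (cases "is_FQ u \<or> is_FA u")
  case True
  then show ?thesis
    by (simp add: family_on_branching)
next
  case False
  then have "is_Const u \<or> is_S u"
    by (cases u) auto
  then show ?thesis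
    using assms by (rule tree_family_on_leaf)
qed

lemma Nil_in_dom_tree_of: "[] \<in> dom (tree_of u)"
  by (cases u) auto

text \<open>The labelled subtree above the node \<open>i\<close> is the tree of \<open>us i\<close>, and the components are the same
  whether they are computed there or in the whole tree. At the root, monotonicity reduces the union
  over all proper extensions to the one over the successors.\<close>

lemma tree_family_on_step:
  fixes Z :: "'a topology"
  assumes T: "tree_of u = (\<lambda>\<tau>. case \<tau> of [] \<Rightarrow> Some t0 | i # \<sigma> \<Rightarrow> tree_of (us i) \<sigma>)"
    and Y: "Y \<subseteq> topspace Z"
  shows "tree_family_on Z u b Y A \<longleftrightarrow>
    (\<exists>U. (\<forall>i. Sigma0 Z (1 + b) (U i)) \<and> family_on Z t0 b (Y - (\<Union>i. U i)) A \<and>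
      (\<forall>i. tree_family_on Z (us i) b (Y \<inter> U i) A))"
proof -
  have dom_Cons: "i # \<sigma> \<in> dom (tree_of u) \<longleftrightarrow> \<sigma> \<in> dom (tree_of (us i))" for i \<sigma>
    by (auto simp: T)
  have tree_Nil: "tree_of u [] = Some t0" and tree_Cons: "tree_of u (i # \<sigma>) = tree_of (us i) \<sigma>"
    for i \<sigma>
    by (simp_all add: T)
  have cpt_Cons: "cpt (dom (tree_of u)) U (i # \<sigma>) = cpt (dom (tree_of (us i))) (\<lambda>\<sigma>. U (i # \<sigma>)) \<sigma>"
    for U :: "nat list \<Rightarrow> 'a set" and i \<sigma>
  proof -
    have "{U \<rho> |\<rho>. \<rho> \<in> dom (tree_of u) \<and> strict_prefix (i # \<sigma>) \<rho>} =
        {U (i # \<rho>) |\<rho>. \<rho> \<in> dom (tree_of (us i)) \<and> strict_prefix \<sigma> \<rho>}" (is "?L = ?R")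
    proof
      show "?L \<subseteq> ?R"
      proof
        fix V assume "V \<in> ?L"
        then obtain \<rho> where \<rho>: "V = U \<rho>" "\<rho> \<in> dom (tree_of u)" "strict_prefix (i # \<sigma>) \<rho>"
          by blast
        then obtain \<rho>' where "\<rho> = i # \<rho>'" "strict_prefix \<sigma> \<rho>'"
          by (cases \<rho>) auto
        then show "V \<in> ?R"
          using \<rho>(1,2) dom_Cons by auto
      qed
      show "?R \<subseteq> ?L"
        using dom_Cons by force
    qed
    then show ?thesis
      by (simp add: cpt_def)
  qed
  have cpt_Nil: "cpt (dom (tree_of u)) U [] = U [] - (\<Union>i. U [i])"
    if "monotone_family (dom (tree_of u)) U" for U :: "nat list \<Rightarrow> 'a set"
  proof -
    have "\<Union> {U \<rho> |\<rho>. \<rho> \<in> dom (tree_of u) \<and> strict_prefix [] \<rho>} = (\<Union>i. U [i])"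
    proof
      show "\<Union> {U \<rho> |\<rho>. \<rho> \<in> dom (tree_of u) \<and> strict_prefix [] \<rho>} \<subseteq> (\<Union>i. U [i])"
      proof
        fix x assume "x \<in> \<Union> {U \<rho> |\<rho>. \<rho> \<in> dom (tree_of u) \<and> strict_prefix [] \<rho>}"
        then obtain \<rho> where "x \<in> U \<rho>" "\<rho> \<in> dom (tree_of u)" "strict_prefix [] \<rho>"
          by blast
        moreover from this obtain i \<sigma> where \<rho>: "\<rho> = i # \<sigma>"
          by (cases \<rho>) auto
        moreover have "[i] \<in> dom (tree_of u)"
          by (simp only: dom_Cons Nil_in_dom_tree_of)
        moreover have "prefix [i] \<rho>"
          by (simp add: \<rho>)
        ultimately have "x \<in> U [i]"
          using that unfolding monotone_family_def by blast
        then show "x \<in> (\<Union>i. U [i])"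
          by blast
      qed
      show "(\<Union>i. U [i]) \<subseteq> \<Union> {U \<rho> |\<rho>. \<rho> \<in> dom (tree_of u) \<and> strict_prefix [] \<rho>}"
      proof
        fix x assume "x \<in> (\<Union>i. U [i])"
        then obtain i where "x \<in> U [i]"
          by blast
        moreover have "[i] \<in> dom (tree_of u)"
          by (simp only: dom_Cons Nil_in_dom_tree_of)
        moreover have "strict_prefix [] [i]"
          by simp
        ultimately show "x \<in> \<Union> {U \<rho> |\<rho>. \<rho> \<in> dom (tree_of u) \<and> strict_prefix [] \<rho>}"
          by blast
      qed
    qed
    then show ?thesis
      by (simp add: cpt_def)
  qed
  show ?thesis
  proof
    assume "tree_family_on Z u b Y A"
    then obtain U where U: "monotone_family (dom (tree_of u)) U"
      "\<forall>\<tau>\<in>dom (tree_of u). U \<tau> \<in> level_base Z b Y 0" "U [] = Y"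
      "\<And>\<tau> t. tree_of u \<tau> = Some t \<Longrightarrow> family_on Z t b (cpt (dom (tree_of u)) U \<tau>) A"
      unfolding tree_family_on_def by blast
    have "[i] \<in> dom (tree_of u)" for i
      by (simp only: dom_Cons Nil_in_dom_tree_of)
    then have "\<forall>i. \<exists>W. Sigma0 Z (1 + b) W \<and> U [i] = Y \<inter> W"
      using U(2) by (simp only: level_base_0_iff) blast
    then obtain W where W: "\<And>i. Sigma0 Z (1 + b) (W i)" "\<And>i. U [i] = Y \<inter> W i"
      by metis
    have "tree_family_on Z (us i) b (Y \<inter> W i) A" for i
      unfolding tree_family_on_def
    proof (intro exI[of _ "\<lambda>\<sigma>. U (i # \<sigma>)"] conjI ballI allI impI)
      have mono: "U (i # \<tau>) \<subseteq> U (i # \<sigma>)"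
        if "\<sigma> \<in> dom (tree_of (us i))" "\<tau> \<in> dom (tree_of (us i))" "prefix \<sigma> \<tau>" for \<sigma> \<tau>
      proof -
        have "i # \<sigma> \<in> dom (tree_of u)" "i # \<tau> \<in> dom (tree_of u)" "prefix (i # \<sigma>) (i # \<tau>)"
          using that by (simp_all only: dom_Cons Cons_prefix_Cons simp_thms)
        then show ?thesis
          using U(1) unfolding monotone_family_def by blast
      qed
      then show "monotone_family (dom (tree_of (us i))) (\<lambda>\<sigma>. U (i # \<sigma>))"
        unfolding monotone_family_def by blast
      show "U (i # \<sigma>) \<in> level_base Z b (Y \<inter> W i) 0" if "\<sigma> \<in> dom (tree_of (us i))" for \<sigma>
      proof -
        have "U (i # \<sigma>) \<in> level_base Z b Y 0"
          using U(2) that by (simp only: dom_Cons)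
        then obtain V where "Sigma0 Z (1 + b) V" "U (i # \<sigma>) = Y \<inter> V"
          unfolding level_base_0_iff by blast
        moreover have "U (i # \<sigma>) \<subseteq> Y \<inter> W i"
          using mono[OF Nil_in_dom_tree_of that] W(2)[of i] by simp
        ultimately show ?thesis
          by (auto simp: level_base_0_iff)
      qed
      show "U [i] = Y \<inter> W i"
        by (rule W)
      show "family_on Z t b (cpt (dom (tree_of (us i))) (\<lambda>\<sigma>. U (i # \<sigma>)) \<sigma>) A"
        if "tree_of (us i) \<sigma> = Some t" for \<sigma> t
        using U(4)[of "i # \<sigma>" t] that by (simp add: cpt_Cons tree_Cons)
    qed
    moreover have "family_on Z t0 b (Y - (\<Union>i. W i)) A"
    proof -
      have "Y - (\<Union>i. W i) = U [] - (\<Union>i. U [i])"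
        using U(3) W(2) by auto
      then show ?thesis
        using U(4)[of "[]" t0] by (simp add: tree_Nil cpt_Nil[OF U(1)])
    qed
    ultimately show "\<exists>U. (\<forall>i. Sigma0 Z (1 + b) (U i)) \<and> family_on Z t0 b (Y - (\<Union>i. U i)) A \<and>
        (\<forall>i. tree_family_on Z (us i) b (Y \<inter> U i) A)"
      using W(1) by blast
  next
    assume "\<exists>U. (\<forall>i. Sigma0 Z (1 + b) (U i)) \<and> family_on Z t0 b (Y - (\<Union>i. U i)) A \<and>
        (\<forall>i. tree_family_on Z (us i) b (Y \<inter> U i) A)"
    then obtain W where W: "\<And>i. Sigma0 Z (1 + b) (W i)" "family_on Z t0 b (Y - (\<Union>i. W i)) A"
      and "\<And>i. tree_family_on Z (us i) b (Y \<inter> W i) A"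
      by blast
    then have "\<forall>i. \<exists>U. monotone_family (dom (tree_of (us i))) U \<and>
        (\<forall>\<tau>\<in>dom (tree_of (us i)). U \<tau> \<in> level_base Z b (Y \<inter> W i) 0) \<and> U [] = Y \<inter> W i \<and>
        (\<forall>\<tau> t. tree_of (us i) \<tau> = Some t \<longrightarrow>
          family_on Z t b (cpt (dom (tree_of (us i))) U \<tau>) A)"
      unfolding tree_family_on_def by blast
    then obtain V where V: "\<And>i. monotone_family (dom (tree_of (us i))) (V i)"
      "\<And>i \<tau>. \<tau> \<in> dom (tree_of (us i)) \<Longrightarrow> V i \<tau> \<in> level_base Z b (Y \<inter> W i) 0"
      "\<And>i. V i [] = Y \<inter> W i"
      "\<And>i \<tau> t. tree_of (us i) \<tau> = Some t \<Longrightarrow>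
          family_on Z t b (cpt (dom (tree_of (us i))) (V i) \<tau>) A"
      by metis
    define U where "U \<tau> = (case \<tau> of [] \<Rightarrow> Y | i # \<sigma> \<Rightarrow> V i \<sigma>)" for \<tau>
    have U_simps [simp]: "U [] = Y" "\<And>i \<sigma>. U (i # \<sigma>) = V i \<sigma>"
      by (auto simp: U_def)
    have level: "U \<tau> \<in> level_base Z b Y 0" if "\<tau> \<in> dom (tree_of u)" for \<tau>
    proof (cases \<tau>)
      case Nil
      then show ?thesis
        using Y Sigma0_topspace[of "1 + b" Z] by (auto simp: level_base_0_iff)
    next
      case (Cons i \<sigma>)
      then have "\<sigma> \<in> dom (tree_of (us i))"
        using that by (simp only: dom_Cons)
      from V(2)[OF this] obtain X where "Sigma0 Z (1 + b) X" "V i \<sigma> = Y \<inter> W i \<inter> X"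
        unfolding level_base_0_iff by blast
      then show ?thesis
        using W(1)[of i] Cons Sigma0_Int[of Z "1 + b" "W i" X]
        by (auto simp: level_base_0_iff Int_assoc)
    qed
    have mono: "monotone_family (dom (tree_of u)) U"
      unfolding monotone_family_def
    proof (intro ballI impI)
      fix \<sigma> \<tau> assume *: "\<sigma> \<in> dom (tree_of u)" "\<tau> \<in> dom (tree_of u)" "prefix \<sigma> \<tau>"
      show "U \<tau> \<subseteq> U \<sigma>"
      proof (cases \<sigma>)
        case Nil
        then show ?thesis
          using level[OF *(2)] by (auto simp: level_base_0_iff)
      next
        case (Cons i \<sigma>')
        then obtain \<tau>' where "\<tau> = i # \<tau>'" "prefix \<sigma>' \<tau>'"
          using *(3) by (cases \<tau>) auto
        moreover from this have "\<sigma>' \<in> dom (tree_of (us i))" "\<tau>' \<in> dom (tree_of (us i))"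
          using *(1,2) Cons by (simp_all only: dom_Cons)
        ultimately show ?thesis
          using V(1)[of i] Cons unfolding monotone_family_def by simp
      qed
    qed
    have "family_on Z t b (cpt (dom (tree_of u)) U \<tau>) A" if t: "tree_of u \<tau> = Some t" for \<tau> t
    proof (cases \<tau>)
      case Nil
      moreover have "U [] - (\<Union>i. U [i]) = Y - (\<Union>i. W i)"
        by (auto simp: V(3))
      ultimately show ?thesis
        using W(2) t cpt_Nil[OF mono] by (simp add: tree_Nil)
    next
      case (Cons i \<sigma>)
      then show ?thesis
        using V(4)[of i \<sigma> t] t cpt_Cons[of U i \<sigma>] by (simp add: tree_Cons)
    qed
    then show "tree_family_on Z u b Y A"
      unfolding tree_family_on_def using mono level by (intro exI[of _ U]) auto
  qed
qed

theorem family_on_iff_determined_on: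
  "Y \<subseteq> topspace Z \<Longrightarrow> family_on Z u b Y A \<longleftrightarrow> determined_on Z u b Y A"
proof (induction u arbitrary: b Y)
  case (Const q)
  then show ?case
    by (simp add: family_on_Const)
next
  case (S a u)
  then show ?case
    by (simp add: family_on_S)
next
  case (FQ q us)
  have *: "Y \<inter> U \<subseteq> topspace Z" "Y - U \<subseteq> topspace Z" for U
    using FQ.prems by auto
  have "family_on Z (FQ q us) b Y A \<longleftrightarrow> (\<exists>U. (\<forall>i. Sigma0 Z (1 + b) (U i)) \<and>
      family_on Z (Const q) b (Y - (\<Union>i. U i)) A \<and>
      (\<forall>i. tree_family_on Z (us i) b (Y \<inter> U i) A))"
    unfolding tree_family_on_iff[OF FQ.prems, symmetric]
    by (rule tree_family_on_step[OF _ FQ.prems]) simp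
  then show ?case
    using FQ.IH[OF rangeI] * by (simp add: tree_family_on_iff family_on_Const)
next
  case (FA a us)
  have *: "Y \<inter> U \<subseteq> topspace Z" "Y - U \<subseteq> topspace Z" for U
    using FA.prems by auto
  have "family_on Z (FA a us) b Y A \<longleftrightarrow> (\<exists>U. (\<forall>i. Sigma0 Z (1 + b) (U i)) \<and>
      family_on Z (S a (us 0)) b (Y - (\<Union>i. U i)) A \<and>
      (\<forall>i. tree_family_on Z (us (Suc i)) b (Y \<inter> U i) A))"
    unfolding tree_family_on_iff[OF FA.prems, symmetric]
    by (rule tree_family_on_step[OF _ FA.prems]) simp
  then show ?case
    using FA.IH[OF rangeI] * by (simp add: tree_family_on_iff family_on_S)
qed

corollary level_borel_base:
  "level Q (topspace Z) (borel_base Z) u =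
     {A \<in> topspace Z \<rightarrow>\<^sub>E Q. determined_on Z u 0 (topspace Z) A}"
proof -
  have "(\<exists>F. is_family u (topspace Z) (borel_base Z) F \<and> determines u (topspace Z) (borel_base Z) F A)
      \<longleftrightarrow> determined_on Z u 0 (topspace Z) A" if "A \<in> topspace Z \<rightarrow>\<^sub>E Q" for A
    using family_on_iff_determined_on[of "topspace Z" Z u 0 A] that
    by (simp add: family_on_def borel_base_eq PiE_restrict)
  then show ?thesis
    unfolding level_def by blast
qed

section \<open>Substitution\<close>

text \<open>Levels in families are shifted only by right addition, which commutes with the left addition of
  \<open>c\<close> caused by the map.\<close>

lemma determined_on_pullback:
  assumes open_level: "\<And>U. openin Z' U \<Longrightarrow> \<exists>V. Sigma0 Z (1 + c) V \<and> (\<forall>x\<in>D. x \<in> V \<longleftrightarrow> g x \<in> U)"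
    and "determined_on Z' u b Y A"
  shows "determined_on Z u (c + b) (D \<inter> g -` Y) (A \<circ> g)"
  using assms(2)
proof (induction u arbitrary: b Y)
  case (S a u)
  then show ?case
    by (simp add: add_assoc_omega1)
next
  case (FQ q us)
  obtain U where U: "\<forall>i. Sigma0 Z' (1 + b) (U i)" "\<forall>x\<in>Y - (\<Union>i. U i). A x = q"
    "\<forall>i. determined_on Z' (us i) b (Y \<inter> U i) A"
    using FQ.prems by auto
  have "\<exists>V. Sigma0 Z (1 + (c + b)) V \<and> (\<forall>x\<in>D. x \<in> V \<longleftrightarrow> g x \<in> U i)" for i
    by (rule Sigma0_pullback[of Z' Z c D g b "U i"]) (use U(1) open_level in blast)+
  then obtain V where V: "\<And>i. Sigma0 Z (1 + (c + b)) (V i)"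
    "\<And>i. \<forall>x\<in>D. x \<in> V i \<longleftrightarrow> g x \<in> U i"
    by metis
  have "D \<inter> g -` Y \<inter> V i = D \<inter> g -` (Y \<inter> U i)" for i
    using V(2) by auto
  then have "determined_on Z (us i) (c + b) (D \<inter> g -` Y \<inter> V i) (A \<circ> g)" for i
    using FQ.IH[OF rangeI, of i b "Y \<inter> U i"] U(3) by (simp add: comp_def)
  moreover have "\<forall>x\<in>D \<inter> g -` Y - (\<Union>i. V i). (A \<circ> g) x = q"
    using U(2) V(2) by auto
  ultimately show ?case
    using V(1) unfolding determined_on.simps by (intro exI[of _ V]) simp
next
  case (FA a us)
  obtain U where U: "\<forall>i. Sigma0 Z' (1 + b) (U i)"
    "determined_on Z' (us 0) (b + omega_pow a) (Y - (\<Union>i. U i)) A"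
    "\<forall>i. determined_on Z' (us (Suc i)) b (Y \<inter> U i) A"
    using FA.prems by auto
  have "\<exists>V. Sigma0 Z (1 + (c + b)) V \<and> (\<forall>x\<in>D. x \<in> V \<longleftrightarrow> g x \<in> U i)" for i
    by (rule Sigma0_pullback[of Z' Z c D g b "U i"]) (use U(1) open_level in blast)+
  then obtain V where V: "\<And>i. Sigma0 Z (1 + (c + b)) (V i)"
    "\<And>i. \<forall>x\<in>D. x \<in> V i \<longleftrightarrow> g x \<in> U i"
    by metis
  have "D \<inter> g -` Y \<inter> V i = D \<inter> g -` (Y \<inter> U i)" for i
    using V(2) by auto
  then have "determined_on Z (us (Suc i)) (c + b) (D \<inter> g -` Y \<inter> V i) (A \<circ> g)" for i
    using FA.IH[OF rangeI, of "Suc i" b "Y \<inter> U i"] U(3) by (simp add: comp_def)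
  moreover have "D \<inter> g -` Y - (\<Union>i. V i) = D \<inter> g -` (Y - (\<Union>i. U i))"
    using V(2) by auto
  then have "determined_on Z (us 0) (c + b + omega_pow a) (D \<inter> g -` Y - (\<Union>i. V i)) (A \<circ> g)"
    using FA.IH[OF rangeI, of 0 _ "Y - (\<Union>i. U i)"] U(2) by (simp add: add_assoc_omega1 comp_def)
  ultimately show ?case
    using V(1) unfolding determined_on.simps by (intro exI[of _ V]) simp
qed auto

lemma determined_on_continuous_map:
  assumes "continuous_map Z Z' g" "determined_on Z' u b (topspace Z') A"
  shows "determined_on Z u b (topspace Z) (A \<circ> g)"
proof -
  have "\<exists>V. Sigma0 Z (1 + 0) V \<and> (\<forall>x\<in>topspace Z. x \<in> V \<longleftrightarrow> g x \<in> U)" if "openin Z' U" for U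
    using openin_continuous_map_preimage[OF assms(1) that]
    by (intro exI[of _ "{x \<in> topspace Z. g x \<in> U}"]) (simp add: Sigma0_one_iff)
  then have "determined_on Z u (0 + b) (topspace Z \<inter> g -` topspace Z') (A \<circ> g)"
    using assms(2) by (intro determined_on_pullback[of Z'])
  moreover have "topspace Z \<inter> g -` topspace Z' = topspace Z"
    using continuous_map_image_subset_topspace[OF assms(1)] by auto
  ultimately show ?thesis
    by simp
qed

lemma determined_on_jump:
  assumes "\<And>A. A \<in> C \<Longrightarrow> determined_on euclidean u 0 UNIV A" "B \<in> jump a C"
  shows "determined_on euclidean u (omega_pow a) UNIV B"
proof -
  obtain A g where "A \<in> C" "B = A \<circ> g" and g: "Sigma0_measurable (1 + omega_pow a) g"
    using assms(2) unfolding jump_def by blast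
  moreover have "\<exists>V. Sigma0 euclidean (1 + omega_pow a) V \<and> (\<forall>x\<in>UNIV. x \<in> V \<longleftrightarrow> g x \<in> U)"
    if "openin euclidean U" for U
    using g that unfolding Sigma0_measurable_def by (intro exI[of _ "g -` U"]) auto
  ultimately show ?thesis
    using determined_on_pullback[of euclidean euclidean "omega_pow a" UNIV g u 0 UNIV A] assms(1)
    by simp
qed

text \<open>The inverse of \<open>h\<close> is only defined on \<open>U\<close>. It pulls open sets back to open sets of the whole
  space because \<open>U\<close> is open.\<close>

lemma determined_on_open_piece:
  assumes "open U" "homeomorphic_map euclidean (top_of_set U) h" "determined_on euclidean u 0 UNIV (A \<circ> h)"
  shows "determined_on euclidean u 0 U A"
proof -
  obtain h' where h': "homeomorphic_maps euclidean (top_of_set U) h h'"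
    using assms(2) homeomorphic_map_maps by blast
  then have cont: "continuous_map (top_of_set U) euclidean h'"
    and inv: "\<And>x. x \<in> U \<Longrightarrow> h (h' x) = x"
    by (auto simp: homeomorphic_maps_def)
  have "\<exists>V. Sigma0 euclidean (1 + 0) V \<and> (\<forall>x\<in>U. x \<in> V \<longleftrightarrow> h' x \<in> W)" if "openin euclidean W" for W
  proof -
    have "openin (top_of_set U) {x \<in> U. h' x \<in> W}"
      using openin_continuous_map_preimage[OF cont that] by simp
    then have "open {x \<in> U. h' x \<in> W}"
      using assms(1) openin_open_trans by blast
    then show ?thesis
      by (intro exI[of _ "{x \<in> U. h' x \<in> W}"]) (simp add: Sigma0_one_iff)
  qed
  then have "determined_on euclidean u (0 + 0) (U \<inter> h' -` UNIV) ((A \<circ> h) \<circ> h')"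
    using assms(3) by (intro determined_on_pullback[of euclidean])
  then have "determined_on euclidean u 0 U ((A \<circ> h) \<circ> h')"
    by simp
  then show ?thesis
    by (rule determined_on_cong) (simp_all add: inv)
qed

theorem Sigma_class_determined_on:
  assumes r: "\<And>C. closed C \<Longrightarrow> C \<noteq> {} \<Longrightarrow> retraction UNIV C (r C)"
    and h: "\<And>U. open U \<Longrightarrow> U \<noteq> {} \<Longrightarrow> homeomorphic_map euclidean (top_of_set U) (h U)"
  shows "B \<in> Sigma_class r h u \<Longrightarrow> determined_on euclidean u 0 UNIV B"
proof (induction u arbitrary: B)
  case (Const q)
  then show ?case
    by simp
next
  case (S a u)
  then show ?case
    using determined_on_jump[of "Sigma_class r h u" u B a] by simp
next
  case (FQ q us)
  obtain U where U: "open_pieces U" "\<forall>x\<in>- (\<Union>i. U i). B x = q"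
    "\<forall>i. B \<circ> h (U i) \<in> Sigma_class r h (us i)"
    using FQ.prems by auto
  have "determined_on euclidean (us i) 0 (U i) B" for i
  proof (rule determined_on_open_piece)
    have "open (U i)" "U i \<noteq> {}"
      using U(1) by (simp_all add: open_pieces_def)
    then show "open (U i)" "homeomorphic_map euclidean (top_of_set (U i)) (h (U i))"
      by (simp_all add: h)
    show "determined_on euclidean (us i) 0 UNIV (B \<circ> h (U i))"
      using U(3) by (intro FQ.IH[OF rangeI]) blast
  qed
  moreover have "Sigma0 euclidean (1 + 0) (U i)" for i
    using U(1) by (simp add: open_pieces_def Sigma0_one_iff)
  ultimately show ?case
    using U(2) unfolding determined_on.simps by (intro exI[of _ U]) simp
next
  case (FA a us)
  obtain U where U: "open_pieces U" "B \<circ> r (- (\<Union>i. U i)) \<in> jump a (Sigma_class r h (us 0))"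
    "\<forall>i. B \<circ> h (U i) \<in> Sigma_class r h (us (Suc i))"
    using FA.prems by auto
  have "determined_on euclidean (us (Suc i)) 0 (U i) B" for i
  proof (rule determined_on_open_piece)
    have "open (U i)" "U i \<noteq> {}"
      using U(1) by (simp_all add: open_pieces_def)
    then show "open (U i)" "homeomorphic_map euclidean (top_of_set (U i)) (h (U i))"
      by (simp_all add: h)
    show "determined_on euclidean (us (Suc i)) 0 UNIV (B \<circ> h (U i))"
      using U(3) by (intro FA.IH[OF rangeI]) blast
  qed
  moreover have "determined_on euclidean (us 0) (omega_pow a) (- (\<Union>i. U i)) B"
  proof (rule determined_on_cong)
    show "determined_on euclidean (us 0) (omega_pow a) UNIV (B \<circ> r (- (\<Union>i. U i)))"
      using determined_on_jump[OF FA.IH[OF rangeI] U(2)] .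
    have "open (\<Union>i. U i)"
      using U(1) by (intro open_UN) (simp add: open_pieces_def)
    moreover have "- (\<Union>i. U i) \<noteq> {}"
      using U(1) unfolding open_pieces_def by blast
    ultimately have "retraction UNIV (- (\<Union>i. U i)) (r (- (\<Union>i. U i)))"
      by (intro r) (simp_all only: closed_def double_complement simp_thms)
    then show "(B \<circ> r (- (\<Union>i. U i))) x = B x" if "x \<in> - (\<Union>i. U i)" for x
      using that by (simp add: retraction_def)
  qed simp
  moreover have "Sigma0 euclidean (1 + 0) (U i)" for i
    using U(1) by (simp add: open_pieces_def Sigma0_one_iff)
  ultimately show ?case
    unfolding determined_on.simps by (intro exI[of _ U]) (simp add: Compl_eq_Diff_UNIV)
qed

section \<open>The Borel hierarchy of the Baire space\<close>

lemma open_coordinate: "open {y :: baire. P (y i)}"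
proof -
  have "open ((\<lambda>y :: baire. y i) -` {k. P k})"
    by (intro open_vimage open_discrete continuous_on_product_coordinates)
  then show ?thesis
    by (simp add: vimage_def)
qed

lemma open_baire_cylinderD:
  assumes "open (U :: baire set)" "x \<in> U"
  shows "\<exists>n. \<forall>y. (\<forall>i<n. y i = x i) \<longrightarrow> y \<in> U"
proof -
  have "openin (product_topology (\<lambda>_. euclidean) UNIV) U"
    using assms(1) by (simp add: open_fun_def)
  then obtain X where X: "finite {i. X i \<noteq> (UNIV :: nat set)}" "x \<in> PiE UNIV X" "PiE UNIV X \<subseteq> U"
    using product_topology_open_contains_basis[OF _ assms(2)] by (metis (no_types, lifting) Collect_cong topspace_euclidean)
  obtain n where n: "\<And>i. X i \<noteq> UNIV \<Longrightarrow> i < n"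
    using X(1) finite_nat_set_iff_bounded[of "{i. X i \<noteq> UNIV}"] by auto
  have "y \<in> U" if "\<forall>i<n. y i = x i" for y
  proof -
    have "y i \<in> X i" for i
      using that n[of i] X(2) by (cases "X i = UNIV") (auto simp: PiE_iff)
    then show ?thesis
      using X(3) by (auto simp: PiE_iff)
  qed
  then show ?thesis
    by blast
qed

definition cylinder :: "nat list \<Rightarrow> baire set" where
  "cylinder s = {y. \<forall>i<length s. y i = s ! i}"

lemma cylinder_Int: "cylinder s = (\<Inter>i\<in>{..<length s}. {y. y i = s ! i})"
  by (auto simp: cylinder_def)

lemma open_cylinder: "open (cylinder s)"
  unfolding cylinder_Int by (intro open_INT) (auto intro: open_coordinate)

lemma closed_cylinder: "closed (cylinder s)"
  unfolding closed_def cylinder_Int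
  by (simp add: Compl_INT Collect_neg_eq[symmetric]) (intro open_UN ballI open_coordinate)

lemma open_eq_Union_cylinder:
  assumes "open U"
  shows "U = (\<Union>s\<in>{s. cylinder s \<subseteq> U}. cylinder s)"
proof (intro equalityI subsetI)
  fix x assume "x \<in> U"
  then obtain n where n: "\<And>y. \<forall>i<n. y i = x i \<Longrightarrow> y \<in> U"
    using open_baire_cylinderD[OF assms] by meson
  have "x \<in> cylinder (map x [0..<n])" "cylinder (map x [0..<n]) \<subseteq> U"
    using n by (auto simp: cylinder_def)
  then show "x \<in> (\<Union>s\<in>{s. cylinder s \<subseteq> U}. cylinder s)"
    by blast
qed auto

definition Delta0 :: "omega1 \<Rightarrow> baire set \<Rightarrow> bool" where
  "Delta0 a D \<longleftrightarrow> Sigma0 euclidean a D \<and> Sigma0 euclidean a (- D)"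

lemma Delta0_one_iff: "Delta0 1 D \<longleftrightarrow> open D \<and> closed D"
  by (simp add: Delta0_def Sigma0_one_iff closed_def)

lemma Delta0_imp_Sigma0: "Delta0 a D \<Longrightarrow> Sigma0 euclidean a D"
  by (simp add: Delta0_def)

lemma Delta0_Compl: "Delta0 a D \<Longrightarrow> Delta0 a (- D)"
  by (simp add: Delta0_def)

lemma Delta0_Int: "Delta0 a D \<Longrightarrow> Delta0 a E \<Longrightarrow> Delta0 a (D \<inter> E)"
  by (simp add: Delta0_def Sigma0_Int Sigma0_Un)

lemma Delta0_Un: "Delta0 a D \<Longrightarrow> Delta0 a E \<Longrightarrow> Delta0 a (D \<union> E)"
  by (simp add: Delta0_def Sigma0_Int Sigma0_Un)

lemma Delta0_empty: "0 < a \<Longrightarrow> Delta0 a {}"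
  using Sigma0_topspace[of a euclidean] by (simp add: Delta0_def Sigma0_empty)

lemma Delta0_disjointed:
  assumes "\<And>n. Delta0 a (D n)"
  shows "Delta0 a (disjointed D n)"
proof -
  have pos: "0 < a"
    using assms[of 0] Sigma0_pos by (auto simp: Delta0_def)
  have "Delta0 a (\<Union>i\<in>{0..<n}. D i)" for n
    by (induction n) (use assms pos in \<open>simp_all add: Delta0_empty Delta0_Un atLeast0_lessThan_Suc\<close>)
  then have "Delta0 a (D n \<inter> - (\<Union>i\<in>{0..<n}. D i))"
    using assms by (intro Delta0_Int Delta0_Compl)
  then show ?thesis
    by (simp add: disjointed_def Diff_eq)
qed

lemma Delta0_Diff_lower:
  assumes "Sigma0 euclidean b A" "Sigma0 euclidean b B" "b < a"
  shows "Delta0 a (A - B)"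
proof -
  have "- (A - B) = (UNIV - A) \<union> B"
    by auto
  then show ?thesis
    using Sigma0_Diff[OF assms(1,2), of a] Sigma0_compl[OF assms(1,3)] Sigma0_mono[OF assms(2), of a]
      assms(3) Sigma0_Un[of euclidean a "UNIV - A" B] by (simp add: Delta0_def)
qed

text \<open>At the open level this is zero-dimensionality; above it the differences of sets of lower levels
  are already ambiguous.\<close>

lemma Sigma0_eq_Union_Delta0:
  assumes "Sigma0 euclidean a W"
  shows "\<exists>D :: nat \<Rightarrow> baire set. (\<forall>n. Delta0 a (D n)) \<and> W = (\<Union>n. D n)"
proof (cases "a = 1")
  case True
  then have W: "open W"
    using assms by (simp add: Sigma0_one_iff)
  define D where "D n = (if cylinder (from_nat n) \<subseteq> W then cylinder (from_nat n) else {})" for n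
  have "W = (\<Union>n. D n)"
  proof (intro equalityI subsetI)
    fix x assume "x \<in> W"
    then obtain s where "cylinder s \<subseteq> W" "x \<in> cylinder s"
      using open_eq_Union_cylinder[OF W] by blast
    then show "x \<in> (\<Union>n. D n)"
      by (intro UN_I[of "to_nat s"]) (auto simp: D_def)
  qed (auto simp: D_def split: if_splits)
  moreover have "Delta0 a (D n)" for n
    by (simp add: True D_def Delta0_one_iff open_cylinder closed_cylinder)
  ultimately show ?thesis
    by blast
next
  case False
  then have "1 < a"
    using Sigma0_pos[OF assms] one_le_iff_omega1[of a] by (simp add: less_le)
  then obtain b and A B :: "nat \<Rightarrow> baire set" where
    "\<forall>n. 0 < b n \<and> b n < a \<and> Sigma0 euclidean (b n) (A n) \<and> Sigma0 euclidean (b n) (B n)"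
    "W = (\<Union>n. A n - B n)"
    using Sigma0_as_differences[OF assms] by blast
  moreover from this have "Delta0 a (A n - B n)" for n
    using Delta0_Diff_lower by blast
  ultimately show ?thesis
    by (intro exI[of _ "\<lambda>n. A n - B n"]) simp
qed

lemma Delta0_disjoint_refinement:
  assumes "\<And>i :: nat. Sigma0 euclidean a (U i)"
  shows "\<exists>D f. (\<forall>m. Delta0 a (D m)) \<and> disjoint_family D \<and> (\<forall>m :: nat. D m \<subseteq> U (f m)) \<and>
    (\<Union>m. D m) = (\<Union>i. U i)"
proof -
  have "\<forall>i. \<exists>E :: nat \<Rightarrow> baire set. (\<forall>n. Delta0 a (E n)) \<and> U i = (\<Union>n. E n)"
    using Sigma0_eq_Union_Delta0[OF assms] by blast
  from choice[OF this] obtain E :: "nat \<Rightarrow> nat \<Rightarrow> baire set"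
    where E: "\<And>i n. Delta0 a (E i n)" "\<And>i. U i = (\<Union>n. E i n)"
    by blast
  define G where "G m = E (fst (prod_decode m)) (snd (prod_decode m))" for m
  have "(\<Union>m. G m) = (\<Union>i. U i)"
  proof (intro equalityI subsetI)
    fix x assume "x \<in> (\<Union>i. U i)"
    then obtain i n where "x \<in> E i n"
      using E(2) by blast
    then show "x \<in> (\<Union>m. G m)"
      by (intro UN_I[of "prod_encode (i, n)"]) (auto simp: G_def)
  qed (use E(2) in \<open>auto simp: G_def\<close>)
  moreover have "disjointed G m \<subseteq> U (fst (prod_decode m))" for m
    using disjointed_subset[of G m] E(2) by (auto simp: G_def)
  moreover have "Delta0 a (disjointed G m)" for m
    by (rule Delta0_disjointed) (simp add: G_def E(1))
  ultimately show ?thesis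
    using disjoint_family_disjointed[of G] UN_disjointed_eq[of G]
    by (intro exI[of _ "disjointed G"] exI[of _ "\<lambda>m. fst (prod_decode m)"]) auto
qed

lemma Sigma0_reduction:
  assumes "\<And>i :: nat. Sigma0 euclidean a (U i :: baire set)"
  shows "\<exists>V. (\<forall>i. Sigma0 euclidean a (V i)) \<and> disjoint_family V \<and> (\<forall>i. V i \<subseteq> U i) \<and>
    (\<Union>i. V i) = (\<Union>i. U i)"
proof -
  obtain D f where D: "\<And>m. Delta0 a (D m)" "disjoint_family D" "\<And>m :: nat. D m \<subseteq> U (f m)"
    "(\<Union>m. D m) = (\<Union>i. U i)"
    using Delta0_disjoint_refinement[of a U, OF assms] by blast
  define V where "V i = (\<Union>m\<in>{m. f m = i}. D m)" for i
  have "Sigma0 euclidean a (V i)" for i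
    unfolding V_def using Sigma0_pos[OF assms[of 0]] Delta0_imp_Sigma0[OF D(1)]
    by (intro Sigma0_UN) simp_all
  moreover have "disjoint_family V"
    unfolding disjoint_family_on_def
  proof (intro ballI impI)
    fix i j :: nat assume "i \<noteq> j"
    have "D m \<inter> D n = {}" if "f m = i" "f n = j" for m n
    proof -
      have "m \<noteq> n"
        using that \<open>i \<noteq> j\<close> by auto
      then show ?thesis
        using D(2) by (simp add: disjoint_family_on_def)
    qed
    then show "V i \<inter> V j = {}"
      unfolding V_def by blast
  qed
  moreover have "V i \<subseteq> U i" for i
    unfolding V_def using D(3) by (intro UN_least) auto
  moreover have "(\<Union>i. V i) = (\<Union>i. U i)"
    unfolding D(4)[symmetric] V_def by blast
  ultimately show ?thesis
    by blast
qed

section \<open>Lowering the level by substitution\<close>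

definition pulls_back :: "(baire \<Rightarrow> baire) \<Rightarrow> baire set set \<Rightarrow> bool" where
  "pulls_back g \<D> \<longleftrightarrow> (\<forall>D\<in>\<D>. \<exists>K. open K \<and> closed K \<and> D = g -` K)"

text \<open>Maps are compared by the ambiguous sets of level \<open>1 + c\<close> that they pull back from clopen sets,
  and a property holds for fine maps if countably many such sets suffice to guarantee it. Like the
  eventual validity along a filter, this notion is stable under countable conjunctions, so sets and
  functions can be treated one at a time.\<close>

definition for_fine_maps :: "omega1 \<Rightarrow> ((baire \<Rightarrow> baire) \<Rightarrow> bool) \<Rightarrow> bool" where
  "for_fine_maps c P \<longleftrightarrow> (\<exists>\<D>. countable \<D> \<and> (\<forall>D\<in>\<D>. Delta0 (1 + c) D) \<and> (\<forall>g. pulls_back g \<D> \<longrightarrow> P g))"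

lemma for_fine_maps_mono: "for_fine_maps c P \<Longrightarrow> (\<And>g. P g \<Longrightarrow> Q g) \<Longrightarrow> for_fine_maps c Q"
  unfolding for_fine_maps_def by blast

lemma for_fine_maps_all:
  assumes "\<And>i :: nat. for_fine_maps c (P i)"
  shows "for_fine_maps c (\<lambda>g. \<forall>i. P i g)"
proof -
  have "\<forall>i. \<exists>\<D>. countable \<D> \<and> (\<forall>D\<in>\<D>. Delta0 (1 + c) D) \<and> (\<forall>g. pulls_back g \<D> \<longrightarrow> P i g)"
    using assms unfolding for_fine_maps_def by blast
  from choice[OF this] obtain \<D> where
    \<D>: "\<forall>i. countable (\<D> i) \<and> (\<forall>D\<in>\<D> i. Delta0 (1 + c) D) \<and> (\<forall>g. pulls_back g (\<D> i) \<longrightarrow> P i g)" ..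
  have "pulls_back g (\<D> i)" if "pulls_back g (\<Union>i. \<D> i)" for g i
    using that unfolding pulls_back_def by blast
  then show ?thesis
    unfolding for_fine_maps_def using \<D> by (intro exI[of _ "\<Union>i. \<D> i"]) simp
qed

lemma for_fine_maps_conj:
  assumes "for_fine_maps c P" "for_fine_maps c Q"
  shows "for_fine_maps c (\<lambda>g. P g \<and> Q g)"
proof -
  have "for_fine_maps c (\<lambda>g. \<forall>i :: nat. (if i = 0 then P else Q) g)"
    using assms by (intro for_fine_maps_all) simp
  then show ?thesis
    by (rule for_fine_maps_mono) (metis zero_neq_one)
qed

text \<open>A set of level \<open>1 + c + b\<close> is built in \<open>b\<close> steps from countably many ambiguous sets of level
  \<open>1 + c\<close>; once a map pulls these back from clopen sets, the steps can be carried out on its target.\<close>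

lemma Sigma0_factor:
  assumes "Sigma0 euclidean (1 + (c + b)) (W :: baire set)"
  shows "for_fine_maps c (\<lambda>g :: baire \<Rightarrow> baire. \<exists>V. Sigma0 euclidean (1 + b) V \<and> W = g -` V)"
  using assms
proof (induction b arbitrary: W rule: less_induct)
  case (less b)
  show ?case
  proof (cases "b = 0")
    case True
    obtain D :: "nat \<Rightarrow> baire set" where D: "\<forall>n. Delta0 (1 + c) (D n)" "W = (\<Union>n. D n)"
      using Sigma0_eq_Union_Delta0[of "1 + c" W] less.prems True by auto
    have "\<exists>V. Sigma0 euclidean (1 + b) V \<and> W = g -` V" if g: "pulls_back g (range D)" for g
    proof -
      have "\<forall>n. \<exists>K. open K \<and> D n = g -` K"
        using g unfolding pulls_back_def by blast
      from choice[OF this] obtain K where K: "\<forall>n. open (K n) \<and> D n = g -` K n" ..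
      then have "open (\<Union>n. K n)" "W = g -` (\<Union>n. K n)"
        using D(2) by (simp_all add: vimage_UN open_UN)
      then show ?thesis
        by (intro exI[of _ "\<Union>n. K n"]) (simp add: True Sigma0_one_iff)
    qed
    then show ?thesis
      unfolding for_fine_maps_def using D(1) by (intro exI[of _ "range D"]) simp
  next
    case False
    then have b: "0 < b"
      by (simp add: less_le)
    then have "1 < 1 + (c + b)"
      using le_less_trans[OF le_add_omega1[of 1 c], of "1 + c + b"]
        add_strict_mono_omega1[of 0 b "1 + c"] by (simp add: add_assoc_omega1)
    then obtain d and A B :: "nat \<Rightarrow> baire set" where
      dAB: "\<forall>n. 0 < d n \<and> d n < 1 + (c + b) \<and> Sigma0 euclidean (d n) (A n) \<and> Sigma0 euclidean (d n) (B n)"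
      and W: "W = (\<Union>n. A n - B n)"
      using Sigma0_as_differences[OF less.prems] by blast
    have "\<forall>n. \<exists>e. e < b \<and> d n \<le> 1 + (c + e)"
      using less_add_posE_omega1[of _ "1 + c" b] dAB b by (simp add: add_assoc_omega1)
    from choice[OF this] obtain e where e: "\<forall>n. e n < b \<and> d n \<le> 1 + (c + e n)" ..
    let ?P = "\<lambda>n (g :: baire \<Rightarrow> baire). \<exists>V. Sigma0 euclidean (1 + e n) V \<and> A n = g -` V"
    let ?Q = "\<lambda>n (g :: baire \<Rightarrow> baire). \<exists>V. Sigma0 euclidean (1 + e n) V \<and> B n = g -` V"
    have "Sigma0 euclidean (1 + (c + e n)) (A n)" "Sigma0 euclidean (1 + (c + e n)) (B n)" for n
      using Sigma0_mono dAB e by blast+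
    then have "for_fine_maps c (?P n)" "for_fine_maps c (?Q n)" for n
      using less.IH e by blast+
    then have "for_fine_maps c (\<lambda>g. ?P n g \<and> ?Q n g)" for n
      by (rule for_fine_maps_conj)
    then have "for_fine_maps c (\<lambda>g. \<forall>n. ?P n g \<and> ?Q n g)"
      by (rule for_fine_maps_all)
    then show ?thesis
    proof (rule for_fine_maps_mono)
      fix g :: "baire \<Rightarrow> baire" assume g: "\<forall>n. ?P n g \<and> ?Q n g"
      then have "\<forall>n. ?P n g"
        by blast
      from choice[OF this] obtain A' where A': "\<forall>n. Sigma0 euclidean (1 + e n) (A' n) \<and> A n = g -` A' n" ..
      have "\<forall>n. ?Q n g"
        using g by blast
      from choice[OF this] obtain B' where B': "\<forall>n. Sigma0 euclidean (1 + e n) (B' n) \<and> B n = g -` B' n" ..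
      have "1 + e n < 1 + b" for n
        using e by (intro add_strict_mono_omega1) blast
      then have "Sigma0 euclidean (1 + b) (A' n - B' n)" for n
        using A' B' by (intro Sigma0_Diff[of _ "1 + e n" _ "1 + e n"]) (auto intro: less_imp_le)
      then have "Sigma0 euclidean (1 + b) (\<Union>n. A' n - B' n)"
        by (rule Sigma0_UN_nat)
      moreover have "W = g -` (\<Union>n. A' n - B' n)"
        unfolding W vimage_UN vimage_Diff using A' B' by simp
      ultimately show "\<exists>V. Sigma0 euclidean (1 + b) V \<and> W = g -` V"
        by blast
    qed
  qed
qed

text \<open>The disjointness of the sets \<open>V i\<close> on the whole target, also off the range of \<open>g\<close>, is what makes it
  possible to define functions on the target piecewise.\<close>

lemma Sigma0_factor_sequence:
  fixes U :: "nat \<Rightarrow> baire set"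
  assumes "\<And>i. Sigma0 euclidean (1 + (c + b)) (U i)"
  shows "for_fine_maps c (\<lambda>g :: baire \<Rightarrow> baire. \<exists>V. (\<forall>i. Sigma0 euclidean (1 + b) (V i)) \<and> disjoint_family V \<and>
      (\<forall>i. g -` V i \<subseteq> U i) \<and> (\<Union>i. g -` V i) = (\<Union>i. U i))"
proof -
  have "for_fine_maps c (\<lambda>g. \<forall>i. \<exists>V. Sigma0 euclidean (1 + b) V \<and> U i = g -` V)"
    using Sigma0_factor[OF assms] by (rule for_fine_maps_all)
  then show ?thesis
  proof (rule for_fine_maps_mono)
    fix g :: "baire \<Rightarrow> baire" assume "\<forall>i. \<exists>V. Sigma0 euclidean (1 + b) V \<and> U i = g -` V"
    from choice[OF this] obtain V' where V': "\<forall>i. Sigma0 euclidean (1 + b) (V' i) \<and> U i = g -` V' i" ..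
    then have "Sigma0 euclidean (1 + b) (V' i)" for i
      by blast
    from Sigma0_reduction[of _ V', OF this] obtain V where V: "\<forall>i. Sigma0 euclidean (1 + b) (V i)"
      "disjoint_family V" "\<forall>i. V i \<subseteq> V' i" "(\<Union>i. V i) = (\<Union>i. V' i)"
      by (elim exE conjE) (rule that)
    have "(\<Union>i. g -` V i) = g -` (\<Union>i. V' i)"
      using V(4) by (simp only: vimage_UN[symmetric])
    then have "(\<Union>i. g -` V i) = (\<Union>i. U i)"
      using V' by (simp add: vimage_UN)
    moreover have "\<forall>i. g -` V i \<subseteq> U i"
      using V(3) V' by (simp add: vimage_mono)
    ultimately show "\<exists>V. (\<forall>i. Sigma0 euclidean (1 + b) (V i)) \<and> disjoint_family V \<and>
        (\<forall>i. g -` V i \<subseteq> U i) \<and> (\<Union>i. g -` V i) = (\<Union>i. U i)"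
      using V(1,2) by blast
  qed
qed

definition paste :: "(nat \<Rightarrow> 'a set) \<Rightarrow> (nat \<Rightarrow> 'a \<Rightarrow> 'q) \<Rightarrow> ('a \<Rightarrow> 'q) \<Rightarrow> 'a \<Rightarrow> 'q" where
  "paste V As A0 y = (if y \<in> (\<Union>i. V i) then As (THE i. y \<in> V i) y else A0 y)"

lemma paste_in:
  assumes "disjoint_family V" "y \<in> V i"
  shows "paste V As A0 y = As i y"
proof -
  have "(THE i. y \<in> V i) = i"
    using assms by (intro the_equality) (auto simp: disjoint_family_on_def)
  then show ?thesis
    using assms(2) by (auto simp: paste_def)
qed

lemma paste_out: "y \<notin> (\<Union>i. V i) \<Longrightarrow> paste V As A0 y = A0 y"
  by (simp add: paste_def)

lemma paste_factor:
  assumes V: "disjoint_family V" "\<forall>i. g -` V i \<subseteq> U i" "(\<Union>i. g -` V i) = (\<Union>i. U i)"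
    and As: "\<And>i x. x \<in> Y \<inter> U i \<Longrightarrow> A x = As i (g x)"
    and A0: "\<And>x. x \<in> Y - (\<Union>i. U i) \<Longrightarrow> A x = A0 (g x)"
    and x: "x \<in> Y"
  shows "A x = paste V As A0 (g x)"
proof (cases "x \<in> (\<Union>i. U i)")
  case True
  then obtain i where i: "g x \<in> V i"
    using V(3) by blast
  then have "x \<in> Y \<inter> U i"
    using x V(2) by blast
  then show ?thesis
    using As paste_in[OF V(1) i, of As A0] by simp
next
  case False
  then have "g x \<notin> (\<Union>i. V i)"
    using V(3) by blast
  then show ?thesis
    using False A0 x by (simp add: paste_out)
qed

text \<open>Functions \<open>As i\<close> for the subterms are defined on the whole target of \<open>g\<close> and pasted along the
  disjoint sets \<open>V i\<close>. The result need only agree with \<open>A\<close> along \<open>g\<close> on \<open>Y\<close>.\<close>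

lemma determined_on_factor:
  fixes A :: "baire \<Rightarrow> 'q"
  assumes "determined_on euclidean u (c + b) Y A"
  shows "for_fine_maps c
    (\<lambda>g :: baire \<Rightarrow> baire. \<exists>A'. determined_on (euclidean :: baire topology) u b UNIV A' \<and> (\<forall>x\<in>Y. A x = A' (g x)))"
  using assms
proof (induction u arbitrary: b Y)
  case (Const q)
  then have "\<exists>A'. determined_on (euclidean :: baire topology) (Const q) b UNIV A' \<and>
      (\<forall>x\<in>Y. A x = A' (g x))" for g :: "baire \<Rightarrow> baire"
    by (intro exI[of _ "\<lambda>_. q"]) simp
  then show ?case
    unfolding for_fine_maps_def by (intro exI[of _ "{}"]) simp
next
  case (S a u)
  then show ?case
    using S.IH[of "b + omega_pow a" Y] by (simp add: add_assoc_omega1)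
next
  case (FQ q us)
  obtain U where U: "\<And>i. Sigma0 euclidean (1 + (c + b)) (U i)" "\<forall>x\<in>Y - (\<Union>i. U i). A x = q"
    "\<And>i. determined_on euclidean (us i) (c + b) (Y \<inter> U i) A"
    using FQ.prems by auto
  let ?P = "\<lambda>i (g :: baire \<Rightarrow> baire). \<exists>A'. determined_on (euclidean :: baire topology) (us i) b UNIV A' \<and>
      (\<forall>x\<in>Y \<inter> U i. A x = A' (g x))"
  let ?R = "\<lambda>g :: baire \<Rightarrow> baire. \<exists>V. (\<forall>i. Sigma0 euclidean (1 + b) (V i)) \<and> disjoint_family V \<and>
      (\<forall>i. g -` V i \<subseteq> U i) \<and> (\<Union>i. g -` V i) = (\<Union>i. U i)"
  have "for_fine_maps c (\<lambda>g. \<forall>i. ?P i g)"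
    by (rule for_fine_maps_all) (rule FQ.IH[OF rangeI U(3)])
  moreover have "for_fine_maps c ?R"
    by (rule Sigma0_factor_sequence) (rule U(1))
  ultimately have "for_fine_maps c (\<lambda>g. (\<forall>i. ?P i g) \<and> ?R g)"
    by (rule for_fine_maps_conj)
  then show ?case
  proof (rule for_fine_maps_mono)
    fix g :: "baire \<Rightarrow> baire" assume g: "(\<forall>i. ?P i g) \<and> ?R g"
    then obtain V where V: "\<forall>i. Sigma0 euclidean (1 + b) (V i)" "disjoint_family V"
      "\<forall>i. g -` V i \<subseteq> U i" "(\<Union>i. g -` V i) = (\<Union>i. U i)"
      by (elim conjE exE) (rule that)
    from g have "\<forall>i. ?P i g"
      by (elim conjE)
    from choice[OF this] obtain As where As: "\<forall>i. determined_on euclidean (us i) b UNIV (As i) \<and>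
        (\<forall>x\<in>Y \<inter> U i. A x = As i (g x))" ..
    let ?A' = "paste V As (\<lambda>_. q)"
    have "determined_on euclidean (us i) b (UNIV \<inter> V i) ?A'" for i
      by (rule determined_on_cong[of _ _ _ UNIV "As i"]) (use As in \<open>simp_all add: paste_in[OF V(2)]\<close>)
    then have "determined_on euclidean (FQ q us) b UNIV ?A'"
      using V(1) unfolding determined_on.simps by (intro exI[of _ V]) (simp add: paste_out)
    moreover have "A x = ?A' (g x)" if "x \<in> Y" for x
      by (rule paste_factor[OF V(2-4) _ _ that]) (use As U(2) in blast)+
    ultimately show "\<exists>A'. determined_on euclidean (FQ q us) b UNIV A' \<and> (\<forall>x\<in>Y. A x = A' (g x))"
      by blast
  qed
next
  case (FA a us)
  obtain U where U: "\<And>i. Sigma0 euclidean (1 + (c + b)) (U i)"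
    "determined_on euclidean (us 0) (c + b + omega_pow a) (Y - (\<Union>i. U i)) A"
    "\<And>i. determined_on euclidean (us (Suc i)) (c + b) (Y \<inter> U i) A"
    using FA.prems by auto
  let ?P = "\<lambda>i (g :: baire \<Rightarrow> baire). \<exists>A'. determined_on (euclidean :: baire topology) (us (Suc i)) b UNIV A' \<and>
      (\<forall>x\<in>Y \<inter> U i. A x = A' (g x))"
  let ?N = "\<lambda>g :: baire \<Rightarrow> baire. \<exists>A'. determined_on (euclidean :: baire topology) (us 0) (b + omega_pow a) UNIV A' \<and>
      (\<forall>x\<in>Y - (\<Union>i. U i). A x = A' (g x))"
  let ?R = "\<lambda>g :: baire \<Rightarrow> baire. \<exists>V. (\<forall>i. Sigma0 euclidean (1 + b) (V i)) \<and> disjoint_family V \<and>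
      (\<forall>i. g -` V i \<subseteq> U i) \<and> (\<Union>i. g -` V i) = (\<Union>i. U i)"
  have "for_fine_maps c (\<lambda>g. \<forall>i. ?P i g)"
    by (rule for_fine_maps_all) (rule FA.IH[OF rangeI U(3)])
  moreover have "for_fine_maps c ?N"
    by (rule FA.IH[OF rangeI U(2)[unfolded add_assoc_omega1]])
  ultimately have "for_fine_maps c (\<lambda>g. (\<forall>i. ?P i g) \<and> ?N g)"
    by (rule for_fine_maps_conj)
  moreover have "for_fine_maps c ?R"
    by (rule Sigma0_factor_sequence) (rule U(1))
  ultimately have "for_fine_maps c (\<lambda>g. ((\<forall>i. ?P i g) \<and> ?N g) \<and> ?R g)"
    by (rule for_fine_maps_conj)
  then show ?case
  proof (rule for_fine_maps_mono)
    fix g :: "baire \<Rightarrow> baire" assume g: "((\<forall>i. ?P i g) \<and> ?N g) \<and> ?R g"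
    then obtain V where V: "\<forall>i. Sigma0 euclidean (1 + b) (V i)" "disjoint_family V"
      "\<forall>i. g -` V i \<subseteq> U i" "(\<Union>i. g -` V i) = (\<Union>i. U i)"
      by (elim conjE exE) (rule that)
    from g have "\<forall>i. ?P i g"
      by (elim conjE)
    from choice[OF this] obtain As where As: "\<forall>i. determined_on euclidean (us (Suc i)) b UNIV (As i) \<and>
        (\<forall>x\<in>Y \<inter> U i. A x = As i (g x))" ..
    from g have "?N g"
      by (elim conjE)
    then obtain A0 where A0: "determined_on (euclidean :: baire topology) (us 0) (b + omega_pow a) UNIV A0"
      "\<forall>x\<in>Y - (\<Union>i. U i). A x = A0 (g x)"
      by (elim exE conjE) (rule that)
    let ?A' = "paste V As A0"
    have "determined_on euclidean (us (Suc i)) b (UNIV \<inter> V i) ?A'" for i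
      by (rule determined_on_cong[of _ _ _ UNIV "As i"]) (use As in \<open>simp_all add: paste_in[OF V(2)]\<close>)
    moreover have "determined_on euclidean (us 0) (b + omega_pow a) (UNIV - (\<Union>i. V i)) ?A'"
      using A0(1) by (rule determined_on_cong[of _ _ _ UNIV A0]) (simp_all add: paste_out)
    ultimately have "determined_on euclidean (FA a us) b UNIV ?A'"
      using V(1) unfolding determined_on.simps by (intro exI[of _ V]) simp
    moreover have "A x = ?A' (g x)" if "x \<in> Y" for x
      by (rule paste_factor[OF V(2-4) _ _ that]) (use As A0(2) in blast)+
    ultimately show "\<exists>A'. determined_on euclidean (FA a us) b UNIV A' \<and> (\<forall>x\<in>Y. A x = A' (g x))"
      by blast
  qed
qed

lemma Sigma0_vimage_coordinatewise:
  assumes "0 < a" "\<And>i k. Sigma0 Z a {x \<in> topspace Z. g x i = k}" "open U"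
  shows "Sigma0 Z a {x \<in> topspace Z. g x \<in> (U :: baire set)}"
proof -
  have cyl: "Sigma0 Z a {x \<in> topspace Z. g x \<in> cylinder s}" for s
  proof (induction s rule: rev_induct)
    case Nil
    then show ?case
      using Sigma0_topspace[OF assms(1)] by (simp add: cylinder_def)
  next
    case (snoc k s)
    have "{x \<in> topspace Z. g x \<in> cylinder (s @ [k])} =
        {x \<in> topspace Z. g x \<in> cylinder s} \<inter> {x \<in> topspace Z. g x (length s) = k}"
      by (auto simp: cylinder_def nth_append less_Suc_eq)
    then show ?case
      using Sigma0_Int[OF snoc assms(2)] by simp
  qed
  have "{x \<in> topspace Z. g x \<in> U} =
      (\<Union>s\<in>{s. cylinder s \<subseteq> U}. {x \<in> topspace Z. g x \<in> cylinder s})"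
    using open_eq_Union_cylinder[OF assms(3)] by blast
  then show ?thesis
    using Sigma0_UN[OF _ assms(1) cyl, of "{s. cylinder s \<subseteq> U}"] by simp
qed

text \<open>The characteristic functions of countably many sets, taken as coordinates, form a map that pulls
  all of them back from clopen sets.\<close>

lemma pulls_back_exists:
  assumes "countable \<D>" "0 < a" "\<And>D. D \<in> \<D> \<Longrightarrow> Delta0 a D"
  shows "\<exists>g. Sigma0_measurable a g \<and> pulls_back g \<D>"
proof -
  define D where "D = from_nat_into (insert {} \<D>)"
  have range: "range D = insert {} \<D>"
    using assms(1) by (simp add: D_def)
  have Delta: "Delta0 a (D n)" for n
  proof -
    have "D n \<in> insert {} \<D>"
      unfolding range[symmetric] by simp
    then show ?thesis
      using assms(3) Delta0_empty[OF assms(2)] by auto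
  qed
  define g :: "baire \<Rightarrow> baire" where "g x n = of_bool (x \<in> D n)" for x n
  have "Sigma0 euclidean a {x \<in> topspace euclidean. g x i = k}" for i k
  proof -
    have "{x. g x i = k} = (if k = 1 then D i else if k = 0 then - D i else {})"
      by (auto simp: g_def)
    then show ?thesis
      using Delta[of i] Sigma0_empty[OF assms(2), of "euclidean :: baire topology"] by (simp add: Delta0_def)
  qed
  then have "Sigma0_measurable a g"
    using Sigma0_vimage_coordinatewise[OF assms(2), of euclidean g]
    by (simp add: Sigma0_measurable_def vimage_def)
  moreover have "\<exists>K. open K \<and> closed K \<and> D n = g -` K" for n
  proof (intro exI conjI)
    show "open {y :: baire. y n = 1}"
      by (rule open_coordinate)
    have "{y :: baire. y n = 1} = - {y. y n \<noteq> 1}"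
      by auto
    then show "closed {y :: baire. y n = 1}"
      using open_coordinate[of "\<lambda>k. k \<noteq> 1" n] by (simp add: closed_def)
    show "D n = g -` {y. y n = 1}"
      by (auto simp: g_def)
  qed
  then have "\<exists>K. open K \<and> closed K \<and> E = g -` K" if "E \<in> range D" for E
    using that by blast
  then have "pulls_back g \<D>"
    unfolding pulls_back_def range by blast
  ultimately show ?thesis
    by blast
qed

text \<open>The converse of the substitution rule: a shift by \<open>c\<close> is always caused by a map measurable at
  level \<open>1 + c\<close>.\<close>

theorem determined_on_unshift:
  fixes A :: "baire \<Rightarrow> 'q"
  assumes "determined_on euclidean u c Y A"
  shows "\<exists>g A'. Sigma0_measurable (1 + c) g \<and> determined_on (euclidean :: baire topology) u 0 UNIV A' \<and>
    (\<forall>x\<in>Y. A x = A' (g x))"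
proof -
  have "determined_on euclidean u (c + 0) Y A"
    using assms by simp
  from determined_on_factor[OF this] obtain \<D> where \<D>: "countable \<D>" "\<forall>D\<in>\<D>. Delta0 (1 + c) D"
    "\<forall>g. pulls_back g \<D> \<longrightarrow>
      (\<exists>A'. determined_on (euclidean :: baire topology) u 0 UNIV A' \<and> (\<forall>x\<in>Y. A x = A' (g x)))"
    unfolding for_fine_maps_def by blast
  then obtain g where "Sigma0_measurable (1 + c) g" "pulls_back g \<D>"
    using pulls_back_exists[of \<D> "1 + c"] by auto
  then show ?thesis
    using \<D>(3) by blast
qed

section \<open>From families on the Baire space to the Wadge hierarchy\<close>

lemma Sigma0_measurable_compose_continuous:
  assumes "Sigma0_measurable (1 + a) g" "continuous_on UNIV f"
  shows "Sigma0_measurable (1 + a) (f \<circ> g)" "Sigma0_measurable (1 + a) (g \<circ> f)"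
proof -
  show "Sigma0_measurable (1 + a) (f \<circ> g)"
    using assms unfolding Sigma0_measurable_def vimage_comp[symmetric]
    by (simp add: open_vimage)
  have "Sigma0 euclidean (1 + a) (f -` W)" if "Sigma0 euclidean (1 + a) W" for W
  proof -
    have "\<exists>V. Sigma0 euclidean (1 + (0 + a)) V \<and> (\<forall>x\<in>UNIV. x \<in> V \<longleftrightarrow> f x \<in> W)"
    proof (rule Sigma0_pullback[OF _ that])
      show "\<exists>V. Sigma0 euclidean (1 + 0) V \<and> (\<forall>x\<in>UNIV. x \<in> V \<longleftrightarrow> f x \<in> U)"
        if "openin euclidean U" for U
        using that assms(2) by (intro exI[of _ "f -` U"]) (simp add: Sigma0_one_iff open_vimage)
    qed
    then obtain V where V: "Sigma0 euclidean (1 + (0 + a)) V" "\<forall>x\<in>UNIV. x \<in> V \<longleftrightarrow> f x \<in> W"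
      by blast
    have "V = f -` W"
      using V(2) by auto
    then show ?thesis
      using V(1) by simp
  qed
  then show "Sigma0_measurable (1 + a) (g \<circ> f)"
    using assms(1) unfolding Sigma0_measurable_def vimage_comp[symmetric] by simp
qed

lemma jump_compose_continuous:
  assumes "B \<in> jump a C" "continuous_on UNIV f"
  shows "B \<circ> f \<in> jump a C"
proof -
  obtain A g where *: "B = A \<circ> g" "A \<in> C" "Sigma0_measurable (1 + omega_pow a) g"
    using assms(1) unfolding jump_def by blast
  have "B \<circ> f = A \<circ> (g \<circ> f)"
    by (simp add: *(1) comp_assoc)
  moreover have "Sigma0_measurable (1 + omega_pow a) (g \<circ> f)"
    using Sigma0_measurable_compose_continuous(2)[OF *(3) assms(2)] .
  ultimately show ?thesis
    using *(2) unfolding jump_def by blast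
qed

lemma continuous_on_baire_iff:
  fixes f :: "'a :: topological_space \<Rightarrow> baire"
  shows "continuous_on D f \<longleftrightarrow> (\<forall>i. continuous_on D (\<lambda>x. f x i))"
  by (auto intro: continuous_on_product_then_coordinatewise continuous_on_coordinatewise_then_product)

text \<open>The identification of functions on an open set with functions on the Baire space uses an
  arbitrary homeomorphism \<open>h\<close>. Reading them through another continuous surjection onto the open set
  amounts to a composition with a continuous surjection of the Baire space.\<close>

lemma lift_to_open_piece:
  assumes U: "homeomorphic_map euclidean (top_of_set U) h"
    and f: "continuous_on UNIV f" "range f = U"
  shows "\<exists>p :: baire \<Rightarrow> baire. continuous_on UNIV p \<and> surj p \<and> f = h \<circ> p"
proof -
  obtain h' where h': "homeomorphic_maps euclidean (top_of_set U) h h'"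
    using U homeomorphic_map_maps by blast
  then have cont: "continuous_on U h'" and inv: "\<And>y. y \<in> U \<Longrightarrow> h (h' y) = y" "\<And>x. h' (h x) = x"
    unfolding homeomorphic_maps_def by simp_all
  have hU: "h x \<in> U" for x
    using homeomorphic_imp_surjective_map[OF U] by auto
  have "continuous_on UNIV (h' \<circ> f)"
    using f(1) cont unfolding f(2)[symmetric] by (rule continuous_on_compose)
  moreover have "surj (h' \<circ> f)"
    unfolding surj_def
  proof
    fix x
    obtain y where "h x = f y"
      using f(2) hU[of x] by auto
    then have "(h' \<circ> f) y = x"
      using inv(2)[of x] by (simp add: comp_def)
    then show "\<exists>y. x = (h' \<circ> f) y"
      by metis
  qed
  moreover have "f = h \<circ> (h' \<circ> f)"
    using f(2) inv(1) by (intro ext) (metis comp_apply rangeI)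
  ultimately show ?thesis
    by blast
qed

text \<open>A point of the Baire space is read as a matrix. Row \<open>0\<close> is a free parameter, row \<open>1\<close> contains
  labels, and row \<open>m + 2\<close> is the payload that belongs to label \<open>m\<close>. The first non-zero label selects an
  open piece together with a payload; the points without non-zero labels form the remaining closed
  set.\<close>

definition baire_row :: "nat \<Rightarrow> baire \<Rightarrow> baire" where
  "baire_row m y = (\<lambda>n. y (prod_encode (m, n)))"

definition first_label :: "baire \<Rightarrow> nat" where
  "first_label y = (LEAST m. baire_row 1 y m \<noteq> 0)"

definition piece :: "nat \<Rightarrow> baire set" where
  "piece i = {y. baire_row 1 y (first_label y) = Suc i}"

definition payload :: "baire \<Rightarrow> baire" where
  "payload y = baire_row (first_label y + 2) y"

lemma first_label_eqI: "baire_row 1 y m \<noteq> 0 \<Longrightarrow> (\<And>k. k < m \<Longrightarrow> baire_row 1 y k = 0) \<Longrightarrow> first_label y = m"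
  unfolding first_label_def by (intro Least_equality) (auto simp: not_less[symmetric])

definition piece_at :: "nat \<Rightarrow> nat \<Rightarrow> baire set" where
  "piece_at i m = {y. baire_row 1 y m = Suc i} \<inter> (\<Inter>k\<in>{..<m}. {y. baire_row 1 y k = 0})"

lemma piece_at_first_label: "y \<in> piece_at i m \<Longrightarrow> first_label y = m"
  by (intro first_label_eqI) (auto simp: piece_at_def)

lemma piece_eq: "piece i = (\<Union>m. piece_at i m)"
proof (intro equalityI subsetI)
  fix y assume "y \<in> piece i"
  moreover from this have "baire_row 1 y k = 0" if "k < first_label y" for k
    using not_less_Least[of k "\<lambda>m. baire_row 1 y m \<noteq> 0"] that by (simp add: first_label_def)
  ultimately show "y \<in> (\<Union>m. piece_at i m)"
    by (intro UN_I[of "first_label y"]) (auto simp: piece_def piece_at_def)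
next
  fix y assume "y \<in> (\<Union>m. piece_at i m)"
  then show "y \<in> piece i"
    using piece_at_first_label by (auto simp: piece_def piece_at_def)
qed

lemma open_piece_at: "open (piece_at i m)"
  unfolding piece_at_def baire_row_def by (intro open_Int open_INT ballI open_coordinate) simp

lemma piece_iff_nonzero: "y \<in> (\<Union>i. piece i) \<longleftrightarrow> (\<exists>m. baire_row 1 y m \<noteq> 0)"
proof
  assume "\<exists>m. baire_row 1 y m \<noteq> 0"
  then have "baire_row 1 y (first_label y) \<noteq> 0"
    unfolding first_label_def by (rule LeastI_ex)
  then obtain i where "baire_row 1 y (first_label y) = Suc i"
    using not0_implies_Suc by blast
  then have "y \<in> piece i"
    unfolding piece_def by simp
  then show "y \<in> (\<Union>i. piece i)"
    by blast
next
  assume "y \<in> (\<Union>i. piece i)"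
  then obtain i where "baire_row 1 y (first_label y) = Suc i"
    unfolding piece_def by blast
  then show "\<exists>m. baire_row 1 y m \<noteq> 0"
    by (metis nat.distinct(2))
qed

lemma continuous_row: "continuous_on D (baire_row m)"
  unfolding continuous_on_baire_iff baire_row_def
  by (auto intro: continuous_on_subset[OF continuous_on_product_coordinates])

lemma continuous_payload: "continuous_on (piece i) payload"
  unfolding piece_eq
proof (rule continuous_on_open_UN)
  show "open (piece_at i m)" for m
    by (rule open_piece_at)
  show "continuous_on (piece_at i m) payload" for m
    using continuous_row by (rule continuous_on_eq) (simp add: payload_def piece_at_first_label)
qed

definition baire_matrix :: "baire \<Rightarrow> (nat \<Rightarrow> nat) \<Rightarrow> (nat \<Rightarrow> baire) \<Rightarrow> baire" where
  "baire_matrix x l p j = (case prod_decode j of (m, n) \<Rightarrow>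
     if m = 0 then x n else if m = 1 then l n else p (m - 2) n)"

lemma row_matrix: "baire_row 0 (baire_matrix x l p) = x" "baire_row 1 (baire_matrix x l p) = l"
  "baire_row (m + 2) (baire_matrix x l p) = p m"
  by (auto simp: baire_row_def baire_matrix_def)

lemma payload_surj: "payload ` piece i = UNIV"
proof -
  have "z \<in> payload ` piece i" for z
  proof -
    let ?y = "baire_matrix z (\<lambda>_. Suc i) (\<lambda>_. z)"
    have "first_label ?y = 0"
      by (intro first_label_eqI) (simp_all add: row_matrix del: One_nat_def)
    then have "?y \<in> piece i" "payload ?y = z"
      by (simp_all only: piece_def payload_def row_matrix mem_Collect_eq)
    then show ?thesis
      by (metis image_eqI)
  qed
  then show ?thesis
    by blast
qed

lemma open_pieces_piece: "open_pieces piece"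
proof -
  have "open (piece i)" for i
    unfolding piece_eq by (intro open_UN ballI open_piece_at)
  moreover have "piece i \<noteq> {}" for i
    using payload_surj[of i] by auto
  moreover have "disjoint_family piece"
    by (auto simp: disjoint_family_on_def piece_def)
  moreover have "baire_matrix undefined (\<lambda>_. 0) undefined \<notin> (\<Union>i. piece i)"
    unfolding piece_iff_nonzero row_matrix by simp
  ultimately show ?thesis
    unfolding open_pieces_def by blast
qed

text \<open>Given clopen disjoint sets \<open>D m\<close>, the label \<open>m\<close> of the image of \<open>x\<close> is non-zero exactly if \<open>x\<close>
  lies in \<open>D m\<close>. Every entry of the matrix is therefore locally constant in \<open>x\<close>; a discontinuity at a
  limit of the sets \<open>D m\<close> cannot arise, because each of them uses its own row.\<close>

definition glue :: "(nat \<Rightarrow> baire set) \<Rightarrow> (nat \<Rightarrow> nat) \<Rightarrow> (nat \<Rightarrow> baire \<Rightarrow> baire) \<Rightarrow> baire \<Rightarrow> baire" where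
  "glue D e f x = baire_matrix x (\<lambda>m. if x \<in> D m then Suc (e m) else 0)
     (\<lambda>m. if x \<in> D m then f (e m) x else (\<lambda>_. 0))"

lemma continuous_if_clopen:
  fixes g :: "baire \<Rightarrow> nat"
  assumes "open D" "closed D" "continuous_on UNIV g"
  shows "continuous_on UNIV (\<lambda>x. if x \<in> D then g x else 0)"
proof -
  have "continuous_on (D \<union> - D) (\<lambda>x. if x \<in> D then g x else 0)"
  proof (rule continuous_on_cases)
    show "closed D" "closed (- D)" "continuous_on (- D) (\<lambda>_. 0 :: nat)"
      using assms by (simp_all add: closed_Compl)
    show "continuous_on D g"
      using assms(3) by (rule continuous_on_subset) simp
  qed simp
  then show ?thesis
    by simp
qed

lemma continuous_glue:
  assumes D: "\<And>m. open (D m)" "\<And>m. closed (D m)" and f: "\<And>i. continuous_on UNIV (f i)"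
  shows "continuous_on UNIV (glue D e f)"
  unfolding continuous_on_baire_iff
proof
  fix j
  obtain m n where mn: "prod_decode j = (m, n)"
    by fastforce
  consider "m = 0" | "m = 1" | "m > 1"
    by linarith
  then show "continuous_on UNIV (\<lambda>x. glue D e f x j)"
  proof cases
    case 1
    then show ?thesis
      by (simp add: glue_def baire_matrix_def mn)
  next
    case 2
    then show ?thesis
      using continuous_if_clopen[OF D, of "\<lambda>_. Suc (e n)" n] by (simp add: glue_def baire_matrix_def mn)
  next
    case 3
    have "continuous_on UNIV (\<lambda>x. f (e (m - 2)) x n)"
      using f continuous_on_baire_iff by blast
    then have "continuous_on UNIV (\<lambda>x. if x \<in> D (m - 2) then f (e (m - 2)) x n else 0)"
      by (rule continuous_if_clopen[OF D])
    moreover have "glue D e f x j = (if x \<in> D (m - 2) then f (e (m - 2)) x n else 0)" for x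
      using 3 by (simp add: glue_def baire_matrix_def mn)
    ultimately show ?thesis
      by simp
  qed
qed

lemma glue_in:
  assumes "disjoint_family D" "x \<in> D m"
  shows "glue D e f x \<in> piece (e m)" "payload (glue D e f x) = f (e m) x"
proof -
  have D: "x \<in> D k \<longleftrightarrow> k = m" for k
    using assms unfolding disjoint_family_on_def by blast
  have rows: "baire_row 1 (glue D e f x) = (\<lambda>k. if k = m then Suc (e k) else 0)"
    "baire_row (m + 2) (glue D e f x) = f (e m) x"
    unfolding glue_def row_matrix D by simp_all
  have first: "first_label (glue D e f x) = m"
    by (rule first_label_eqI) (simp_all add: rows del: One_nat_def)
  show "glue D e f x \<in> piece (e m)"
    unfolding piece_def mem_Collect_eq first rows by simp
  show "payload (glue D e f x) = f (e m) x"
    unfolding payload_def first rows ..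
qed

lemma glue_out: "x \<notin> (\<Union>m. D m) \<Longrightarrow> glue D e f x \<notin> (\<Union>i. piece i)"
  unfolding piece_iff_nonzero glue_def row_matrix by simp

lemma row_glue: "baire_row 0 (glue D e f x) = x"
  by (simp add: glue_def row_matrix)

text \<open>The common part of the two kinds of branching terms: functions reduced to \<open>B i\<close> on the open sets
  \<open>U i\<close> are reduced to one function that carries \<open>B i\<close> on its \<open>i\<close>-th piece. The free row remembers
  \<open>x\<close>, so nothing is lost on the points outside all \<open>U i\<close>.\<close>

lemma glue_family:
  assumes U: "\<And>i. open (U i)" and f: "\<And>i. continuous_on UNIV (f i)"
    and B: "\<And>i x. x \<in> Y \<inter> U i \<Longrightarrow> A x = B i (f i x)"
    and C: "\<And>x. x \<in> Y - (\<Union>i. U i) \<Longrightarrow> A x = C (x :: baire)"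
  shows "\<exists>g. continuous_on UNIV g \<and>
    (\<forall>x\<in>Y. A x = paste piece (\<lambda>i. B i \<circ> payload) (C \<circ> baire_row 0) (g x))"
proof -
  have "Sigma0 euclidean 1 (U i)" for i
    using U by (simp add: Sigma0_one_iff)
  from Delta0_disjoint_refinement[of 1 U, OF this]
  obtain D e where D: "\<forall>m. Delta0 1 (D m)" "disjoint_family D" "\<forall>m :: nat. D m \<subseteq> U (e m)"
    "(\<Union>m. D m) = (\<Union>i. U i)"
    by (elim exE conjE) (rule that)
  have "continuous_on UNIV (glue D e f)"
    using D(1) f by (intro continuous_glue) (simp_all add: Delta0_one_iff)
  moreover have "A x = paste piece (\<lambda>i. B i \<circ> payload) (C \<circ> baire_row 0) (glue D e f x)"
    if x: "x \<in> Y" for x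
  proof (cases "x \<in> (\<Union>m. D m)")
    case True
    then obtain m where m: "x \<in> D m"
      by blast
    have "paste piece (\<lambda>i. B i \<circ> payload) (C \<circ> baire_row 0) (glue D e f x) = B (e m) (f (e m) x)"
    proof -
      have "disjoint_family piece"
        using open_pieces_piece by (simp add: open_pieces_def)
      from paste_in[OF this glue_in(1)[OF D(2) m]]
      have "paste piece (\<lambda>i. B i \<circ> payload) (C \<circ> baire_row 0) (glue D e f x) =
          (B (e m) \<circ> payload) (glue D e f x)" .
      then show ?thesis
        by (simp add: glue_in(2)[OF D(2) m])
    qed
    moreover have "x \<in> Y \<inter> U (e m)"
      using x m D(3) by blast
    ultimately show ?thesis
      using B by simp
  next
    case False
    then have "x \<in> Y - (\<Union>i. U i)"
      using x D(4) by simp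
    then have "A x = (C \<circ> baire_row 0) (glue D e f x)"
      using C by (simp add: row_glue)
    then show ?thesis
      by (simp only: paste_out[OF glue_out[OF False]])
  qed
  ultimately show ?thesis
    by blast
qed

context
  fixes r h :: "baire set \<Rightarrow> baire \<Rightarrow> baire"
  assumes r: "\<And>C. closed C \<Longrightarrow> C \<noteq> {} \<Longrightarrow> retraction UNIV C (r C)"
    and h: "\<And>U. open U \<Longrightarrow> U \<noteq> {} \<Longrightarrow> homeomorphic_map euclidean (top_of_set U) (h U)"
begin

lemma open_pieces_closed_rest:
  assumes "open_pieces U"
  shows "closed (- (\<Union>i. U i))" "- (\<Union>i. U i) \<noteq> {}"
proof -
  have "open (\<Union>i. U i)"
    using assms by (intro open_UN) (simp add: open_pieces_def)
  then show "closed (- (\<Union>i. U i))"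
    by (simp only: closed_def double_complement)
  show "- (\<Union>i. U i) \<noteq> {}"
    using assms unfolding open_pieces_def by blast
qed

lemma open_pieces_vimage:
  assumes "open_pieces U" "continuous_on UNIV f" "surj f"
  shows "open_pieces (\<lambda>i. f -` U i)"
proof -
  have "f -` U i \<noteq> {}" for i
    using assms(1,3) unfolding open_pieces_def by (metis surj_image_vimage_eq image_empty)
  moreover have "open (f -` U i)" for i
    using assms(1,2) by (simp add: open_pieces_def open_vimage)
  moreover have "f -` (\<Union>i. U i) \<noteq> UNIV"
    using assms(1,3) unfolding open_pieces_def by (metis surj_image_vimage_eq)
  moreover have "disjoint_family (\<lambda>i. f -` U i)"
    using assms(1) unfolding open_pieces_def disjoint_family_on_def by blast
  ultimately show ?thesis
    by (simp add: open_pieces_def vimage_UN)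
qed

lemma range_h: "open U \<Longrightarrow> U \<noteq> {} \<Longrightarrow> range (h U) = U"
  using homeomorphic_imp_surjective_map[OF h[of U]] by simp

lemma continuous_h: "open U \<Longrightarrow> U \<noteq> {} \<Longrightarrow> continuous_on UNIV (h U)"
  using homeomorphic_imp_continuous_map[OF h[of U]] by (simp add: continuous_map_in_subtopology)

lemma lift_surj_between_pieces:
  assumes U: "open U" "U \<noteq> {}" and f: "continuous_on UNIV f" "surj f"
  shows "\<exists>p :: baire \<Rightarrow> baire. continuous_on UNIV p \<and> surj p \<and> f \<circ> h (f -` U) = h U \<circ> p"
proof (rule lift_to_open_piece[OF h[OF U]])
  have V: "open (f -` U)" "f -` U \<noteq> {}"
    using U(1) f(1) by (rule open_vimage) (metis U(2) f(2) surj_image_vimage_eq image_empty)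
  show "continuous_on UNIV (f \<circ> h (f -` U))"
    using continuous_h[OF V] continuous_on_subset[OF f(1) subset_UNIV] by (rule continuous_on_compose)
  show "range (f \<circ> h (f -` U)) = U"
    unfolding image_comp[symmetric] range_h[OF V] by (rule surj_image_vimage_eq[OF f(2)])
qed

text \<open>Surjectivity keeps the preimages of open pieces non-empty and not exhausting, and the maps that
  are induced between pieces are again surjective.\<close>

theorem Sigma_class_compose_surj:
  assumes "A \<in> Sigma_class r h u" "continuous_on UNIV f" "surj f"
  shows "A \<circ> f \<in> Sigma_class r h u"
  using assms
proof (induction u arbitrary: A f)
  case (Const q)
  then show ?case
    by (simp add: comp_def)
next
  case (S a u)
  then show ?case
    unfolding Sigma_class.simps by (intro jump_compose_continuous)
next
  case (FQ q us)
  obtain U where U: "open_pieces U" "\<forall>x\<in>- (\<Union>i. U i). A x = q" "\<forall>i. A \<circ> h (U i) \<in> Sigma_class r h (us i)"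
    using FQ.prems(1) by auto
  have piece: "A \<circ> f \<circ> h (f -` U i) \<in> Sigma_class r h (us i)" for i
  proof -
    have "open (U i)" "U i \<noteq> {}"
      using U(1) by (simp_all add: open_pieces_def)
    from lift_surj_between_pieces[OF this FQ.prems(2,3)]
    obtain p :: "baire \<Rightarrow> baire" where p: "continuous_on UNIV p" "surj p"
      "f \<circ> h (f -` U i) = h (U i) \<circ> p"
      by (elim exE conjE) (rule that)
    have "A \<circ> f \<circ> h (f -` U i) = (A \<circ> h (U i)) \<circ> p"
      using p(3) by (simp add: comp_assoc)
    then show ?thesis
      using FQ.IH[OF rangeI _ p(1,2)] U(3) by metis
  qed
  have "\<forall>x\<in>- (\<Union>i. f -` U i). (A \<circ> f) x = q"
    using U(2) by simp
  then show ?case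
    using open_pieces_vimage[OF U(1) FQ.prems(2,3)] piece unfolding Sigma_class.simps mem_Collect_eq
    by (intro exI[of _ "\<lambda>i. f -` U i"] conjI allI)
next
  case (FA a us)
  obtain U where U: "open_pieces U" "A \<circ> r (- (\<Union>i. U i)) \<in> jump a (Sigma_class r h (us 0))"
    "\<forall>i. A \<circ> h (U i) \<in> Sigma_class r h (us (Suc i))"
    using FA.prems(1) by auto
  have V: "open_pieces (\<lambda>i. f -` U i)"
    using open_pieces_vimage[OF U(1) FA.prems(2,3)] .
  have piece: "A \<circ> f \<circ> h (f -` U i) \<in> Sigma_class r h (us (Suc i))" for i
  proof -
    have "open (U i)" "U i \<noteq> {}"
      using U(1) by (simp_all add: open_pieces_def)
    from lift_surj_between_pieces[OF this FA.prems(2,3)]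
    obtain p :: "baire \<Rightarrow> baire" where p: "continuous_on UNIV p" "surj p"
      "f \<circ> h (f -` U i) = h (U i) \<circ> p"
      by (elim exE conjE) (rule that)
    have "A \<circ> f \<circ> h (f -` U i) = (A \<circ> h (U i)) \<circ> p"
      using p(3) by (simp add: comp_assoc)
    then show ?thesis
      using FA.IH[OF rangeI _ p(1,2)] U(3) by metis
  qed
  have r0: "retraction UNIV (- (\<Union>i. U i)) (r (- (\<Union>i. U i)))"
    by (rule r[OF open_pieces_closed_rest[OF U(1)]])
  have r': "retraction UNIV (- (\<Union>i. f -` U i)) (r (- (\<Union>i. f -` U i)))"
    by (rule r[OF open_pieces_closed_rest[OF V]])
  have eq: "A \<circ> f \<circ> r (- (\<Union>i. f -` U i)) =
      (A \<circ> r (- (\<Union>i. U i))) \<circ> (f \<circ> r (- (\<Union>i. f -` U i)))"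
  proof
    fix x
    have "r (- (\<Union>i. f -` U i)) x \<in> - (\<Union>i. f -` U i)"
      using r' unfolding retraction_def by blast
    then have "f (r (- (\<Union>i. f -` U i)) x) \<in> - (\<Union>i. U i)"
      by simp
    then show "(A \<circ> f \<circ> r (- (\<Union>i. f -` U i))) x =
        ((A \<circ> r (- (\<Union>i. U i))) \<circ> (f \<circ> r (- (\<Union>i. f -` U i)))) x"
      using r0 unfolding retraction_def by (simp only: comp_apply)
  qed
  have cont: "continuous_on UNIV (f \<circ> r (- (\<Union>i. f -` U i)))"
  proof (rule continuous_on_compose)
    show "continuous_on UNIV (r (- (\<Union>i. f -` U i)))"
      using r' unfolding retraction_def by blast
    show "continuous_on (range (r (- (\<Union>i. f -` U i)))) f"
      using FA.prems(2) by (rule continuous_on_subset) simp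
  qed
  have "A \<circ> f \<circ> r (- (\<Union>i. f -` U i)) \<in> jump a (Sigma_class r h (us 0))"
    unfolding eq by (rule jump_compose_continuous[OF U(2) cont])
  then show ?case
    using V piece unfolding Sigma_class.simps mem_Collect_eq
    by (intro exI[of _ "\<lambda>i. f -` U i"] conjI allI)
qed

text \<open>The function \<open>B i\<close> of the payload, read through the homeomorphism onto the \<open>i\<close>-th piece, is \<open>B i\<close>
  composed with a continuous surjection.\<close>

lemma paste_piece_in_Sigma_class:
  assumes "B i \<in> Sigma_class r h u"
  shows "paste piece (\<lambda>i. B i \<circ> payload) C \<circ> h (piece i) \<in> Sigma_class r h u"
proof -
  have piece: "open (piece i)" "piece i \<noteq> {}"
    using open_pieces_piece by (simp_all add: open_pieces_def)
  have range: "range (h (piece i)) = piece i"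
    by (rule range_h[OF piece])
  have eq: "paste piece (\<lambda>i. B i \<circ> payload) C \<circ> h (piece i) = B i \<circ> (payload \<circ> h (piece i))"
  proof
    fix y
    have "h (piece i) y \<in> piece i"
      using range by blast
    moreover have "disjoint_family piece"
      using open_pieces_piece by (simp add: open_pieces_def)
    ultimately show "(paste piece (\<lambda>i. B i \<circ> payload) C \<circ> h (piece i)) y = (B i \<circ> (payload \<circ> h (piece i))) y"
      by (simp add: paste_in)
  qed
  have "continuous_on UNIV (payload \<circ> h (piece i))"
    by (rule continuous_on_compose[OF continuous_h[OF piece]]) (simp only: range continuous_payload)
  moreover have "surj (payload \<circ> h (piece i))"
    unfolding image_comp[symmetric] range by (rule payload_surj)
  ultimately show ?thesis
    unfolding eq by (rule Sigma_class_compose_surj[OF assms])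
qed

text \<open>By \<open>determined_on_unshift\<close> it suffices to treat families of open sets, and these are moved to the
  pieces of the matrix space. For \<open>FA a us\<close> the points outside the open sets keep themselves in the
  free row, so the function there is a jump of a function for \<open>us 0\<close>, evaluated in that row.\<close>

theorem determined_on_imp_Sigma_class:
  fixes Y :: "baire set"
  assumes "determined_on euclidean u 0 Y A"
  shows "\<exists>B f. B \<in> Sigma_class r h u \<and> continuous_on UNIV f \<and> (\<forall>x\<in>Y. A x = B (f x))"
  using assms
proof (induction u arbitrary: Y A)
  case (Const q)
  then show ?case
    by (intro exI[of _ "\<lambda>_. q"] exI[of _ "\<lambda>x. x"]) simp
next
  case (S a u)
  then obtain g A' where g: "Sigma0_measurable (1 + omega_pow a) g"
    "determined_on (euclidean :: baire topology) u 0 UNIV A'" "\<forall>x\<in>Y. A x = A' (g x)"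
    using determined_on_unshift[of u "omega_pow a" Y A] by auto
  obtain B f where B: "B \<in> Sigma_class r h u" "continuous_on UNIV f" "\<forall>x\<in>UNIV. A' x = B (f x)"
    using S.IH[OF g(2)] by blast
  have 1: "B \<circ> (f \<circ> g) \<in> Sigma_class r h (S a u)"
    using B(1) Sigma0_measurable_compose_continuous(1)[OF g(1) B(2)] by (auto simp: jump_def)
  have 2: "\<forall>x\<in>Y. A x = (B \<circ> (f \<circ> g)) (id x)"
    using g(3) B(3) by simp
  show ?case
    by (intro exI conjI) (rule 1 continuous_on_id[folded id_def] 2)+
next
  case (FQ q us)
  obtain U where U: "\<And>i. Sigma0 euclidean (1 + 0) (U i)" "\<forall>x\<in>Y - (\<Union>i. U i). A x = q"
    "\<And>i. determined_on euclidean (us i) 0 (Y \<inter> U i) A"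
    using FQ.prems by auto
  have "\<forall>i. \<exists>Bf. fst Bf \<in> Sigma_class r h (us i) \<and> continuous_on UNIV (snd Bf) \<and>
      (\<forall>x\<in>Y \<inter> U i. A x = fst Bf (snd Bf x))"
    using FQ.IH[OF rangeI U(3)] by simp
  from choice[OF this] obtain Bf where Bf: "\<forall>i. fst (Bf i) \<in> Sigma_class r h (us i) \<and>
      continuous_on UNIV (snd (Bf i)) \<and> (\<forall>x\<in>Y \<inter> U i. A x = fst (Bf i) (snd (Bf i) x))" ..
  define B f where "B i = fst (Bf i)" and "f i = snd (Bf i)" for i
  have B: "B i \<in> Sigma_class r h (us i)" "continuous_on UNIV (f i)"
    "x \<in> Y \<inter> U i \<Longrightarrow> A x = B i (f i x)" for i x
    using Bf by (simp_all add: B_def f_def)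
  let ?B = "paste piece (\<lambda>i. B i \<circ> payload) ((\<lambda>_. q) \<circ> baire_row 0)"
  have "\<exists>g. continuous_on UNIV g \<and> (\<forall>x\<in>Y. A x = ?B (g x))"
  proof (rule glue_family[of U f Y A B])
    show "open (U i)" for i
      using U(1)[of i] by (simp add: Sigma0_one_iff)
    show "continuous_on UNIV (f i)" for i
      by (rule B(2))
    show "A x = B i (f i x)" if "x \<in> Y \<inter> U i" for i x
      by (rule B(3)[OF that])
    show "A x = q" if "x \<in> Y - (\<Union>i. U i)" for x
      using U(2) that by blast
  qed
  then obtain g where g: "continuous_on UNIV g" "\<forall>x\<in>Y. A x = ?B (g x)"
    by blast
  have "?B x = q" if "x \<in> - (\<Union>i. piece i)" for x
    using that by (simp add: paste_out)
  then have "?B \<in> Sigma_class r h (FQ q us)"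
    unfolding Sigma_class.simps mem_Collect_eq
    using open_pieces_piece paste_piece_in_Sigma_class[of B, OF B(1)] by (intro exI[of _ piece]) blast
  then show ?case
    using g by (intro exI conjI)
next
  case (FA a us)
  obtain U where U: "\<And>i. Sigma0 euclidean (1 + 0) (U i)"
    "determined_on euclidean (us 0) (omega_pow a) (Y - (\<Union>i. U i)) A"
    "\<And>i. determined_on euclidean (us (Suc i)) 0 (Y \<inter> U i) A"
    using FA.prems by auto
  have "\<forall>i. \<exists>Bf. fst Bf \<in> Sigma_class r h (us (Suc i)) \<and> continuous_on UNIV (snd Bf) \<and>
      (\<forall>x\<in>Y \<inter> U i. A x = fst Bf (snd Bf x))"
    using FA.IH[OF rangeI U(3)] by simp
  from choice[OF this] obtain Bf where Bf: "\<forall>i. fst (Bf i) \<in> Sigma_class r h (us (Suc i)) \<and>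
      continuous_on UNIV (snd (Bf i)) \<and> (\<forall>x\<in>Y \<inter> U i. A x = fst (Bf i) (snd (Bf i) x))" ..
  define B f where "B i = fst (Bf i)" and "f i = snd (Bf i)" for i
  have B: "B i \<in> Sigma_class r h (us (Suc i))" "continuous_on UNIV (f i)"
    "x \<in> Y \<inter> U i \<Longrightarrow> A x = B i (f i x)" for i x
    using Bf by (simp_all add: B_def f_def)
  obtain g A' where g: "Sigma0_measurable (1 + omega_pow a) g"
    "determined_on (euclidean :: baire topology) (us 0) 0 UNIV A'"
    "\<forall>x\<in>Y - (\<Union>i. U i). A x = A' (g x)"
    using determined_on_unshift[OF U(2)] by blast
  obtain B0 f0 where B0: "B0 \<in> Sigma_class r h (us 0)" "continuous_on UNIV f0"
    "\<forall>x\<in>UNIV. A' x = B0 (f0 x)"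
    using FA.IH[OF rangeI g(2)] by blast
  let ?C = "B0 \<circ> (f0 \<circ> g)"
  let ?B = "paste piece (\<lambda>i. B i \<circ> payload) (?C \<circ> baire_row 0)"
  have "\<exists>g. continuous_on UNIV g \<and> (\<forall>x\<in>Y. A x = ?B (g x))"
  proof (rule glue_family[of U f Y A B])
    show "open (U i)" for i
      using U(1)[of i] by (simp add: Sigma0_one_iff)
    show "continuous_on UNIV (f i)" for i
      by (rule B(2))
    show "A x = B i (f i x)" if "x \<in> Y \<inter> U i" for i x
      by (rule B(3)[OF that])
    show "A x = ?C x" if "x \<in> Y - (\<Union>i. U i)" for x
      using g(3) B0(3) that by simp
  qed
  then obtain g' where g': "continuous_on UNIV g'" "\<forall>x\<in>Y. A x = ?B (g' x)"
    by blast
  let ?r = "r (- (\<Union>i. piece i))"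
  have retr: "retraction UNIV (- (\<Union>i. piece i)) ?r"
    by (rule r[OF open_pieces_closed_rest[OF open_pieces_piece]])
  then have r': "continuous_on UNIV ?r" "?r y \<notin> (\<Union>i. piece i)" for y
    unfolding retraction_def by blast+
  have eq: "?B \<circ> ?r = ?C \<circ> (baire_row 0 \<circ> ?r)"
  proof
    show "(?B \<circ> ?r) y = (?C \<circ> (baire_row 0 \<circ> ?r)) y" for y
    proof -
      have "?B (?r y) = (?C \<circ> baire_row 0) (?r y)"
        by (rule paste_out[OF r'(2)])
      then show ?thesis
        by simp
    qed
  qed
  have "Sigma0_measurable (1 + omega_pow a) (f0 \<circ> g)"
    by (rule Sigma0_measurable_compose_continuous(1)[OF g(1) B0(2)])
  then have "?C \<in> jump a (Sigma_class r h (us 0))"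
    using B0(1) unfolding jump_def by blast
  moreover have "continuous_on UNIV (baire_row 0 \<circ> ?r)"
    by (rule continuous_on_compose[OF r'(1) continuous_row])
  ultimately have "?B \<circ> ?r \<in> jump a (Sigma_class r h (us 0))"
    unfolding eq by (rule jump_compose_continuous)
  then have "?B \<in> Sigma_class r h (FA a us)"
    unfolding Sigma_class.simps mem_Collect_eq
    using open_pieces_piece paste_piece_in_Sigma_class[of B, OF B(1)] by (intro exI[of _ piece]) blast
  then show ?case
    using g' by (intro exI conjI)
qed

end

section \<open>Baire category\<close>

definition meager_in :: "'a topology \<Rightarrow> 'a set \<Rightarrow> bool" where
  "meager_in Z M \<longleftrightarrow> (\<exists>\<C>. countable \<C> \<and> (\<forall>C\<in>\<C>. closedin Z C \<and> Z interior_of C = {}) \<and> M \<subseteq> \<Union>\<C>)"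

lemma meager_in_subset: "meager_in Z M \<Longrightarrow> N \<subseteq> M \<Longrightarrow> meager_in Z N"
  unfolding meager_in_def by (meson order_trans)

lemma meager_in_UN:
  assumes "countable I" "\<And>i. i \<in> I \<Longrightarrow> meager_in Z (M i)"
  shows "meager_in Z (\<Union>i\<in>I. M i)"
proof -
  have "\<forall>i\<in>I. \<exists>\<C>. countable \<C> \<and> (\<forall>C\<in>\<C>. closedin Z C \<and> Z interior_of C = {}) \<and> M i \<subseteq> \<Union>\<C>"
    using assms(2) unfolding meager_in_def by blast
  from bchoice[OF this] obtain \<C> where
    \<C>: "\<forall>i\<in>I. countable (\<C> i) \<and> (\<forall>C\<in>\<C> i. closedin Z C \<and> Z interior_of C = {}) \<and> M i \<subseteq> \<Union>(\<C> i)" ..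
  show ?thesis
    unfolding meager_in_def
  proof (intro exI[of _ "\<Union>i\<in>I. \<C> i"] conjI)
    show "countable (\<Union>i\<in>I. \<C> i)"
      using assms(1) \<C> by (intro countable_UN) blast+
    show "\<forall>C\<in>(\<Union>i\<in>I. \<C> i). closedin Z C \<and> Z interior_of C = {}"
      using \<C> by blast
    show "(\<Union>i\<in>I. M i) \<subseteq> \<Union>(\<Union>i\<in>I. \<C> i)"
      using \<C> by fastforce
  qed
qed

lemma meager_in_empty: "meager_in Z {}"
  unfolding meager_in_def by (intro exI[of _ "{}"]) simp

lemma meager_in_Un:
  assumes "meager_in Z M" "meager_in Z N"
  shows "meager_in Z (M \<union> N)"
proof -
  have "meager_in Z (\<Union>K\<in>{M, N}. K)"
    by (rule meager_in_UN) (use assms in auto)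
  then show ?thesis
    by simp
qed

lemma open_meager_imp_empty:
  assumes "completely_metrizable_space Z" "openin Z U" "meager_in Z U"
  shows "U = {}"
proof -
  obtain \<C> where \<C>: "countable \<C>" "\<forall>C\<in>\<C>. closedin Z C \<and> Z interior_of C = {}" "U \<subseteq> \<Union>\<C>"
    using assms(3) unfolding meager_in_def by blast
  then have "Z interior_of \<Union>\<C> = {}"
    using assms(1) by (intro Baire_category_alt) blast+
  then show ?thesis
    using interior_of_maximal[OF \<C>(3) assms(2)] by simp
qed

definition baire_property :: "'a topology \<Rightarrow> 'a set \<Rightarrow> bool" where
  "baire_property Z W \<longleftrightarrow> (\<exists>G. openin Z G \<and> meager_in Z (W - G) \<and> meager_in Z (G - W))"

lemma baire_property_openin: "openin Z W \<Longrightarrow> baire_property Z W"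
  unfolding baire_property_def by (intro exI[of _ W]) (simp add: meager_in_empty)

lemma baire_property_UN:
  assumes "countable I" "\<And>i. i \<in> I \<Longrightarrow> baire_property Z (W i)"
  shows "baire_property Z (\<Union>i\<in>I. W i)"
proof -
  have "\<forall>i\<in>I. \<exists>G. openin Z G \<and> meager_in Z (W i - G) \<and> meager_in Z (G - W i)"
    using assms(2) unfolding baire_property_def by blast
  from bchoice[OF this] obtain G where
    G: "\<forall>i\<in>I. openin Z (G i) \<and> meager_in Z (W i - G i) \<and> meager_in Z (G i - W i)" ..
  have "meager_in Z (\<Union>i\<in>I. W i - G i)" "meager_in Z (\<Union>i\<in>I. G i - W i)"
    using G assms(1) by (intro meager_in_UN; blast)+
  moreover have "(\<Union>i\<in>I. W i) - (\<Union>i\<in>I. G i) \<subseteq> (\<Union>i\<in>I. W i - G i)"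
    "(\<Union>i\<in>I. G i) - (\<Union>i\<in>I. W i) \<subseteq> (\<Union>i\<in>I. G i - W i)"
    by blast+
  moreover have "openin Z (\<Union>i\<in>I. G i)"
    using G by (intro openin_Union) blast
  ultimately show ?thesis
    unfolding baire_property_def using meager_in_subset by (intro exI[of _ "\<Union>i\<in>I. G i"]) blast
qed

text \<open>The complement of an open set differs from its interior by a boundary, which is closed with empty
  interior.\<close>

lemma baire_property_compl:
  assumes "baire_property Z W"
  shows "baire_property Z (topspace Z - W)"
proof -
  obtain G where G: "openin Z G" "meager_in Z (W - G)" "meager_in Z (G - W)"
    using assms unfolding baire_property_def by blast
  let ?C = "topspace Z - G"
  have closed: "closedin Z ?C"
    using G(1) by blast
  have "closedin Z (?C - Z interior_of ?C)"
    by (rule closedin_diff[OF closed openin_interior_of])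
  moreover have "Z interior_of (?C - Z interior_of ?C) = {}"
  proof -
    have "Z interior_of (?C - Z interior_of ?C) \<subseteq> Z interior_of ?C"
      by (intro interior_of_mono) blast
    then show ?thesis
      using interior_of_subset[of Z "?C - Z interior_of ?C"] by blast
  qed
  ultimately have boundary: "meager_in Z (?C - Z interior_of ?C)"
    unfolding meager_in_def by (intro exI[of _ "{?C - Z interior_of ?C}"]) simp
  have "(topspace Z - W) - Z interior_of ?C \<subseteq> (G - W) \<union> (?C - Z interior_of ?C)"
    by blast
  then have "meager_in Z ((topspace Z - W) - Z interior_of ?C)"
    using meager_in_Un[OF G(3) boundary] meager_in_subset by blast
  moreover have "Z interior_of ?C - (topspace Z - W) \<subseteq> W - G"
    using interior_of_subset[of Z ?C] by blast
  then have "meager_in Z (Z interior_of ?C - (topspace Z - W))"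
    using G(2) meager_in_subset by blast
  ultimately show ?thesis
    unfolding baire_property_def by (intro exI[of _ "Z interior_of ?C"]) simp
qed

lemma baire_property_Diff:
  assumes "baire_property Z A" "baire_property Z B" "A \<subseteq> topspace Z"
  shows "baire_property Z (A - B)"
proof -
  have "baire_property Z (\<Union>W\<in>{topspace Z - A, B}. W)"
    by (rule baire_property_UN) (use assms baire_property_compl in auto)
  then have "baire_property Z (topspace Z - (\<Union>W\<in>{topspace Z - A, B}. W))"
    by (rule baire_property_compl)
  moreover have "topspace Z - (\<Union>W\<in>{topspace Z - A, B}. W) = A - B"
    using assms(3) by auto
  ultimately show ?thesis
    by simp
qed

lemma Sigma0_baire_property:
  assumes "Sigma0 Z a W"
  shows "baire_property (subtopology Z E) (E \<inter> W)"
  using assms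
proof (induction a arbitrary: W rule: less_induct)
  case (less a)
  show ?case
  proof (cases "1 < a")
    case True
    obtain b and A B :: "nat \<Rightarrow> _" where
      AB: "\<forall>n. 0 < b n \<and> b n < a \<and> Sigma0 Z (b n) (A n) \<and> Sigma0 Z (b n) (B n)"
      and W: "W = (\<Union>n. A n - B n)"
      using Sigma0_as_differences[OF less.prems True] by blast
    have "baire_property (subtopology Z E) ((E \<inter> A n) - (E \<inter> B n))" for n
    proof (rule baire_property_Diff)
      show "baire_property (subtopology Z E) (E \<inter> A n)" "baire_property (subtopology Z E) (E \<inter> B n)"
        using less.IH AB by blast+
      show "E \<inter> A n \<subseteq> topspace (subtopology Z E)"
        using AB Sigma0_subset[of Z "b n" "A n"] by auto
    qed
    then have "baire_property (subtopology Z E) (\<Union>n. (E \<inter> A n) - (E \<inter> B n))"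
      by (intro baire_property_UN) simp_all
    moreover have "E \<inter> W = (\<Union>n. (E \<inter> A n) - (E \<inter> B n))"
      unfolding W by blast
    ultimately show ?thesis
      by simp
  next
    case False
    then have "a = 1"
      using Sigma0_pos[OF less.prems] one_le_iff_omega1[of a] by (meson antisym not_less)
    then have "openin (subtopology Z E) (E \<inter> W)"
      using less.prems by (auto simp: Sigma0_one_iff openin_subtopology_Int2)
    then show ?thesis
      by (rule baire_property_openin)
  qed
qed

lemma nonmeager_localize:
  assumes "baire_property Z W" "\<not> meager_in Z W"
  shows "\<exists>G. openin Z G \<and> G \<noteq> {} \<and> meager_in Z (G - W)"
proof -
  obtain G where G: "openin Z G" "meager_in Z (W - G)" "meager_in Z (G - W)"
    using assms(1) unfolding baire_property_def by blast
  have "G \<noteq> {}"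
    using G(2) assms(2) by auto
  then show ?thesis
    using G by blast
qed

section \<open>Descent along open maps\<close>

text \<open>The points whose fibre meets \<open>W\<close> in a non-meager set. For open maps with Baire fibres this
  replaces the image: on open sets it is the image, it commutes with countable unions, and it loses
  nothing in the level of the hierarchy.\<close>

definition nonmeager_image :: "(baire \<Rightarrow> 'a) \<Rightarrow> baire set \<Rightarrow> 'a set" where
  "nonmeager_image f W = {x. \<not> meager_in (top_of_set (f -` {x})) (f -` {x} \<inter> W)}"

lemma nonmeager_image_mono: "V \<subseteq> W \<Longrightarrow> nonmeager_image f V \<subseteq> nonmeager_image f W"
  unfolding nonmeager_image_def using meager_in_subset by (blast dest: Int_mono)

lemma nonmeager_image_UN:
  assumes "countable I"
  shows "nonmeager_image f (\<Union>i\<in>I. W i) = (\<Union>i\<in>I. nonmeager_image f (W i))"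
proof
  show "(\<Union>i\<in>I. nonmeager_image f (W i)) \<subseteq> nonmeager_image f (\<Union>i\<in>I. W i)"
    by (intro UN_least nonmeager_image_mono) blast
  show "nonmeager_image f (\<Union>i\<in>I. W i) \<subseteq> (\<Union>i\<in>I. nonmeager_image f (W i))"
  proof (rule subsetI, rule ccontr)
    fix x assume x: "x \<in> nonmeager_image f (\<Union>i\<in>I. W i)" "x \<notin> (\<Union>i\<in>I. nonmeager_image f (W i))"
    have "meager_in (top_of_set (f -` {x})) (f -` {x} \<inter> W i)" if "i \<in> I" for i
      using x(2) that unfolding nonmeager_image_def by blast
    then have "meager_in (top_of_set (f -` {x})) (\<Union>i\<in>I. f -` {x} \<inter> W i)"
      by (rule meager_in_UN[OF assms])
    moreover have "(\<Union>i\<in>I. f -` {x} \<inter> W i) = f -` {x} \<inter> (\<Union>i\<in>I. W i)"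
      by blast
    ultimately show False
      using x(1) unfolding nonmeager_image_def mem_Collect_eq by metis
  qed
qed

lemma nonmeager_image_Un:
  "nonmeager_image f (V \<union> W) = nonmeager_image f V \<union> nonmeager_image f W"
  using nonmeager_image_UN[of "{V, W}" f "\<lambda>W. W"] by simp

lemma nonmeager_image_rest:
  assumes "x \<in> nonmeager_image f Y" "x \<notin> (\<Union>i :: nat. nonmeager_image f (Y \<inter> U i))"
  shows "x \<in> nonmeager_image f (Y - (\<Union>i. U i))"
proof -
  have "Y = (Y - (\<Union>i. U i)) \<union> (\<Union>i. Y \<inter> U i)"
    by blast
  then have "nonmeager_image f Y =
      nonmeager_image f (Y - (\<Union>i. U i)) \<union> (\<Union>i. nonmeager_image f (Y \<inter> U i))"
    using nonmeager_image_Un[of f "Y - (\<Union>i. U i)" "\<Union>i. Y \<inter> U i"]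
      nonmeager_image_UN[of UNIV f "\<lambda>i. Y \<inter> U i"] by simp
  then show ?thesis
    using assms by blast
qed

lemma nonmeager_image_subset: "nonmeager_image f W \<subseteq> f ` W"
proof
  fix x assume "x \<in> nonmeager_image f W"
  then have "f -` {x} \<inter> W \<noteq> {}"
    by (auto simp: nonmeager_image_def meager_in_empty)
  then show "x \<in> f ` W"
    by blast
qed

context
  fixes X :: "'a topology" and \<xi> :: "baire \<Rightarrow> 'a"
  assumes open_map: "open_map euclidean X \<xi>"
    and fibres: "\<And>x. x \<in> topspace X \<Longrightarrow> completely_metrizable_space (top_of_set (\<xi> -` {x}))"
begin

lemma open_map_topspace: "\<xi> y \<in> topspace X"
  using open_map_imp_subset_topspace[OF open_map] by auto

lemma nonmeager_image_open:
  assumes "open W"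
  shows "nonmeager_image \<xi> W = \<xi> ` W"
proof
  show "\<xi> ` W \<subseteq> nonmeager_image \<xi> W"
  proof safe
    fix y assume y: "y \<in> W"
    let ?E = "\<xi> -` {\<xi> y}"
    have "openin (top_of_set ?E) (?E \<inter> W)"
      using assms by (simp add: openin_open_Int)
    then have "\<not> meager_in (top_of_set ?E) (?E \<inter> W)"
      using open_meager_imp_empty[OF fibres[OF open_map_topspace]] y by blast
    then show "\<xi> y \<in> nonmeager_image \<xi> W"
      by (simp add: nonmeager_image_def)
  qed
qed (rule nonmeager_image_subset)

text \<open>By the Baire property, a non-meager trace of \<open>A - B\<close> on a fibre is comeager in some basic open
  piece of the fibre. There \<open>A\<close> is non-meager and \<open>B\<close> is meager.\<close>

lemma nonmeager_image_Diff:
  assumes A: "Sigma0 euclidean a A" and B: "Sigma0 euclidean b B"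
  shows "nonmeager_image \<xi> (A - B) =
    (\<Union>s. nonmeager_image \<xi> (cylinder s \<inter> A) - nonmeager_image \<xi> (cylinder s \<inter> B))"
proof (intro equalityI subsetI)
  fix x assume "x \<in> (\<Union>s. nonmeager_image \<xi> (cylinder s \<inter> A) - nonmeager_image \<xi> (cylinder s \<inter> B))"
  then obtain s where s: "x \<in> nonmeager_image \<xi> (cylinder s \<inter> A)" "x \<notin> nonmeager_image \<xi> (cylinder s \<inter> B)"
    by blast
  have "cylinder s \<inter> A \<subseteq> (A - B) \<union> (cylinder s \<inter> B)"
    by blast
  from subsetD[OF nonmeager_image_mono[OF this] s(1)]
  show "x \<in> nonmeager_image \<xi> (A - B)"
    using s(2) by (simp add: nonmeager_image_Un)
next
  fix x assume x: "x \<in> nonmeager_image \<xi> (A - B)"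
  let ?E = "\<xi> -` {x}"
  let ?Z = "top_of_set ?E"
  have E: "completely_metrizable_space ?Z"
    using x nonmeager_image_subset[of \<xi> "A - B"] open_map_topspace by (intro fibres) auto
  have "baire_property ?Z ((?E \<inter> A) - (?E \<inter> B))"
    using A B by (intro baire_property_Diff Sigma0_baire_property) auto
  moreover have "(?E \<inter> A) - (?E \<inter> B) = ?E \<inter> (A - B)"
    by blast
  ultimately have "baire_property ?Z (?E \<inter> (A - B))"
    by simp
  then obtain G where G: "openin ?Z G" "G \<noteq> {}" "meager_in ?Z (G - ?E \<inter> (A - B))"
    using nonmeager_localize x unfolding nonmeager_image_def by blast
  obtain V where V: "open V" "G = ?E \<inter> V"
    using G(1) unfolding openin_open by blast
  obtain y where y: "y \<in> ?E" "y \<in> V"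
    using G(2) V(2) by blast
  obtain s where s: "y \<in> cylinder s" "cylinder s \<subseteq> V"
    using y(2) open_eq_Union_cylinder[OF V(1)] by blast
  have small: "meager_in ?Z M" if "M \<subseteq> ?E \<inter> cylinder s" "M \<inter> (A - B) = {}" for M
    using G(3) by (rule meager_in_subset) (use that s(2) V(2) in blast)
  have "meager_in ?Z (?E \<inter> (cylinder s \<inter> B))"
    by (rule small) blast+
  moreover have "\<not> meager_in ?Z (?E \<inter> (cylinder s \<inter> A))"
  proof
    assume "meager_in ?Z (?E \<inter> (cylinder s \<inter> A))"
    moreover have "meager_in ?Z (?E \<inter> cylinder s - A)"
      by (rule small) blast+
    ultimately have "meager_in ?Z (?E \<inter> (cylinder s \<inter> A) \<union> (?E \<inter> cylinder s - A))"
      by (rule meager_in_Un)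
    moreover have "?E \<inter> (cylinder s \<inter> A) \<union> (?E \<inter> cylinder s - A) = ?E \<inter> cylinder s"
      by blast
    moreover have "openin ?Z (?E \<inter> cylinder s)"
      by (intro openin_open_Int open_cylinder)
    ultimately show False
      using open_meager_imp_empty[OF E] y(1) s(1) by (metis IntI empty_iff)
  qed
  ultimately show "x \<in> (\<Union>s. nonmeager_image \<xi> (cylinder s \<inter> A) - nonmeager_image \<xi> (cylinder s \<inter> B))"
    by (intro UN_I[of s]) (simp_all add: nonmeager_image_def)
qed

text \<open>Intersecting with a clopen cylinder does not raise the level, so the induction hypothesis applies
  to the sets in \<open>nonmeager_image_Diff\<close>.\<close>

theorem Sigma0_nonmeager_image:
  "Sigma0 euclidean a W \<Longrightarrow> Sigma0 X a (nonmeager_image \<xi> W)"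
proof (induction a arbitrary: W rule: less_induct)
  case (less a)
  show ?case
  proof (cases "1 < a")
    case True
    obtain b and A B :: "nat \<Rightarrow> _" where
      AB: "\<forall>n. 0 < b n \<and> b n < a \<and> Sigma0 euclidean (b n) (A n) \<and> Sigma0 euclidean (b n) (B n)"
      and W: "W = (\<Union>n. A n - B n)"
      using Sigma0_as_differences[OF less.prems True] by blast
    have cyl: "Sigma0 X (b n) (nonmeager_image \<xi> (cylinder s \<inter> A n))"
      "Sigma0 X (b n) (nonmeager_image \<xi> (cylinder s \<inter> B n))" for n s
    proof -
      have "Sigma0 euclidean (b n) (cylinder s)"
        using AB by (intro Sigma0_openin) (simp_all add: open_cylinder)
      then have "Sigma0 euclidean (b n) (cylinder s \<inter> A n)" "Sigma0 euclidean (b n) (cylinder s \<inter> B n)"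
        using AB by (simp_all add: Sigma0_Int)
      then show "Sigma0 X (b n) (nonmeager_image \<xi> (cylinder s \<inter> A n))"
        "Sigma0 X (b n) (nonmeager_image \<xi> (cylinder s \<inter> B n))"
        using less.IH AB by blast+
    qed
    have "Sigma0 X a (nonmeager_image \<xi> (A n - B n))" for n
    proof -
      have "nonmeager_image \<xi> (A n - B n) =
          (\<Union>s. nonmeager_image \<xi> (cylinder s \<inter> A n) - nonmeager_image \<xi> (cylinder s \<inter> B n))"
        using AB by (intro nonmeager_image_Diff[of "b n" _ "b n"]) blast+
      moreover have "Sigma0 X a (\<Union>s. nonmeager_image \<xi> (cylinder s \<inter> A n) - nonmeager_image \<xi> (cylinder s \<inter> B n))"
      proof (rule Sigma0_UN)
        show "0 < a"
          by (rule Sigma0_pos[OF less.prems])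
        show "Sigma0 X a (nonmeager_image \<xi> (cylinder s \<inter> A n) - nonmeager_image \<xi> (cylinder s \<inter> B n))" for s
          using AB by (intro Sigma0_Diff[OF cyl(1) cyl(2)]) (auto intro: less_imp_le)
      qed simp
      ultimately show ?thesis
        by simp
    qed
    then have "Sigma0 X a (\<Union>n. nonmeager_image \<xi> (A n - B n))"
      by (rule Sigma0_UN_nat)
    then show ?thesis
      unfolding W by (simp add: nonmeager_image_UN)
  next
    case False
    then have a: "a = 1"
      using Sigma0_pos[OF less.prems] one_le_iff_omega1[of a] by (meson antisym not_less)
    then have "open W"
      using less.prems by (simp add: Sigma0_one_iff)
    then have "openin X (\<xi> ` W)"
      using open_map by (simp add: open_map_def)
    then show ?thesis
      using \<open>open W\<close> by (simp add: a Sigma0_one_iff nonmeager_image_open)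
  qed
qed

text \<open>A family upstairs is pushed down by replacing every set by its non-meager image. Each \<open>x\<close> is sent to
  a component that contains a non-meager part of its fibre, and one point of this part determines
  \<open>A x\<close>. The bound on the level of \<open>Y\<close> is an invariant: intersections with sets of the family keep it,
  and the difference that is left over at a branching has the level to which the base is shifted.\<close>

theorem determined_on_nonmeager_image:
  assumes "determined_on euclidean u b Y (A \<circ> \<xi>)" "Sigma0 euclidean (1 + b) Y" "D \<subseteq> nonmeager_image \<xi> Y"
  shows "determined_on X u b D A"
  using assms
proof (induction u arbitrary: b Y D)
  case (Const q)
  then show ?case
    using nonmeager_image_subset[of \<xi> Y] by auto
next
  case (S a u)
  have "b \<le> b + omega_pow a"
    by simp
  then have "Sigma0 euclidean (1 + (b + omega_pow a)) Y"
    using S.prems(2) add_mono_omega1 Sigma0_mono by blast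
  then show ?case
    using S.prems S.IH[of "b + omega_pow a" Y D] by simp
next
  case (FQ q us)
  obtain U where U: "\<And>i. Sigma0 euclidean (1 + b) (U i)" "\<forall>x\<in>Y - (\<Union>i. U i). (A \<circ> \<xi>) x = q"
    "\<And>i. determined_on euclidean (us i) b (Y \<inter> U i) (A \<circ> \<xi>)"
    using FQ.prems(1) unfolding determined_on.simps by blast
  let ?V = "\<lambda>i. nonmeager_image \<xi> (Y \<inter> U i)"
  have YU: "Sigma0 euclidean (1 + b) (Y \<inter> U i)" for i
    using FQ.prems(2) U(1) by (rule Sigma0_Int)
  then have "Sigma0 X (1 + b) (?V i)" for i
    by (rule Sigma0_nonmeager_image)
  moreover have "determined_on X (us i) b (D \<inter> ?V i) A" for i
    using U(3) YU by (rule FQ.IH[OF rangeI]) blast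
  moreover have "A x = q" if x: "x \<in> D - (\<Union>i. ?V i)" for x
  proof -
    have "x \<in> nonmeager_image \<xi> (Y - (\<Union>i. U i))"
      by (rule nonmeager_image_rest) (use x FQ.prems(3) in blast)+
    then have "x \<in> \<xi> ` (Y - (\<Union>i. U i))"
      by (rule subsetD[OF nonmeager_image_subset])
    then obtain y where y: "y \<in> Y - (\<Union>i. U i)" "x = \<xi> y"
      by blast
    have "(A \<circ> \<xi>) y = q"
      using U(2) y(1) by (rule bspec)
    then show ?thesis
      by (simp add: y(2))
  qed
  ultimately show ?case
    unfolding determined_on.simps by (intro exI[of _ ?V]) blast
next
  case (FA a us)
  obtain U where U: "\<And>i. Sigma0 euclidean (1 + b) (U i)"
    "determined_on euclidean (us 0) (b + omega_pow a) (Y - (\<Union>i. U i)) (A \<circ> \<xi>)"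
    "\<And>i. determined_on euclidean (us (Suc i)) b (Y \<inter> U i) (A \<circ> \<xi>)"
    using FA.prems(1) unfolding determined_on.simps by blast
  let ?V = "\<lambda>i. nonmeager_image \<xi> (Y \<inter> U i)"
  have YU: "Sigma0 euclidean (1 + b) (Y \<inter> U i)" for i
    using FA.prems(2) U(1) by (rule Sigma0_Int)
  then have "Sigma0 X (1 + b) (?V i)" for i
    by (rule Sigma0_nonmeager_image)
  moreover have "determined_on X (us (Suc i)) b (D \<inter> ?V i) A" for i
    using U(3) YU by (rule FA.IH[OF rangeI]) blast
  moreover have "determined_on X (us 0) (b + omega_pow a) (D - (\<Union>i. ?V i)) A"
    using U(2)
  proof (rule FA.IH[OF rangeI])
    have "1 + b < 1 + (b + omega_pow a)"
      using add_strict_mono_omega1[OF omega_pow_pos[of a], of b] by (simp add: add_strict_mono_omega1)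
    then show "Sigma0 euclidean (1 + (b + omega_pow a)) (Y - (\<Union>i. U i))"
      using FA.prems(2) Sigma0_UN_nat[of euclidean "1 + b" U, OF U(1)]
      by (intro Sigma0_Diff[of _ "1 + b" _ "1 + b"]) (auto intro: less_imp_le)
    show "D - (\<Union>i. ?V i) \<subseteq> nonmeager_image \<xi> (Y - (\<Union>i. U i))"
    proof
      fix x assume "x \<in> D - (\<Union>i. ?V i)"
      then show "x \<in> nonmeager_image \<xi> (Y - (\<Union>i. U i))"
        using FA.prems(3) by (intro nonmeager_image_rest) blast+
    qed
  qed
  ultimately show ?case
    unfolding determined_on.simps by (intro exI[of _ ?V]) blast
qed

end

section \<open>Fibres over quasi-Polish spaces\<close>

lemma openin_scott_member: "openin scott_topology {A. n \<in> A}"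
proof -
  have "{A. {n} \<subseteq> A} \<in> {{A. F \<subseteq> A} |F. finite F}"
    by blast
  then show ?thesis
    unfolding scott_topology_def using topology_generated_by_Basis[of "{A. {n} \<subseteq> A}"] by simp
qed

lemma completely_metrizable_space_baire: "completely_metrizable_space (euclidean :: baire topology)"
proof -
  have "(euclidean :: nat topology) = discrete_topology UNIV"
    by (simp add: topology_eq open_discrete)
  then have "completely_metrizable_space (euclidean :: nat topology)"
    by (simp add: completely_metrizable_space_discrete_topology)
  then have "completely_metrizable_space (product_topology (\<lambda>_. euclidean :: nat topology) (UNIV :: nat set))"
    unfolding completely_metrizable_space_product_topology by simp
  then show ?thesis
    by (simp add: euclidean_product_topology)
qed

text \<open>A point of \<open>P(\<omega>)\<close> is the intersection of countably many sets that are open or closed, and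
  open and closed subsets of the Baire space are both \<open>G\<^sub>\<delta>\<close>.\<close>

lemma completely_metrizable_space_fibre:
  assumes X: "quasi_polish X" and f: "continuous_map euclidean X f" and x: "x \<in> topspace X"
  shows "completely_metrizable_space (top_of_set (f -` {x} :: baire set))"
proof -
  obtain P where "X homeomorphic_space subtopology scott_topology P"
    using X unfolding quasi_polish_def by blast
  then obtain e where e: "homeomorphic_map X (subtopology scott_topology P) e"
    unfolding homeomorphic_space by blast
  have "continuous_map X scott_topology e"
    using homeomorphic_imp_continuous_map[OF e] by (simp add: continuous_map_in_subtopology)
  then have cont: "continuous_map euclidean scott_topology (e \<circ> f)"
    using f continuous_map_compose by blast
  have inj: "inj_on e (topspace X)"
    by (rule homeomorphic_imp_injective_map[OF e])
  have f_in: "f y \<in> topspace X" for y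
    using continuous_map_image_subset_topspace[OF f] by auto
  define G where "G n = {y. n \<in> e (f y) \<longleftrightarrow> n \<in> e x}" for n
  have opn: "open {y. n \<in> e (f y)}" for n
    using openin_continuous_map_preimage[OF cont openin_scott_member[of n]] by simp
  have "gdelta_in euclidean (G n)" for n
  proof (cases "n \<in> e x")
    case True
    then show ?thesis
      using opn[of n] by (intro open_imp_gdelta_in) (simp add: G_def)
  next
    case False
    then have "G n = - {y. n \<in> e (f y)}"
      by (auto simp: G_def)
    then have "closedin euclidean (G n)"
      using opn[of n] by (simp add: closed_Compl)
    then show ?thesis
      using closed_imp_gdelta_in completely_metrizable_imp_metrizable_space completely_metrizable_space_baire
      by blast
  qed
  then have "gdelta_in euclidean (\<Inter>(range G))"
    by (intro gdelta_in_Inter) auto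
  moreover have "f -` {x} = \<Inter>(range G)"
  proof -
    have "f y = x \<longleftrightarrow> e (f y) = e x" for y
      using inj_on_eq_iff[OF inj f_in x] by simp
    then show ?thesis
      by (auto simp: G_def set_eq_iff)
  qed
  ultimately show ?thesis
    using completely_metrizable_space_gdelta_in[OF completely_metrizable_space_baire] by simp
qed

theorem theorem7:
  fixes X :: "'a topology" and k :: nat and T :: "nat ltree"
    and r h :: "baire set \<Rightarrow> baire \<Rightarrow> baire" and \<xi> :: "baire \<Rightarrow> 'a"
  assumes "quasi_polish X"
    and "k > 0"
    and "T \<in> ltrees {..<k}"
    and "\<And>C. closed C \<Longrightarrow> C \<noteq> {} \<Longrightarrow> retraction UNIV C (r C)"
    and "\<And>U. open U \<Longrightarrow> U \<noteq> {} \<Longrightarrow> homeomorphic_map euclidean (top_of_set U) (h U)"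
    and "continuous_map euclidean X \<xi>" and "open_map euclidean X \<xi>" and "range \<xi> = topspace X"
  shows "wadge_level r h \<xi> {..<k} (=) X T = tree_level {..<k} X T"
proof -
  let ?u = "term_of {..<k} T"
  have fibres: "completely_metrizable_space (top_of_set (\<xi> -` {x}))" if "x \<in> topspace X" for x
    using completely_metrizable_space_fibre[OF assms(1,6) that] .
  have "(\<exists>B\<in>Sigma_class r h ?u. wadge_le (=) (A \<circ> \<xi>) B) \<longleftrightarrow> determined_on X ?u 0 (topspace X) A"
    for A :: "'a \<Rightarrow> nat"
  proof
    assume "\<exists>B\<in>Sigma_class r h ?u. wadge_le (=) (A \<circ> \<xi>) B"
    then obtain B f where B: "B \<in> Sigma_class r h ?u" and f: "continuous_on UNIV f"
      "\<forall>x. (A \<circ> \<xi>) x = B (f x)"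
      unfolding wadge_le_def by blast
    have "determined_on euclidean ?u 0 UNIV B"
      by (rule Sigma_class_determined_on[of r h]) (simp_all add: assms(4,5) B)
    then have "determined_on euclidean ?u 0 UNIV (B \<circ> f)"
      using determined_on_continuous_map[of euclidean euclidean f ?u 0 B] f(1) by simp
    moreover have "B \<circ> f = A \<circ> \<xi>"
      using f(2) by auto
    ultimately have "determined_on euclidean ?u 0 UNIV (A \<circ> \<xi>)"
      by simp
    moreover have "Sigma0 (euclidean :: baire topology) (1 + 0) UNIV"
      by (simp add: Sigma0_one_iff)
    moreover have "topspace X \<subseteq> nonmeager_image \<xi> UNIV"
    proof -
      have "nonmeager_image \<xi> UNIV = range \<xi>"
        by (rule nonmeager_image_open[OF assms(7)]) (simp_all add: fibres)
      then show ?thesis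
        using assms(8) by simp
    qed
    ultimately show "determined_on X ?u 0 (topspace X) A"
      by (intro determined_on_nonmeager_image[OF assms(7) _, of ?u 0 UNIV]) (simp_all add: fibres)
  next
    assume "determined_on X ?u 0 (topspace X) A"
    then have "determined_on euclidean ?u 0 UNIV (A \<circ> \<xi>)"
      using determined_on_continuous_map[OF assms(6)] by simp
    then have "\<exists>B f. B \<in> Sigma_class r h ?u \<and> continuous_on UNIV f \<and> (\<forall>x\<in>UNIV. (A \<circ> \<xi>) x = B (f x))"
      by (rule determined_on_imp_Sigma_class[of r h, rotated 2]) (simp_all add: assms(4,5))
    then show "\<exists>B\<in>Sigma_class r h ?u. wadge_le (=) (A \<circ> \<xi>) B"
      unfolding wadge_le_def by blast
  qed
  moreover have "A \<circ> \<xi> \<in> UNIV \<rightarrow> {..<k}" if "A \<in> topspace X \<rightarrow>\<^sub>E {..<k}" for A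
  proof
    fix y
    have "\<xi> y \<in> topspace X"
      using assms(8) by blast
    then show "(A \<circ> \<xi>) y \<in> {..<k}"
      using PiE_mem[OF that] by simp
  qed
  ultimately have "A \<circ> \<xi> \<in> wadge_baire r h {..<k} (=) T \<longleftrightarrow> determined_on X ?u 0 (topspace X) A"
    if "A \<in> topspace X \<rightarrow>\<^sub>E {..<k}" for A
    using that unfolding wadge_baire_def by simp
  then show ?thesis
    unfolding wadge_level_def tree_level_def level_borel_base by (intro Collect_cong conj_cong refl)
qed

end
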